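(* For every $e\in(0,1)$ the manifold $M$ of Kepler ellipses of minimal period $2\pi$ is a nondegenerate critical manifold of the Kepler action $\mathcal{A}_0$ at the planar Kepler ellipse $u_e$. The Hessian $\mathcal{L}_e:=\nabla^2\mathcal{A}_0(u_e)$, acting on $2\pi$-periodic vector fields, has kernel $$\ker\mathcal{L}_e=\operatorname{span}\{\,\partial_\tau u_e,\ \partial_e u_e,\ J_1u_e,\ J_2u_e,\ J_3u_e\,\},$$ which is five-dimensional and coincides with the tangent space $T_{u_e}M$.
   Context: Let $X$ be the space of $2\pi$-periodic $H^2_{\mathrm{loc}}$ maps $u:\mathbb{R}\to\mathbb{R}^3$. The Kepler action is $$\mathcal{A}_0(u)=\int_0^{2\pi}\frac{|\dot u|^2}{2}+\frac1{|u|}\,d\tau ,$$ defined on the $u\in X$ that never vanish. Gradient and Hessian are taken in the $L^2(0,2\pi)$ inner product, so $\nabla\mathcal{A}_0(u)=-\ddot u-u/|u|^3$ and $$\nabla^2\mathcal{A}_0(u)\eta=-\ddot\eta-\frac{\eta}{|u|^3}+3\,\frac{u\,\langle u,\eta\rangle}{|u|^5}.$$ Planar reference ellipse: for $e\in[0,1)$ put $c_e=\sqrt{1-e^2}$ and $$u_e(\tau)=r\,(\cos\theta,\sin\theta,0),\qquad r=\frac{c_e^2}{1+e\cos\theta},\qquad \dot\theta=\frac{c_e}{r^2}=\frac{(1+e\cos\theta)^2}{c_e^3},\qquad \theta(0)=0 ;$$ it is a $2\pi$-periodic solution of the Kepler equation $\ddot u=-u/|u|^3$. $\partial_e u_e$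 is the derivative in $e$ at fixed $\tau$, and $\partial_\tau u_e=\dot u_e$. Basis of $\mathfrak{so}(3)$: $$J_1=\begin{pmatrix}0&0&0\\0&0&-1\\0&1&0\end{pmatrix},\quad J_2=\begin{pmatrix}0&0&-1\\0&0&0\\1&0&0\end{pmatrix},\quad J_3=\begin{pmatrix}0&-1&0\\1&0&0\\0&0&0\end{pmatrix}.$$ For $\psi=(\psi_1,\psi_2,\psi_3)$ put $R(\psi)=e^{\psi_1J_1}e^{\psi_2J_2}e^{\psi_3J_3}$ and $u_{e,\psi}=R(\psi)u_e$. The manifold $M$ is the five-dimensional set of curves $$M=\{\,u_{e,\psi}(\cdot+\varphi): e\in[0,1),\ \psi\in\mathbb{R}^3,\ \varphi\in S^1=\mathbb{R}/2\pi\mathbb{Z}\,\}\subset X ,$$ all of which are critical points of $\mathcal{A}_0$; near $u_e$ with $0<e<1$ it is parametrized by $(e,\psi,\varphi)$, and $T_{u_e}M$ is the tangent space of $M$ at $u_e$. "$M$ is a nondegenerate critical manifold of $\mathcal{A}_0$ at $u\in M$" means that the points of $M$ are critical points of $\mathcal{A}_0$ and $\ker\nabla^2\mathcal{A}_0(u)=T_uM$. *)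

theory Defs
  imports "HOL-Analysis.Analysis" "HOL-Library.Function_Algebras"
begin

text \<open>
  Curves are functions \<open>real \<Rightarrow> real ^ 3\<close>; the pointwise vector space structure makes
  \<^const>\<open>span\<close> and \<^const>\<open>dim\<close> available for sets of curves.
\<close>

instantiation "fun" :: (type, real_vector) real_vector
begin

definition scaleR_fun :: "real \<Rightarrow> ('a \<Rightarrow> 'b) \<Rightarrow> 'a \<Rightarrow> 'b" where
  "scaleR_fun c f = (\<lambda>x. c *\<^sub>R f x)"

instance
  by standard
    (simp_all add: scaleR_fun_def fun_eq_iff scaleR_add_right scaleR_add_left)

end

type_synonym curve = "real \<Rightarrow> real ^ 3"


section \<open>Periodic curves of class \<open>H\<^sup>2\<close>\<close>

definition L2_on :: "real \<Rightarrow> real \<Rightarrow> curve \<Rightarrow> bool" where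
  "L2_on a b f \<longleftrightarrow>
     set_borel_measurable lborel {a..b} f \<and>
     set_integrable lborel {a..b} (\<lambda>t. (norm (f t))\<^sup>2)"

definition L2_loc :: "curve \<Rightarrow> bool" where
  "L2_loc f \<longleftrightarrow> f \<in> borel_measurable lborel \<and> (\<forall>a b. L2_on a b f)"

definition L2_inner :: "curve \<Rightarrow> curve \<Rightarrow> real" where
  "L2_inner f g = (LBINT t:{0..2*pi}. f t \<bullet> g t)"

definition L2_norm :: "curve \<Rightarrow> real" where
  "L2_norm f = sqrt (LBINT t:{0..2*pi}. (norm (f t))\<^sup>2)"

definition velocity :: "curve \<Rightarrow> curve" where
  "velocity u = (\<lambda>t. vector_derivative u (at t))"

text \<open>
  On the line, \<open>w\<close> is the weak derivative of the continuous function \<open>v\<close> iff \<open>v\<close> is an indefinite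
  Lebesgue integral of \<open>w\<close>.  An element of \<open>H\<^sup>2\<close> is represented by its unique continuously
  differentiable representative; its second weak derivative is determined almost everywhere only.
\<close>

definition has_weak_derivative :: "curve \<Rightarrow> curve \<Rightarrow> bool" where
  "has_weak_derivative v w \<longleftrightarrow>
     (\<forall>a b. a \<le> b \<longrightarrow> set_integrable lborel {a..b} w \<and> v b - v a = (LBINT t:{a..b}. w t))"

definition H2_periodic :: "curve set" where
  "H2_periodic =
     {u. (\<forall>t. u (t + 2*pi) = u t) \<and>
         (\<forall>t. u differentiable (at t)) \<and>
         (\<exists>w. L2_loc w \<and> has_weak_derivative (velocity u) w)}"

definition weak_deriv2 :: "curve \<Rightarrow> curve" where
  "weak_deriv2 u = (SOME w. L2_loc w \<and> has_weak_derivative (velocity u) w)"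

definition H2_norm :: "curve \<Rightarrow> real" where
  "H2_norm u = sqrt ((L2_norm u)\<^sup>2 + (L2_norm (velocity u))\<^sup>2 + (L2_norm (weak_deriv2 u))\<^sup>2)"


section \<open>\<open>L\<^sup>2\<close> gradient and Hessian\<close>

text \<open>
  \<open>F\<close> is a functional on a domain \<open>D\<close>, meant to be an open subset of \<^const>\<open>H2_periodic\<close>.
  Both derivatives are Frechet derivatives with respect to the \<open>H\<^sup>2\<close> norm; the first is represented
  through the \<open>L\<^sup>2\<close> inner product, and the second is the derivative of the gradient as a map into
  \<open>L\<^sup>2\<close>.
\<close>

definition has_L2_gradient :: "(curve \<Rightarrow> real) \<Rightarrow> curve set \<Rightarrow> curve \<Rightarrow> curve \<Rightarrow> bool" where
  "has_L2_gradient F D u g \<longleftrightarrow>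
     u \<in> D \<and> L2_on 0 (2*pi) g \<and>
     (\<forall>\<epsilon>>0. \<exists>\<delta>>0. \<forall>v\<in>D. H2_norm (v - u) < \<delta> \<longrightarrow>
        \<bar>F v - F u - L2_inner g (v - u)\<bar> \<le> \<epsilon> * H2_norm (v - u))"

text \<open>Bounded linear operators from periodic \<open>H\<^sup>2\<close> to \<open>L\<^sup>2\<close>; values are classes modulo null sets.\<close>

definition bounded_linear_H2_L2 :: "(curve \<Rightarrow> curve) \<Rightarrow> bool" where
  "bounded_linear_H2_L2 L \<longleftrightarrow>
     (\<forall>\<eta>\<in>H2_periodic. L2_on 0 (2*pi) (L \<eta>)) \<and>
     (\<forall>\<eta>\<in>H2_periodic. \<forall>\<zeta>\<in>H2_periodic. \<forall>a b.
        AE t in lborel. t \<in> {0..2*pi} \<longrightarrow>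
          L (a *\<^sub>R \<eta> + b *\<^sub>R \<zeta>) t = a *\<^sub>R L \<eta> t + b *\<^sub>R L \<zeta> t) \<and>
     (\<exists>C. \<forall>\<eta>\<in>H2_periodic. L2_norm (L \<eta>) \<le> C * H2_norm \<eta>)"

definition has_L2_hessian :: "(curve \<Rightarrow> real) \<Rightarrow> curve set \<Rightarrow> curve \<Rightarrow> (curve \<Rightarrow> curve) \<Rightarrow> bool" where
  "has_L2_hessian F D u L \<longleftrightarrow>
     u \<in> D \<and> bounded_linear_H2_L2 L \<and>
     (\<exists>G. (\<forall>v\<in>D. has_L2_gradient F D v (G v)) \<and>
       (\<forall>\<epsilon>>0. \<exists>\<delta>>0. \<forall>v\<in>D. H2_norm (v - u) < \<delta> \<longrightarrow>
          L2_norm (G v - G u - L (v - u)) \<le> \<epsilon> * H2_norm (v - u)))"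

definition operator_kernel :: "(curve \<Rightarrow> curve) \<Rightarrow> curve set" where
  "operator_kernel L = {\<eta> \<in> H2_periodic. AE t in lborel. t \<in> {0..2*pi} \<longrightarrow> L \<eta> t = 0}"

text \<open>Velocities at \<open>u\<close> of the curves in \<open>M\<close> that are differentiable at \<open>0\<close> in the \<open>H\<^sup>2\<close> norm.\<close>

definition tangent_space :: "curve set \<Rightarrow> curve \<Rightarrow> curve set" where
  "tangent_space M u =
     {\<eta> \<in> H2_periodic. \<exists>\<gamma> :: real \<Rightarrow> curve.
        \<gamma> 0 = u \<and> (\<forall>\<^sub>F s in nhds 0. \<gamma> s \<in> M) \<and>
        ((\<lambda>s. H2_norm ((\<gamma> s - u) /\<^sub>R s - \<eta>)) \<longlongrightarrow> 0) (at 0)}"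

definition nondegenerate_critical_manifold ::
    "(curve \<Rightarrow> real) \<Rightarrow> curve set \<Rightarrow> curve set \<Rightarrow> curve \<Rightarrow> bool" where
  "nondegenerate_critical_manifold F D M u \<longleftrightarrow>
     u \<in> M \<and>
     (\<forall>v\<in>M. has_L2_gradient F D v 0) \<and>
     (\<exists>L. has_L2_hessian F D u L \<and> operator_kernel L = tangent_space M u)"


section \<open>The Kepler problem\<close>

definition kepler_domain :: "curve set" where
  "kepler_domain = {u \<in> H2_periodic. \<forall>t. u t \<noteq> 0}"

definition kepler_action :: "curve \<Rightarrow> real" where
  "kepler_action u = (LBINT t:{0..2*pi}. (norm (velocity u t))\<^sup>2 / 2 + 1 / norm (u t))"

definition kepler_hessian :: "curve \<Rightarrow> curve \<Rightarrow> curve" where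
  "kepler_hessian u \<eta> = (\<lambda>t.
     - weak_deriv2 \<eta> t - (1 / norm (u t) ^ 3) *\<^sub>R \<eta> t
       + (3 * (u t \<bullet> \<eta> t) / norm (u t) ^ 5) *\<^sub>R u t)"

definition kepler_angle :: "real \<Rightarrow> real \<Rightarrow> real" where
  "kepler_angle e =
     (THE \<theta>. \<theta> 0 = 0 \<and>
        (\<forall>t. (\<theta> has_real_derivative (1 + e * cos (\<theta> t))\<^sup>2 / sqrt (1 - e\<^sup>2) ^ 3) (at t)))"

definition kepler_ellipse :: "real \<Rightarrow> curve" where
  "kepler_ellipse e = (\<lambda>t.
     let \<theta> = kepler_angle e t
     in ((sqrt (1 - e\<^sup>2))\<^sup>2 / (1 + e * cos \<theta>)) *\<^sub>R vector [cos \<theta>, sin \<theta>, 0])"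

definition kepler_ellipse_deriv_e :: "real \<Rightarrow> curve" where
  "kepler_ellipse_deriv_e e = (\<lambda>t. vector_derivative (\<lambda>e'. kepler_ellipse e' t) (at e))"

definition J1 :: "real ^ 3 ^ 3" where
  "J1 = vector [vector [0, 0, 0], vector [0, 0, -1], vector [0, 1, 0]]"

definition J2 :: "real ^ 3 ^ 3" where
  "J2 = vector [vector [0, 0, -1], vector [0, 0, 0], vector [1, 0, 0]]"

definition J3 :: "real ^ 3 ^ 3" where
  "J3 = vector [vector [0, -1, 0], vector [1, 0, 0], vector [0, 0, 0]]"

text \<open>The multiplication of the type \<open>real ^ 3 ^ 3\<close> is componentwise, hence the explicit series.\<close>

definition matrix_exp :: "real ^ 3 ^ 3 \<Rightarrow> real ^ 3 ^ 3" where
  "matrix_exp A = (\<Sum>n. (((**) A ^^ n) (mat 1)) /\<^sub>R fact n)"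

definition rotation :: "real ^ 3 \<Rightarrow> real ^ 3 ^ 3" where
  "rotation \<psi> =
     matrix_exp ((\<psi> $ 1) *\<^sub>R J1) ** matrix_exp ((\<psi> $ 2) *\<^sub>R J2) ** matrix_exp ((\<psi> $ 3) *\<^sub>R J3)"

definition kepler_manifold :: "curve set" where
  "kepler_manifold =
     {(\<lambda>t. rotation \<psi> *v kepler_ellipse e (t + \<phi>)) | e \<psi> \<phi>. 0 \<le> e \<and> e < 1}"

end

theory Submission
  imports Defs
begin

text \<open>
  Kepler's equation \<open>x - e sin x = t\<close> turns the ellipse into
  \<open>u = (cos x - e, sqrt (1 - e\<^sup>2) sin x, 0)\<close>.  The kernel of the Hessian consists of the periodic
  solutions of the linearized equation, since weak solutions are of class \<open>C\<^sup>2\<close>.  Its full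
  six-dimensional solution space is spanned by \<open>u'\<close>, \<open>\<partial>\<^sub>e u\<close>, \<open>J\<^sub>i u\<close> and the scaling field
  \<open>2 u - 3 t u'\<close>, as their initial data at \<open>t = 0\<close> are independent precisely when \<open>e \<noteq> 0\<close>;
  periodicity kills the coefficient of the last one.

  A velocity of a curve in \<open>M\<close> lies in the kernel because the gradient vanishes on \<open>M\<close>.
  Conversely, \<open>a u' + b \<partial>\<^sub>e u + \<Sum> c\<^sub>i J\<^sub>i u\<close> is the velocity of the rotated, shifted ellipses
  with parameters \<open>e + s b\<close>, \<open>s c\<close>, \<open>s a\<close>.  For solutions of the Kepler equation the second
  derivative is a function of the curve, and \<open>\<parallel>p'\<parallel>\<^sup>2 = - \<langle>p'', p\<rangle>\<close>, so uniform convergence of the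
  difference quotients already gives convergence in \<open>H\<^sup>2\<close>.
\<close>

text \<open>Two objects given by description have to become explicit before anything can be
  computed. \<open>kepler_angle\<close> is the unique solution of an ODE, so a closed formula is
  shown to solve it and Gronwall's inequality excludes any other solution. Differentiability in e
  then comes from the inverse function theorem for Kepler's equation, which needs an open range of
  parameters: hence |e| < 1 in most lemmas, negative values included. \<open>weak_deriv2\<close> is
  a choice within a class, so identities for second derivatives hold almost everywhere only.

  The analytic input is the embedding of H^2 into C^1, in the pointwise form \<open>Sobolev\<close>:
  perturbations small in H^2 are uniformly small, so they stay away from the collision at 0 and
  first order expansions of the force are uniform in t.

  The case e = 0 is a true obstacle: on the circle u' and J3 u coincide, so the five fields span at
  most four dimensions. In the computations this appears as a factor e in a 2 by 2
  determinant.\<close>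

section \<open>Weak derivatives and periodic Sobolev curves\<close>

text \<open>The closed intervals are an intersection-stable generator of the Borel sets, so by
  Dynkin's theorem the integrals over all Borel sets vanish too, which forces f to be zero almost
  everywhere. Truncation to [-n, n] makes f integrable on the line, as the complement and union
  cases require.\<close>

lemma AE_zero_of_interval_integrals_zero:
  fixes f :: "real \<Rightarrow> real ^ 3"
  assumes int: "\<And>a b. a \<le> b \<Longrightarrow> set_integrable lborel {a..b} f"
    and zero: "\<And>a b. a \<le> b \<Longrightarrow> (LBINT t:{a..b}. f t) = 0"
  shows "AE t in lborel. f t = 0"
proof -
  have *: "AE t in lborel. indicator {-real n..real n} t *\<^sub>R f t = 0" for n :: nat
  proof (rule sigma_finite_measure.density_zero[OF lborel.sigma_finite_measure_axioms])
    let ?g = "\<lambda>t. indicator {-real n..real n} t *\<^sub>R f t"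
    show gi: "integrable lborel ?g"
      using int[of "-real n" "real n"] by (simp add: set_integrable_def)
    fix A :: "real set" assume "A \<in> sets lborel"
    then have A: "A \<in> sigma_sets UNIV (range (\<lambda>(a,b). {a..b::real}))"
      by (metis borel_eq_atLeastAtMost sets_lborel sets_measure_of subset_UNIV Pow_UNIV)
    have si: "set_integrable lborel B ?g" if "B \<in> sigma_sets UNIV (range (\<lambda>(a,b). {a..b::real}))" for B
    proof -
      have "B \<in> sets lborel"
        using that by (metis borel_eq_atLeastAtMost sets_lborel sets_measure_of subset_UNIV Pow_UNIV)
      then show ?thesis
        unfolding set_integrable_def by (intro integrable_mult_indicator gi)
    qed
    have st: "Int_stable (range (\<lambda>(a,b). {a..b::real}))"
      proof (rule Int_stableI)
      fix A B :: "real set"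
      assume "A \<in> range (\<lambda>(a,b). {a..b})" "B \<in> range (\<lambda>(a,b). {a..b})"
      then obtain a b c d where "A = {a..b}" "B = {c..d}" by auto
      then show "A \<inter> B \<in> range (\<lambda>(a,b). {a..b})"
        by (intro image_eqI[of _ _ "(max a c, min b d)"]) auto
    qed
    have tot: "set_lebesgue_integral lborel UNIV ?g = 0"
      using zero[of "-real n" "real n"] by (simp add: set_lebesgue_integral_def)
    have sb: "B \<in> sets lborel" if "B \<in> sigma_sets UNIV (range (\<lambda>(a,b). {a..b::real}))" for B
        using that by (metis borel_eq_atLeastAtMost sets_lborel sets_measure_of subset_UNIV Pow_UNIV)
    have sub: "range (\<lambda>(a,b). {a..b::real}) \<subseteq> Pow UNIV" by simp
    show "set_lebesgue_integral lborel A ?g = 0"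
      using st sub A
    proof (induct rule: sigma_sets_induct_disjoint)
      case (basic B)
      then obtain a b where B: "B = {a..b}" by auto
      \<comment> \<open>An interval meets the window in an interval again, which is empty when its
        left end exceeds its right end; hence the case split below.\<close>
      have "set_lebesgue_integral lborel B ?g = (LBINT t:{max a (-real n)..min b (real n)}. f t)"
        unfolding set_lebesgue_integral_def B
        by (rule Bochner_Integration.integral_cong) (auto simp: indicator_def)
      also have "\<dots> = 0"
        using zero[of "max a (-real n)" "min b (real n)"]
        by (cases "max a (-real n) \<le> min b (real n)") (auto simp: set_lebesgue_integral_def)
      finally show ?case .
    next
      case empty
      show ?case by (simp add: set_lebesgue_integral_def)
    next
      case (compl B)
      have "UNIV = B \<union> (UNIV - B)" by auto
      then have "set_lebesgue_integral lborel UNIV ?g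
          = set_lebesgue_integral lborel B ?g + set_lebesgue_integral lborel (UNIV - B) ?g"
        using set_integral_Un[of B "UNIV - B" lborel ?g] si[of B] si[OF sigma_sets.Compl[of B]] compl
        by (auto simp: Compl_eq_Diff_UNIV)
      then show ?case using compl tot by simp
    next
      case (union B)
      have "set_integrable lborel (\<Union>i. B i) ?g"
        by (rule si) (use union in \<open>auto intro: sigma_sets.Union\<close>)
      moreover have "B i \<in> sets lborel" for i by (rule sb) (use union in auto)
      ultimately have "set_lebesgue_integral lborel (\<Union>i. B i) ?g = (\<Sum>i. set_lebesgue_integral lborel (B i) ?g)"
        using union by (intro lebesgue_integral_countable_add) (auto simp: disjoint_family_on_def)
      then show ?case using union by simp
    qed
  qed
  have "AE t in lborel. \<forall>n::nat. indicator {-real n..real n} t *\<^sub>R f t = 0"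
    unfolding AE_all_countable using * by blast
  then show ?thesis
  proof (rule AE_mp, intro AE_I2 impI)
    fix t :: real
    assume h: "\<forall>n::nat. indicator {-real n..real n} t *\<^sub>R f t = 0"
    obtain n :: nat where "\<bar>t\<bar> \<le> real n" using real_arch_simple by blast
    then show "f t = 0" using h[rule_format, of n] by (auto simp: indicator_def)
  qed
qed


lemma weak_derivative_unique:
  assumes "has_weak_derivative v w" "has_weak_derivative v w'"
  shows "AE t in lborel. w t = w' t"
proof -
  have "AE t in lborel. w t - w' t = 0"
    using assms by (intro AE_zero_of_interval_integrals_zero set_integral_diff)
      (auto simp: has_weak_derivative_def set_integral_diff)
  then show ?thesis by simp
qed

lemma weak_deriv2:
  assumes "u \<in> H2_periodic"
  shows "L2_loc (weak_deriv2 u)" "has_weak_derivative (velocity u) (weak_deriv2 u)"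
proof -
  have "\<exists>w. L2_loc w \<and> has_weak_derivative (velocity u) w"
    using assms by (simp add: H2_periodic_def)
  from someI_ex[OF this]
  show "L2_loc (weak_deriv2 u)" "has_weak_derivative (velocity u) (weak_deriv2 u)"
    by (simp_all add: weak_deriv2_def)
qed

lemma weak_deriv2_unique:
  assumes "u \<in> H2_periodic" "has_weak_derivative (velocity u) w"
  shows "AE t in lborel. weak_deriv2 u t = w t"
  using weak_derivative_unique weak_deriv2(2) assms by blast

lemma has_vector_derivative_velocity:
  assumes "u \<in> H2_periodic"
  shows "(u has_vector_derivative velocity u t) (at t within S)"
proof -
  have "u differentiable (at t)" using assms by (simp add: H2_periodic_def)
  then show ?thesis
    by (auto simp: velocity_def vector_derivative_works intro: has_vector_derivative_at_within)
qed

lemma velocity_eqI: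
  assumes "\<And>t. (u has_vector_derivative v t) (at t)"
  shows "velocity u = v"
  using vector_derivative_at[OF assms] by (auto simp: velocity_def)

text \<open>On each [-n, n] the function v is a constant plus an indefinite integral, hence
  continuous; the open intervals cover the line.\<close>

lemma weak_derivative_continuous:
  assumes "has_weak_derivative v w"
  shows "continuous_on S v"
proof -
  have c: "continuous_on {-real n..real n} v" for n :: nat
  proof -
    let ?a = "-real n" and ?b = "real n"
    have si: "set_integrable lborel {?a..x} w" if "?a \<le> x" for x
      using assms that by (simp add: has_weak_derivative_def)
    have "continuous_on {?a..?b} (\<lambda>x. v ?a + integral {?a..x} w)"
      using set_borel_integral_eq_integral(1)[OF si, of ?b]
      by (intro continuous_intros indefinite_integral_continuous_1) auto
    moreover have "v x = v ?a + integral {?a..x} w" if "x \<in> {?a..?b}" for x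
      using assms that set_borel_integral_eq_integral(2)[OF si, of x]
      by (auto simp: has_weak_derivative_def algebra_simps)
    ultimately show ?thesis
      by (metis (no_types, lifting) continuous_on_cong)
  qed
  have "continuous_on {-real n<..<real n} v" for n :: nat
    by (rule continuous_on_subset[OF c[of n]]) auto
  then have "continuous_on (\<Union>n. {-real n<..<real n}) v"
    by (intro continuous_on_open_UN) auto
  moreover have "(\<Union>n. {-real n<..<real n}) = UNIV"
  proof -
    have "\<exists>n. -real n < x \<and> x < real n" for x :: real
    proof -
      obtain n where "\<bar>x\<bar> < real n" using reals_Archimedean2 by blast
      then show ?thesis by (intro exI[of _ n]) auto
    qed
    then show ?thesis by (auto simp: set_eq_iff) 
  qed
  ultimately show ?thesis by (metis continuous_on_subset subset_UNIV)
qed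

lemma
  assumes "u \<in> H2_periodic"
  shows H2_continuous: "continuous_on S u"
    and H2_velocity_continuous: "continuous_on S (velocity u)"
    and H2_periodicD: "u (t + 2*pi) = u t"
    and H2_velocity_periodicD: "velocity u (t + 2*pi) = velocity u t"
proof -
  show "continuous_on S u"
    using has_vector_derivative_velocity[OF assms] has_vector_derivative_continuous
    by (blast intro: continuous_at_imp_continuous_on)
  show "continuous_on S (velocity u)"
    using weak_deriv2(2)[OF assms] by (rule weak_derivative_continuous)
  show *: "u (t + 2*pi) = u t" for t using assms by (simp add: H2_periodic_def)
  have "((\<lambda>t. u (t + 2*pi)) has_vector_derivative 1 *\<^sub>R velocity u (t + 2*pi)) (at t)"
    by (rule vector_diff_chain_at[of "\<lambda>t. t + 2*pi" 1 t u, unfolded o_def])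
      (auto intro!: derivative_eq_intros has_vector_derivative_velocity assms)
  then show "velocity u (t + 2*pi) = velocity u t"
    using has_vector_derivative_velocity[OF assms, of t UNIV]
    by (simp add: * vector_derivative_unique_at)
qed

section \<open>Elementary L^2 estimates over one period\<close>

lemma L2_on_continuous:
  assumes "continuous_on {a..b} f"
  shows "L2_on a b f"
  unfolding L2_on_def
proof
  show "set_borel_measurable lborel {a..b} f"
    using borel_integrable_atLeastAtMost'[OF assms]
    by (auto simp: set_integrable_def set_borel_measurable_def)
  show "set_integrable lborel {a..b} (\<lambda>t. (norm (f t))\<^sup>2)"
    by (intro borel_integrable_atLeastAtMost' continuous_intros assms)
qed

lemma L2_on_lincomb:
  assumes "L2_on a b f" "L2_on a b g"
  shows "L2_on a b (\<lambda>t. p *\<^sub>R f t + q *\<^sub>R g t)"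
proof -
  have m: "set_borel_measurable lborel {a..b} (\<lambda>t. p *\<^sub>R f t + q *\<^sub>R g t)"
  proof -
    have "(\<lambda>t. p *\<^sub>R (indicator {a..b} t *\<^sub>R f t) + q *\<^sub>R (indicator {a..b} t *\<^sub>R g t)) \<in> borel_measurable lborel"
      using assms by (intro borel_measurable_add borel_measurable_const_scaleR)
        (auto simp: L2_on_def set_borel_measurable_def)
    then show ?thesis by (simp add: set_borel_measurable_def algebra_simps)
  qed
  have mn: "set_borel_measurable lborel {a..b} (\<lambda>t. (norm (p *\<^sub>R f t + q *\<^sub>R g t))\<^sup>2)"
  proof -
    have "(\<lambda>t. (norm (indicator {a..b} t *\<^sub>R (p *\<^sub>R f t + q *\<^sub>R g t)))\<^sup>2) \<in> borel_measurable lborel"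
      using m[unfolded set_borel_measurable_def] by measurable
    moreover have "(\<lambda>t. (norm (indicator {a..b} t *\<^sub>R (p *\<^sub>R f t + q *\<^sub>R g t)))\<^sup>2)
        = (\<lambda>t. indicator {a..b} t *\<^sub>R (norm (p *\<^sub>R f t + q *\<^sub>R g t))\<^sup>2)"
      by (auto simp: indicator_def)
    ultimately show ?thesis by (simp add: set_borel_measurable_def)
  qed
  have "(norm (p *\<^sub>R f t + q *\<^sub>R g t))\<^sup>2 \<le> (2 * p\<^sup>2) * (norm (f t))\<^sup>2 + (2 * q\<^sup>2) * (norm (g t))\<^sup>2" for t
  proof -
    have "norm (p *\<^sub>R f t + q *\<^sub>R g t) \<le> \<bar>p\<bar> * norm (f t) + \<bar>q\<bar> * norm (g t)"
      using norm_triangle_ineq[of "p *\<^sub>R f t" "q *\<^sub>R g t"] by simp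
    then have "(norm (p *\<^sub>R f t + q *\<^sub>R g t))\<^sup>2 \<le> (\<bar>p\<bar> * norm (f t) + \<bar>q\<bar> * norm (g t))\<^sup>2"
      by (rule power_mono) simp
    also have "\<dots> \<le> 2 * (\<bar>p\<bar> * norm (f t))\<^sup>2 + 2 * (\<bar>q\<bar> * norm (g t))\<^sup>2"
      using sum_squares_bound[of "\<bar>p\<bar> * norm (f t)" "\<bar>q\<bar> * norm (g t)"] by (simp add: power2_sum)
    finally show ?thesis by (simp add: power_mult_distrib)
  qed
  moreover have "set_integrable lborel {a..b} (\<lambda>t. (2 * p\<^sup>2) * (norm (f t))\<^sup>2 + (2 * q\<^sup>2) * (norm (g t))\<^sup>2)"
    using assms by (intro set_integral_add set_integrable_mult_right) (auto simp: L2_on_def)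
  ultimately have "set_integrable lborel {a..b} (\<lambda>t. (norm (p *\<^sub>R f t + q *\<^sub>R g t))\<^sup>2)"
    by (intro set_integrable_bound[OF _ mn]) (auto intro: order_trans)
  with m show ?thesis by (simp add: L2_on_def)
qed

lemma L2_norm_nonneg: "0 \<le> L2_norm f"
  unfolding L2_norm_def by (simp add: set_lebesgue_integral_def)

lemma L2_norm_squared: "(L2_norm f)\<^sup>2 = (LBINT t:{0..2*pi}. (norm (f t))\<^sup>2)"
proof -
  have "0 \<le> (LBINT t:{0..2*pi}. (norm (f t))\<^sup>2)" by (simp add: set_lebesgue_integral_def)
  then show ?thesis by (simp add: L2_norm_def)
qed

text \<open>If f is not square integrable, the Bochner integral on the left has the default value 0;
  the bound survives because k dominates a square and is therefore nonnegative on the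
  period.\<close>

lemma L2_norm_squared_le:
  assumes k: "set_integrable lborel {0..2*pi} k"
    and le: "AE t in lborel. t \<in> {0..2*pi} \<longrightarrow> (norm (f t))\<^sup>2 \<le> k t"
  shows "(L2_norm f)\<^sup>2 \<le> (LBINT t:{0..2*pi}. k t)"
  unfolding L2_norm_squared set_lebesgue_integral_def
proof (rule integral_mono_AE')
  show "integrable lborel (\<lambda>t. indicator {0..2*pi} t *\<^sub>R k t)"
    using k by (simp add: set_integrable_def)
  show "AE x in lborel. indicator {0..2*pi} x *\<^sub>R (norm (f x))\<^sup>2 \<le> indicator {0..2*pi} x *\<^sub>R k x"
    using le by eventually_elim (auto simp: indicator_def)
  show "AE x in lborel. 0 \<le> indicator {0..2*pi} x *\<^sub>R k x"
    using le by eventually_elim (auto simp: indicator_def intro: order_trans[OF zero_le_power2])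
qed

text \<open>The factor 3 is a convenient upper bound for sqrt (2 * pi).\<close>

lemma L2_norm_le_sup:
  assumes "0 \<le> B" "AE t in lborel. t \<in> {0..2*pi} \<longrightarrow> norm (f t) \<le> B"
  shows "L2_norm f \<le> 3 * B"
proof -
  have "(L2_norm f)\<^sup>2 \<le> (LBINT t:{0..2*pi}. B\<^sup>2)"
  proof (rule L2_norm_squared_le)
    show "AE t in lborel. t \<in> {0..2*pi} \<longrightarrow> (norm (f t))\<^sup>2 \<le> B\<^sup>2"
      using assms(2) by eventually_elim (auto intro: power_mono)
  qed (intro borel_integrable_atLeastAtMost' continuous_intros)
  also have "\<dots> = 2 * pi * B\<^sup>2"
    by (simp add: set_lebesgue_integral_def)
  also have "\<dots> \<le> 9 * B\<^sup>2"
    using pi_less_4 by (intro mult_right_mono) auto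
  also have "\<dots> = (3 * B)\<^sup>2" by (simp add: power2_eq_square)
  finally show ?thesis by (rule power2_le_imp_le) (use assms in auto)
qed

text \<open>A substitute for Minkowski's inequality: (a + b)^2 \<le> 2 a^2 + 2 b^2 costs a factor,
  which is harmless wherever only smallness or boundedness is at stake.\<close>

lemma L2_norm_quasi_triangle:
  assumes f: "L2_on 0 (2*pi) f" and g: "L2_on 0 (2*pi) g"
    and le: "AE t in lborel. t \<in> {0..2*pi} \<longrightarrow> norm (h t) \<le> norm (f t) + norm (g t)"
  shows "L2_norm h \<le> 2 * (L2_norm f + L2_norm g)"
proof -
  have i: "set_integrable lborel {0..2*pi} (\<lambda>t. 2 * (norm (f t))\<^sup>2)"
    "set_integrable lborel {0..2*pi} (\<lambda>t. 2 * (norm (g t))\<^sup>2)"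
    using f g by (auto simp: L2_on_def)
  have "(L2_norm h)\<^sup>2 \<le> (LBINT t:{0..2*pi}. 2 * (norm (f t))\<^sup>2 + 2 * (norm (g t))\<^sup>2)"
  proof (rule L2_norm_squared_le)
    show "AE t in lborel. t \<in> {0..2*pi} \<longrightarrow> (norm (h t))\<^sup>2 \<le> 2 * (norm (f t))\<^sup>2 + 2 * (norm (g t))\<^sup>2"
      using le
    proof eventually_elim
      case (elim t)
      show ?case
      proof
        assume "t \<in> {0..2*pi}"
        then have "(norm (h t))\<^sup>2 \<le> (norm (f t) + norm (g t))\<^sup>2"
          using elim by (intro power_mono) auto
        also have "\<dots> \<le> 2 * (norm (f t))\<^sup>2 + 2 * (norm (g t))\<^sup>2"
          using sum_squares_bound[of "norm (f t)" "norm (g t)"] by (simp add: power2_sum)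
        finally show "(norm (h t))\<^sup>2 \<le> 2 * (norm (f t))\<^sup>2 + 2 * (norm (g t))\<^sup>2" .
      qed
    qed
  qed (intro set_integral_add i)
  also have "\<dots> = 2 * (L2_norm f)\<^sup>2 + 2 * (L2_norm g)\<^sup>2"
    using set_integral_add(2)[OF i] by (simp add: L2_norm_squared)
  also have "\<dots> \<le> (2 * (L2_norm f + L2_norm g))\<^sup>2"
    using L2_norm_nonneg[of f] L2_norm_nonneg[of g]
    by (simp add: power2_eq_square algebra_simps)
  finally show ?thesis
    by (rule power2_le_imp_le) (use L2_norm_nonneg[of f] L2_norm_nonneg[of g] in auto)
qed

lemma L2_norm_eq_0_imp:
  assumes "L2_on 0 (2*pi) f" "L2_norm f = 0"
  shows "AE t in lborel. t \<in> {0..2*pi} \<longrightarrow> f t = 0"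
proof -
  have "integral\<^sup>L lborel (\<lambda>t. indicator {0..2*pi} t *\<^sub>R (norm (f t))\<^sup>2) = 0"
    using assms(2) L2_norm_squared[of f] by (simp add: set_lebesgue_integral_def)
  moreover have "integrable lborel (\<lambda>t. indicator {0..2*pi} t *\<^sub>R (norm (f t))\<^sup>2)"
    using assms(1) by (simp add: L2_on_def set_integrable_def)
  ultimately have "AE t in lborel. indicator {0..2*pi} t *\<^sub>R (norm (f t))\<^sup>2 = 0"
    by (subst (asm) integral_nonneg_eq_0_iff_AE) auto
  then show ?thesis by eventually_elim (auto simp: indicator_def split: if_splits)
qed


section \<open>Linear combinations in H^2, the H^2 norm and the Sobolev embedding\<close>

lemma H2_L2_on:
  assumes "u \<in> H2_periodic"
  shows "L2_on a b u" "L2_on a b (velocity u)" "L2_on a b (weak_deriv2 u)"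
  using weak_deriv2(1)[OF assms] H2_continuous[OF assms] H2_velocity_continuous[OF assms]
  by (auto simp: L2_loc_def intro: L2_on_continuous)

lemma L2_loc_lincomb:
  assumes "L2_loc f" "L2_loc g"
  shows "L2_loc (\<lambda>t. p *\<^sub>R f t + q *\<^sub>R g t)"
  using assms by (auto simp: L2_loc_def intro!: L2_on_lincomb)

text \<open>The last identity is an almost everywhere statement because \<open>weak_deriv2\<close>
  chooses a representative for every curve separately.\<close>

lemma H2_lincomb:
  assumes u: "u \<in> H2_periodic" and v: "v \<in> H2_periodic"
  shows "(\<lambda>t. p *\<^sub>R u t + q *\<^sub>R v t) \<in> H2_periodic" (is "?w \<in> _")
    and "velocity (\<lambda>t. p *\<^sub>R u t + q *\<^sub>R v t) = (\<lambda>t. p *\<^sub>R velocity u t + q *\<^sub>R velocity v t)"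
    and "AE t in lborel. weak_deriv2 (\<lambda>t. p *\<^sub>R u t + q *\<^sub>R v t) t
           = p *\<^sub>R weak_deriv2 u t + q *\<^sub>R weak_deriv2 v t"
proof -
  have hd: "(?w has_vector_derivative p *\<^sub>R velocity u t + q *\<^sub>R velocity v t) (at t)" for t
    by (auto intro!: derivative_eq_intros has_vector_derivative_velocity u v)
  then show vel: "velocity ?w = (\<lambda>t. p *\<^sub>R velocity u t + q *\<^sub>R velocity v t)"
    by (rule velocity_eqI)
  have weak: "has_weak_derivative (velocity ?w) (\<lambda>t. p *\<^sub>R weak_deriv2 u t + q *\<^sub>R weak_deriv2 v t)"
    unfolding has_weak_derivative_def vel
  proof (intro allI impI)
    fix a b :: real
    assume "a \<le> b"
    then have i: "set_integrable lborel {a..b} (\<lambda>t. p *\<^sub>R weak_deriv2 u t)"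
        "set_integrable lborel {a..b} (\<lambda>t. q *\<^sub>R weak_deriv2 v t)"
      and "velocity u b - velocity u a = (LBINT t:{a..b}. weak_deriv2 u t)"
        "velocity v b - velocity v a = (LBINT t:{a..b}. weak_deriv2 v t)"
      using weak_deriv2(2)[OF u] weak_deriv2(2)[OF v] by (auto simp: has_weak_derivative_def)
    then show "set_integrable lborel {a..b} (\<lambda>t. p *\<^sub>R weak_deriv2 u t + q *\<^sub>R weak_deriv2 v t) \<and>
        p *\<^sub>R velocity u b + q *\<^sub>R velocity v b - (p *\<^sub>R velocity u a + q *\<^sub>R velocity v a) =
        (LBINT t:{a..b}. p *\<^sub>R weak_deriv2 u t + q *\<^sub>R weak_deriv2 v t)"
      using set_integral_add[OF i]
      by (simp add: algebra_simps flip: scaleR_diff_right)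
  qed
  show w: "?w \<in> H2_periodic"
    unfolding H2_periodic_def
    using hd weak L2_loc_lincomb[OF weak_deriv2(1)[OF u] weak_deriv2(1)[OF v], of p q]
    by (auto simp: H2_periodicD[OF u] H2_periodicD[OF v] intro: differentiableI_vector)
  show "AE t in lborel. weak_deriv2 ?w t = p *\<^sub>R weak_deriv2 u t + q *\<^sub>R weak_deriv2 v t"
    by (rule weak_deriv2_unique[OF w weak])
qed

lemma H2_norm_nonneg: "0 \<le> H2_norm u"
  by (simp add: H2_norm_def)

lemma H2_norm_squared:
  "(H2_norm u)\<^sup>2 = (L2_norm u)\<^sup>2 + (L2_norm (velocity u))\<^sup>2 + (L2_norm (weak_deriv2 u))\<^sup>2"
  by (simp add: H2_norm_def)

lemma L2_norm_le_H2_norm: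
  "L2_norm u \<le> H2_norm u"
  "L2_norm (velocity u) \<le> H2_norm u"
  "L2_norm (weak_deriv2 u) \<le> H2_norm u"
  by (rule power2_le_imp_le; simp add: H2_norm_squared H2_norm_nonneg)+

lemma H2_norm_le_sum:
  "H2_norm u \<le> L2_norm u + L2_norm (velocity u) + L2_norm (weak_deriv2 u)"
proof (rule power2_le_imp_le)
  show "(H2_norm u)\<^sup>2 \<le> (L2_norm u + L2_norm (velocity u) + L2_norm (weak_deriv2 u))\<^sup>2"
    using L2_norm_nonneg[of u] L2_norm_nonneg[of "velocity u"] L2_norm_nonneg[of "weak_deriv2 u"]
    unfolding H2_norm_squared by (simp add: power2_eq_square algebra_simps)
qed (use L2_norm_nonneg in simp)

text \<open>Cauchy-Schwarz against the constant 1, read off from the nonnegative variance of |w|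
  about its mean \<open>m\<close>.\<close>

lemma L2_norm_integral_bound:
  assumes "set_integrable lborel {0..2*pi} w" "L2_on 0 (2*pi) w"
  shows "(LBINT t:{0..2*pi}. norm (w t))\<^sup>2 \<le> 2 * pi * (L2_norm w)\<^sup>2"
proof -
  define m where "m = (LBINT t:{0..2*pi}. norm (w t)) / (2 * pi)"
  have i: "set_integrable lborel {0..2*pi} (\<lambda>t. (norm (w t))\<^sup>2)"
    "set_integrable lborel {0..2*pi} (\<lambda>t. 2 * m * norm (w t))"
    "set_integrable lborel {0..2*pi} (\<lambda>t. m\<^sup>2)"
    using assms set_integrable_norm[OF assms(1)]
    by (auto simp: L2_on_def intro!: borel_integrable_atLeastAtMost' continuous_intros)
  have "0 \<le> (LBINT t:{0..2*pi}. (norm (w t))\<^sup>2 - 2 * m * norm (w t) + m\<^sup>2)"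
  proof -
    have "0 \<le> (LBINT t:{0..2*pi}. (norm (w t) - m)\<^sup>2)"
      by (simp add: set_lebesgue_integral_def)
    then show ?thesis by (simp add: power2_diff algebra_simps)
  qed
  also have "\<dots> = (L2_norm w)\<^sup>2 - 2 * m * (LBINT t:{0..2*pi}. norm (w t)) + 2 * pi * m\<^sup>2"
    using i by (simp add: set_integral_add set_integral_diff L2_norm_squared)
      (simp add: set_lebesgue_integral_def)
  also have "\<dots> = (L2_norm w)\<^sup>2 - (LBINT t:{0..2*pi}. norm (w t))\<^sup>2 / (2 * pi)"
    by (simp add: m_def power2_eq_square field_simps)
  finally show ?thesis by (simp add: field_simps)
qed

text \<open>For every s in the period |v t| is at most |v s| plus the integral of |w|. Squaring and
  averaging over s turns |v s| into an L^2 norm.\<close>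

lemma sup_le_L2_norms:
  assumes v: "has_weak_derivative v w" and w: "L2_on 0 (2*pi) w" and t: "t \<in> {0..2*pi}"
  shows "(norm (v t))\<^sup>2 \<le> 16 * ((L2_norm v)\<^sup>2 + (L2_norm w)\<^sup>2)"
proof -
  define I where "I = (LBINT t:{0..2*pi}. norm (w t))"
  have wi: "set_integrable lborel {a..b} w" if "a \<le> b" for a b
    using v that by (simp add: has_weak_derivative_def)
  have I: "I\<^sup>2 \<le> 2 * pi * (L2_norm w)\<^sup>2" unfolding I_def
    by (rule L2_norm_integral_bound) (auto intro: wi w)
  have diff: "norm (v y - v x) \<le> I" if "0 \<le> x" "x \<le> y" "y \<le> 2*pi" for x y
  proof -
    have "norm (v y - v x) = norm (LBINT t:{x..y}. w t)"
      using v that by (simp add: has_weak_derivative_def)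
    also have "\<dots> \<le> (LBINT t:{x..y}. norm (w t))"
      by (rule set_integral_norm_bound[OF wi]) fact
    also have "\<dots> \<le> I"
      unfolding I_def set_lebesgue_integral_def
      using set_integrable_norm[OF wi[of x y]] set_integrable_norm[OF wi[of 0 "2*pi"]] that
      by (intro integral_mono) (auto simp: set_integrable_def indicator_def)
    finally show ?thesis .
  qed
  have diff': "norm (v t - v s) \<le> I" if "s \<in> {0..2*pi}" for s
    using diff[of s t] diff[of t s] that t by (cases "s \<le> t") (auto simp: norm_minus_commute)
  have ptw: "(norm (v t))\<^sup>2 \<le> 2 * (norm (v s))\<^sup>2 + 2 * I\<^sup>2" if "s \<in> {0..2*pi}" for s
  proof -
    have "norm (v t) \<le> norm (v s) + I"
      using diff'[OF that] norm_triangle_sub[of "v t" "v s"] by linarith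
    then have "(norm (v t))\<^sup>2 \<le> (norm (v s) + I)\<^sup>2" by (rule power_mono) simp
    also have "\<dots> \<le> 2 * (norm (v s))\<^sup>2 + 2 * I\<^sup>2"
      using sum_squares_bound[of "norm (v s)" I] by (simp add: power2_sum)
    finally show ?thesis .
  qed
  have i: "set_integrable lborel {0..2*pi} (\<lambda>s. 2 * (norm (v s))\<^sup>2)"
    "set_integrable lborel {0..2*pi} (\<lambda>s. 2 * I\<^sup>2)"
    "set_integrable lborel {0..2*pi} (\<lambda>s. (norm (v t))\<^sup>2)"
    using weak_derivative_continuous[OF v]
    by (auto intro!: borel_integrable_atLeastAtMost' continuous_intros)
  have "2 * pi * (norm (v t))\<^sup>2 = (LBINT s:{0..2*pi}. (norm (v t))\<^sup>2)"
    by (simp add: set_lebesgue_integral_def)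
  also have "\<dots> \<le> (LBINT s:{0..2*pi}. 2 * (norm (v s))\<^sup>2 + 2 * I\<^sup>2)"
    by (rule set_integral_mono[OF i(3) set_integral_add(1)[OF i(1,2)]]) (rule ptw)
  also have "\<dots> = 2 * (L2_norm v)\<^sup>2 + 4 * pi * I\<^sup>2"
    using set_integral_add(2)[OF i(1,2)] by (simp add: L2_norm_squared) (simp add: set_lebesgue_integral_def)
  also have "\<dots> \<le> 2 * (L2_norm v)\<^sup>2 + 4 * pi * (2 * pi * (L2_norm w)\<^sup>2)"
    using I by (intro add_left_mono mult_left_mono) auto
  finally have "(norm (v t))\<^sup>2 \<le> (L2_norm v)\<^sup>2 / pi + 4 * pi * (L2_norm w)\<^sup>2"
    by (simp add: field_simps power2_eq_square)
  \<comment> \<open>The constant 16 exceeds both 1 / pi and 4 * pi, and its root 4 is the constant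
    of \<open>Sobolev\<close>.\<close>
  also have "\<dots> \<le> 16 * (L2_norm v)\<^sup>2 + 16 * (L2_norm w)\<^sup>2"
  proof (intro add_mono mult_right_mono)
    have "(L2_norm v)\<^sup>2 / pi \<le> (L2_norm v)\<^sup>2 / 1"
      using pi_gt3 by (intro divide_left_mono) auto
    then show "(L2_norm v)\<^sup>2 / pi \<le> 16 * (L2_norm v)\<^sup>2"
      using zero_le_power2[of "L2_norm v"] by linarith
  qed (use pi_less_4 in auto)
  finally show ?thesis by simp
qed

lemma periodic_shift:
  fixes f :: "real \<Rightarrow> 'a"
  assumes "\<And>t. f (t + 2*pi) = f t"
  shows "\<exists>s\<in>{0..2*pi}. f t = f s"
proof -
  have step: "f (t + 2*pi * real n) = f t" for n :: nat and t
  proof (induction n)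
    case (Suc n)
    have "f (t + 2*pi * real (Suc n)) = f ((t + 2*pi * real n) + 2*pi)"
      by (simp add: algebra_simps)
    with Suc show ?case by (simp only: assms)
  qed simp
  define k where "k = \<lfloor>t / (2*pi)\<rfloor>"
  have k: "2*pi * of_int k \<le> t" "t < 2*pi * (of_int k + 1)"
  proof -
    have "of_int k \<le> t / (2*pi)" "t / (2*pi) < of_int k + 1" unfolding k_def by linarith+
    then show "2*pi * of_int k \<le> t" "t < 2*pi * (of_int k + 1)" by (auto simp: field_simps)
  qed
  have "f t = f (t - 2*pi * of_int k)"
  proof (cases "0 \<le> k")
    case True
    then show ?thesis using step[of "t - 2*pi * of_int k" "nat k"] by simp
  next
    case False
    then show ?thesis using step[of t "nat (-k)"] by simp
  qed
  moreover have "t - 2*pi * of_int k \<in> {0..2*pi}" using k by (auto simp: algebra_simps)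
  ultimately show ?thesis by blast
qed

lemma C1_has_weak_derivative:
  assumes "\<And>t. (v has_vector_derivative w t) (at t)" "continuous_on UNIV w"
  shows "has_weak_derivative v w"
  unfolding has_weak_derivative_def
proof (intro allI impI conjI)
  fix a b :: real assume "a \<le> b"
  have c: "continuous_on {a..b} w" using assms(2) by (rule continuous_on_subset) simp
  then show "set_integrable lborel {a..b} w" by (rule borel_integrable_atLeastAtMost')
  show "v b - v a = (LBINT t:{a..b}. w t)"
    unfolding set_lebesgue_integral_def
    by (rule integral_FTC_atLeastAtMost[OF \<open>a \<le> b\<close> _ c, symmetric])
      (rule has_vector_derivative_at_within[OF assms(1)])
qed

lemma H2_has_weak_derivative_velocity:
  assumes "u \<in> H2_periodic"
  shows "has_weak_derivative u (velocity u)"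
  by (intro C1_has_weak_derivative has_vector_derivative_velocity H2_velocity_continuous assms)

text \<open>\<open>sup_le_L2_norms\<close> for the pairs (u, u') and (u', u''); periodicity carries
  the bounds from one period to all times. The factor 4 reappears in the later choices of
  radii.\<close>

lemma Sobolev:
  assumes u: "u \<in> H2_periodic"
  shows "norm (u t) \<le> 4 * H2_norm u" "norm (velocity u t) \<le> 4 * H2_norm u"
proof -
  obtain s where s: "s \<in> {0..2*pi}" "u t = u s"
    using periodic_shift[of u] H2_periodicD[OF u] by blast
  have "(norm (u s))\<^sup>2 \<le> 16 * ((L2_norm u)\<^sup>2 + (L2_norm (velocity u))\<^sup>2)"
    by (rule sup_le_L2_norms) (intro H2_has_weak_derivative_velocity H2_L2_on u s)+
  also have "\<dots> \<le> (4 * H2_norm u)\<^sup>2"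
    by (simp add: power_mult_distrib H2_norm_squared)
  finally show "norm (u t) \<le> 4 * H2_norm u"
    unfolding s(2) by (rule power2_le_imp_le) (use H2_norm_nonneg[of u] in simp)
  obtain s where s: "s \<in> {0..2*pi}" "velocity u t = velocity u s"
    using periodic_shift[of "velocity u"] H2_velocity_periodicD[OF u] by blast
  have "(norm (velocity u s))\<^sup>2 \<le> 16 * ((L2_norm (velocity u))\<^sup>2 + (L2_norm (weak_deriv2 u))\<^sup>2)"
    by (rule sup_le_L2_norms) (intro weak_deriv2 H2_L2_on u s)+
  also have "\<dots> \<le> (4 * H2_norm u)\<^sup>2"
    by (simp add: power_mult_distrib H2_norm_squared)
  finally show "norm (velocity u t) \<le> 4 * H2_norm u"
    unfolding s(2) by (rule power2_le_imp_le) (use H2_norm_nonneg[of u] in simp)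
qed

lemma C2_periodic_H2:
  assumes "\<And>t. u (t + 2*pi) = u t"
    and "\<And>t. (u has_vector_derivative v t) (at t)"
    and "\<And>t. (v has_vector_derivative w t) (at t)"
    and "continuous_on UNIV w"
  shows "u \<in> H2_periodic" "velocity u = v" "AE t in lborel. weak_deriv2 u t = w t"
proof -
  show vel: "velocity u = v" by (rule velocity_eqI[OF assms(2)])
  have weak: "has_weak_derivative (velocity u) w"
    unfolding vel by (rule C1_has_weak_derivative[OF assms(3,4)])
  have "L2_loc w"
    using assms(4) continuous_on_subset[OF assms(4)]
    by (auto simp: L2_loc_def intro!: L2_on_continuous borel_measurable_continuous_onI)
  then show u: "u \<in> H2_periodic"
    using assms(1,2) weak by (auto simp: H2_periodic_def intro: differentiableI_vector)
  show "AE t in lborel. weak_deriv2 u t = w t"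
    by (rule weak_deriv2_unique[OF u weak])
qed


section \<open>Integration by parts against a C^1 function\<close>

text \<open>Bisecting the interval halves the bound, so it can be iterated down to \<open>0\<close>.\<close>

lemma eq_of_quadratic_increments:
  fixes f :: "real \<Rightarrow> 'a :: real_normed_vector" and W :: "real \<Rightarrow> real"
  assumes "\<And>x y. \<lbrakk>a \<le> x; x \<le> y; y \<le> b\<rbrakk> \<Longrightarrow> norm (f y - f x) \<le> (y - x) * (W y - W x)"
    and "a \<le> b"
  shows "f a = f b"
proof -
  have *: "norm (f y - f x) \<le> (y - x) * (W y - W x) / 2 ^ n"
    if "a \<le> x" "x \<le> y" "y \<le> b" for x y n
    using that
  proof (induction n arbitrary: x y)
    case (Suc n)
    let ?m = "(x + y) / 2"
    have "norm (f y - f x) \<le> norm (f y - f ?m) + norm (f ?m - f x)"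
      using norm_triangle_ineq[of "f y - f ?m" "f ?m - f x"] by simp
    also have "\<dots> \<le> (y - ?m) * (W y - W ?m) / 2 ^ n + (?m - x) * (W ?m - W x) / 2 ^ n"
      using Suc.prems by (intro add_mono Suc.IH) auto
    also have "\<dots> = (y - x) * (W y - W x) / 2 ^ Suc n"
      by (simp add: field_simps)
    finally show ?case .
  qed (use assms in simp)
  have "(\<lambda>n. (b - a) * (W b - W a) * (1 / 2) ^ n) \<longlonglongrightarrow> (b - a) * (W b - W a) * 0"
    by (intro tendsto_intros LIMSEQ_realpow_zero) auto
  moreover have "norm (f b - f a) \<le> (b - a) * (W b - W a) * (1 / 2) ^ n" for n
    using *[of a b n] assms(2) by (simp add: power_divide)
  ultimately have "norm (f b - f a) \<le> 0"
    using LIMSEQ_le_const by fastforce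
  then show ?thesis by simp
qed

lemma weak_integration_by_parts:
  assumes v: "has_weak_derivative v w"
    and h: "\<And>t. (h has_vector_derivative h' t) (at t)" and h': "continuous_on UNIV h'"
    and "a \<le> b"
  shows "set_integrable lborel {a..b} (\<lambda>t. w t \<bullet> h t)"
    and "(LBINT t:{a..b}. w t \<bullet> h t) = v b \<bullet> h b - v a \<bullet> h a - (LBINT t:{a..b}. v t \<bullet> h' t)"
proof -
  have hc: "continuous_on S h" for S
    using h has_vector_derivative_continuous by (blast intro: continuous_at_imp_continuous_on)
  have h'c: "continuous_on S h'" for S
    using h' by (rule continuous_on_subset) simp
  have vc: "continuous_on S v" for S by (rule weak_derivative_continuous[OF v])
  have w: "set_integrable lborel {x..y} w" if "x \<le> y" for x y
    using v that by (simp add: has_weak_derivative_def)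
  have whS: "set_integrable lborel {x..y} (\<lambda>t. w t \<bullet> h t)" if "x \<le> y" for x y
  proof -
    obtain B where B: "\<And>t. t \<in> {x..y} \<Longrightarrow> norm (h t) \<le> B"
      using compact_imp_bounded[OF compact_continuous_image[OF hc compact_Icc[of x y]]]
      unfolding bounded_iff by fastforce
    show ?thesis
    proof (rule set_integrable_bound)
      show "set_integrable lborel {x..y} (\<lambda>t. B * norm (w t))"
        using set_integrable_norm[OF w[OF that]] by simp
      have "(\<lambda>t. indicator {x..y} t *\<^sub>R w t) \<in> borel_measurable lborel"
        using w[OF that] by (auto simp: set_integrable_def)
      moreover have "h \<in> borel_measurable lborel"
        using hc by (simp add: borel_measurable_continuous_onI)
      ultimately have "(\<lambda>t. (indicator {x..y} t *\<^sub>R w t) \<bullet> h t) \<in> borel_measurable lborel"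
        by (rule borel_measurable_inner)
      then show "set_borel_measurable lborel {x..y} (\<lambda>t. w t \<bullet> h t)"
        by (simp add: set_borel_measurable_def)
      have "norm (w t \<bullet> h t) \<le> norm (B * norm (w t))" if "t \<in> {x..y}" for t
      proof -
        have "norm (w t \<bullet> h t) \<le> norm (w t) * norm (h t)" by (simp add: Cauchy_Schwarz_ineq2)
        also have "\<dots> \<le> norm (w t) * B" using B[OF that] by (intro mult_left_mono) auto
        also have "\<dots> \<le> norm (B * norm (w t))" by (simp add: mult.commute)
        finally show ?thesis .
      qed
      then show "AE t in lborel. t \<in> {x..y} \<longrightarrow> norm (w t \<bullet> h t) \<le> norm (B * norm (w t))"
        by simp
    qed
  qed
  then show "set_integrable lborel {a..b} (\<lambda>t. w t \<bullet> h t)" using \<open>a \<le> b\<close> .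
  have int[intro]: "w integrable_on {x..y}" "(\<lambda>t. norm (w t)) integrable_on {x..y}"
    "(\<lambda>t. w t \<bullet> h t) integrable_on {x..y}" if "x \<le> y" for x y
    using set_borel_integral_eq_integral(1)[OF w] set_borel_integral_eq_integral(1)[OF whS]
      set_borel_integral_eq_integral(1)[OF set_integrable_norm[OF w]] that by auto
  have intv[intro]: "(\<lambda>t. v t \<bullet> h' t) integrable_on {x..y}" for x y
    by (intro integrable_continuous_interval continuous_intros vc h'c)
  obtain K where K: "\<And>t. t \<in> {a..b} \<Longrightarrow> norm (h' t) \<le> K" and K0: "0 \<le> K"
  proof -
    obtain K where K: "\<And>t. t \<in> {a..b} \<Longrightarrow> norm (h' t) \<le> K"
      using compact_imp_bounded[OF compact_continuous_image[OF h'c compact_Icc[of a b]]]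
      unfolding bounded_iff by fastforce
    show ?thesis
      by (rule that[of "max K 0"]) (use K in \<open>auto simp: le_max_iff_disj\<close>)
  qed
  \<comment> \<open>The integral of |w| up to t dominates the variation of v; a multiple of it
    serves as the monotone function in the increment bound.\<close>
  define W where "W t = integral {a..t} (\<lambda>t. norm (w t))" for t
  have W: "W y - W x = integral {x..y} (\<lambda>t. norm (w t))" if "a \<le> x" "x \<le> y" for x y
    using Henstock_Kurzweil_Integration.integral_combine[of a x y "\<lambda>t. norm (w t)"] that
    by (simp add: W_def int(2))
  have Wmono: "W x \<le> W y" if "a \<le> x" "x \<le> y" for x y
    using W[OF that] Henstock_Kurzweil_Integration.integral_nonneg[OF int(2)[OF that(2)]] by simp
  have vdiff: "(w has_integral v y - v x) {x..y}" if "x \<le> y" for x y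
    using v that set_borel_integral_eq_integral(2)[OF w[OF that]] int(1)[OF that]
    by (simp add: has_weak_derivative_def has_integral_iff)
  have hdiff: "(h' has_integral h y - h x) {x..y}" if "x \<le> y" for x y
    by (rule fundamental_theorem_of_calculus[OF that])
      (rule has_vector_derivative_at_within[OF h])
  have vW: "norm (v y - v x) \<le> W y - W x" if "a \<le> x" "x \<le> y" for x y
    using integral_norm_bound_integral[OF int(1) int(2), OF that(2) that(2)] vdiff[OF that(2)] W[OF that]
    by (simp add: has_integral_iff)
  have hK: "norm (h y - h x) \<le> K * (y - x)" if "a \<le> x" "x \<le> y" "y \<le> b" for x y
    using integral_norm_bound_integral[of h' "{x..y}" "\<lambda>_. K"] hdiff[OF that(2)] K that
    by (auto simp: has_integral_iff mult.commute)
  define \<psi> where "\<psi> t = v t \<bullet> h t - integral {a..t} (\<lambda>t. w t \<bullet> h t + v t \<bullet> h' t)" for t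
  have "\<psi> a = \<psi> b"
  proof (rule eq_of_quadratic_increments[OF _ \<open>a \<le> b\<close>])
    fix x y assume xy: "a \<le> x" "x \<le> y" "y \<le> b"
    \<comment> \<open>The increment of the product splits as (v y - v x) . h y + v x . (h y - h x),
      and both parts are integrals over [x, y]. Subtracting the integrand of \<open>\<psi>\<close>
      leaves only differences of h and of v, each multiplied by an integrable factor.\<close>
    have "((\<lambda>t. w t \<bullet> h y - w t \<bullet> h t + (v x \<bullet> h' t - v t \<bullet> h' t)) has_integral
      (v y - v x) \<bullet> h y - integral {x..y} (\<lambda>t. w t \<bullet> h t)
        + (v x \<bullet> (h y - h x) - integral {x..y} (\<lambda>t. v t \<bullet> h' t))) {x..y}"
      using xy
      by (intro has_integral_add has_integral_diff integrable_integral int intv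
          has_integral_linear[OF vdiff bounded_linear_inner_left, unfolded o_def]
          has_integral_linear[OF hdiff bounded_linear_inner_right, unfolded o_def])
    moreover have "(v y - v x) \<bullet> h y - integral {x..y} (\<lambda>t. w t \<bullet> h t)
        + (v x \<bullet> (h y - h x) - integral {x..y} (\<lambda>t. v t \<bullet> h' t)) = \<psi> y - \<psi> x"
      using Henstock_Kurzweil_Integration.integral_combine[of a x y "\<lambda>t. w t \<bullet> h t + v t \<bullet> h' t"] xy
        Henstock_Kurzweil_Integration.integral_add[OF int(3) intv, of x y]
      by (simp add: \<psi>_def inner_diff_left inner_diff_right integrable_add int intv)
    ultimately have hi: "((\<lambda>t. w t \<bullet> (h y - h t) + (v x - v t) \<bullet> h' t) has_integral \<psi> y - \<psi> x) {x..y}"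
      by (simp add: inner_diff_left inner_diff_right)
    have "norm (integral {x..y} (\<lambda>t. w t \<bullet> (h y - h t) + (v x - v t) \<bullet> h' t))
      \<le> integral {x..y} (\<lambda>t. K * (y - x) * norm (w t) + K * (W y - W x))"
    proof (rule integral_norm_bound_integral)
      show "(\<lambda>t. w t \<bullet> (h y - h t) + (v x - v t) \<bullet> h' t) integrable_on {x..y}"
        using hi by blast
      show "(\<lambda>t. K * (y - x) * norm (w t) + K * (W y - W x)) integrable_on {x..y}"
        using int(2)[OF xy(2)]
        by (intro integrable_add integrable_on_mult_right) auto
      fix t assume t: "t \<in> {x..y}"
      have "norm (w t \<bullet> (h y - h t)) \<le> norm (w t) * norm (h y - h t)"
        by (simp add: Cauchy_Schwarz_ineq2)
      also have "\<dots> \<le> norm (w t) * (K * (y - x))"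
        using hK[of t y] K0 t xy by (intro mult_left_mono order_trans[OF hK[of t y]]) auto
      finally have 1: "norm (w t \<bullet> (h y - h t)) \<le> K * (y - x) * norm (w t)" by (simp add: mult_ac)
      have "norm ((v x - v t) \<bullet> h' t) \<le> norm (v t - v x) * norm (h' t)"
        using Cauchy_Schwarz_ineq2[of "v x - v t" "h' t"] by (simp add: norm_minus_commute)
      also have "\<dots> \<le> (W y - W x) * K"
        using vW[of x t] Wmono[of t y] Wmono[of x y] K[of t] t xy by (intro mult_mono) auto
      finally show "norm (w t \<bullet> (h y - h t) + (v x - v t) \<bullet> h' t) \<le> K * (y - x) * norm (w t) + K * (W y - W x)"
        using norm_triangle_ineq[of "w t \<bullet> (h y - h t)" "(v x - v t) \<bullet> h' t"] 1
        by (simp add: mult.commute)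
    qed
    also have "\<dots> = K * (y - x) * (W y - W x) + (y - x) * (K * (W y - W x))"
      using W[OF xy(1,2)] int(2)[OF xy(2)] xy(2)
      by (subst Henstock_Kurzweil_Integration.integral_add)
        (auto intro: integrable_on_mult_right simp: integral_mult_right)
    also have "\<dots> = (y - x) * (2 * K * W y - 2 * K * W x)"
      by (simp add: algebra_simps)
    finally show "norm (\<psi> y - \<psi> x) \<le> (y - x) * (2 * K * W y - 2 * K * W x)"
      using hi by (simp add: has_integral_iff)
  qed
  then have "integral {a..b} (\<lambda>t. w t \<bullet> h t) + integral {a..b} (\<lambda>t. v t \<bullet> h' t)
      = v b \<bullet> h b - v a \<bullet> h a"
    using Henstock_Kurzweil_Integration.integral_add[OF int(3)[OF \<open>a \<le> b\<close>] intv]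
    by (simp add: \<psi>_def)
  moreover have "(LBINT t:{a..b}. v t \<bullet> h' t) = integral {a..b} (\<lambda>t. v t \<bullet> h' t)"
    by (intro set_borel_integral_eq_integral borel_integrable_atLeastAtMost' continuous_intros vc h'c)
  moreover have "(LBINT t:{a..b}. w t \<bullet> h t) = integral {a..b} (\<lambda>t. w t \<bullet> h t)"
    by (intro set_borel_integral_eq_integral whS \<open>a \<le> b\<close>)
  ultimately show "(LBINT t:{a..b}. w t \<bullet> h t) = v b \<bullet> h b - v a \<bullet> h a - (LBINT t:{a..b}. v t \<bullet> h' t)"
    by simp
qed

section \<open>Gradient and Hessian of the Kepler action\<close>

text \<open>The derivative is uniformly continuous on a compact neighbourhood of K, so the mean
  value inequality on small balls gives one radius for all points of K.\<close>

lemma uniform_differentiability: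
  fixes f :: "'a::euclidean_space \<Rightarrow> 'b::real_normed_vector"
  assumes "open S" "compact K" "K \<subseteq> S"
    and der: "\<And>x. x \<in> S \<Longrightarrow> (f has_derivative f' x) (at x)"
    and cont: "\<And>h. continuous_on S (\<lambda>x. f' x h)"
    and "0 < \<epsilon>"
  obtains \<delta> where "0 < \<delta>"
    "\<And>x h. \<lbrakk>x \<in> K; norm h < \<delta>\<rbrakk> \<Longrightarrow> x + h \<in> S \<and> norm (f (x + h) - f x - f' x h) \<le> \<epsilon> * norm h"
proof -
  obtain d where d: "0 < d" "(\<Union>x\<in>K. cball x d) \<subseteq> S"
    using compact_subset_open_imp_cball_epsilon_subset assms(1-3) by metis
  \<comment> \<open>The closed d-neighbourhood of K, written as a Minkowski sum so that its
    compactness is immediate.\<close>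
  define C where "C = {x + y | x y. x \<in> K \<and> y \<in> cball 0 d}"
  have "compact C" unfolding C_def by (intro compact_sums assms compact_cball)
  have inC: "x + h \<in> C" if "x \<in> K" "norm h \<le> d" for x h
    using that by (auto simp: C_def)
  have "C \<subseteq> S"
  proof
    fix z assume "z \<in> C"
    then obtain x y where "z = x + y" "x \<in> K" "norm y \<le> d" by (auto simp: C_def)
    then have "z \<in> cball x d" by (simp add: dist_norm)
    with \<open>x \<in> K\<close> have "z \<in> (\<Union>x\<in>K. cball x d)" by blast
    with d show "z \<in> S" by blast
  qed
  define F where "F x = Blinfun (f' x)" for x
  have F: "blinfun_apply (F x) = f' x" if "x \<in> S" for x
    using has_derivative_bounded_linear[OF der[OF that]] by (simp add: F_def bounded_linear_Blinfun_apply)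
  have "continuous_on S F"
    \<comment> \<open>On a finite-dimensional space, continuity in the operator norm follows from
      continuity for each fixed direction h.\<close>
    by (rule continuous_on_blinfun_componentwise)
      (use cont F in \<open>auto cong: continuous_on_cong_simp\<close>)
  then have "uniformly_continuous_on C F"
    using \<open>compact C\<close> \<open>C \<subseteq> S\<close> by (intro compact_uniformly_continuous) (auto intro: continuous_on_subset)
  then obtain \<delta>1 where "0 < \<delta>1" and \<delta>1: "\<And>x y. \<lbrakk>x \<in> C; y \<in> C; dist y x < \<delta>1\<rbrakk> \<Longrightarrow> dist (F y) (F x) < \<epsilon>"
    using \<open>0 < \<epsilon>\<close> unfolding uniformly_continuous_on_def by metis
  show ?thesis
  proof (rule that[of "min d \<delta>1"])
    show "0 < min d \<delta>1" using d \<open>0 < \<delta>1\<close> by simp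
    fix x h :: 'a assume x: "x \<in> K" and h: "norm h < min d \<delta>1"
    define B where "B = ball x (min d \<delta>1)"
    have B: "y \<in> C \<and> y \<in> S \<and> dist y x < \<delta>1" if "y \<in> B" for y
      using that inC[OF x, of "y - x"] \<open>C \<subseteq> S\<close> by (auto simp: B_def dist_norm norm_minus_commute)
    have xB: "x \<in> B" using d \<open>0 < \<delta>1\<close> by (simp add: B_def)
    have "norm (f (x + h) - f x - f' x ((x + h) - x)) \<le> norm ((x + h) - x) * \<epsilon>"
    proof (rule differentiable_bound_linearization)
      fix t :: real assume t: "t \<in> {0..1}"
      have "norm (t *\<^sub>R h) \<le> norm h" using t by (auto simp: mult_left_le_one_le)
      with h show "x + t *\<^sub>R ((x + h) - x) \<in> B" by (simp add: B_def dist_norm)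
    next
      fix y assume y: "y \<in> B"
      show "(f has_derivative f' y) (at y within B)"
        using B[OF y] der has_derivative_at_withinI by blast
      have "onorm (f' y - f' x) = norm (F y - F x)"
        using B[OF y] B[OF xB] by (simp add: norm_blinfun.rep_eq blinfun.diff_left[abs_def] fun_diff_def F)
      also have "\<dots> \<le> \<epsilon>" using \<delta>1[of x y] B[OF y] B[OF xB] by (simp add: dist_norm)
      finally show "onorm (f' y - f' x) \<le> \<epsilon>" .
    qed (rule xB)
    moreover have "x + h \<in> B" using h by (simp add: B_def dist_norm)
    ultimately show "x + h \<in> S \<and> norm (f (x + h) - f x - f' x h) \<le> \<epsilon> * norm h"
      using B by (simp add: mult.commute)
  qed
qed

text \<open>This is minus the gradient of 1 / |x|, so Kepler's equation reads u'' = -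
  \<open>kepler_field\<close> u and its linearization y'' = - \<open>kepler_field_deriv\<close> u
  y.\<close>

definition kepler_field :: "real ^ 3 \<Rightarrow> real ^ 3" where
  "kepler_field x = (1 / norm x ^ 3) *\<^sub>R x"

definition kepler_field_deriv :: "real ^ 3 \<Rightarrow> real ^ 3 \<Rightarrow> real ^ 3" where
  "kepler_field_deriv x h = (1 / norm x ^ 3) *\<^sub>R h - (3 * (x \<bullet> h) / norm x ^ 5) *\<^sub>R x"

lemma has_derivative_norm':
  fixes x :: "'a::real_inner"
  assumes "x \<noteq> 0"
  shows "(norm has_derivative (\<lambda>h. (x \<bullet> h) / norm x)) (at x)"
  using has_derivative_norm[OF assms] by (simp add: sgn_div_norm inner_commute divide_inverse mult.commute)

lemma has_derivative_kepler_potential: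
  fixes x :: "'a::real_inner"
  assumes "x \<noteq> 0"
  shows "((\<lambda>x. 1 / norm x) has_derivative (\<lambda>h. - (x \<bullet> h) / norm x ^ 3)) (at x)"
proof -
  have "((\<lambda>x. 1 / norm x) has_derivative (\<lambda>h. - (1 * ((x \<bullet> h) / norm x)) / (norm x * norm x))) (at x)"
    using assms by (auto intro!: derivative_eq_intros has_derivative_norm' simp: field_simps)
  then show ?thesis by (simp add: power3_eq_cube mult.assoc)
qed

lemma has_derivative_kepler_field:
  assumes "x \<noteq> 0"
  shows "(kepler_field has_derivative kepler_field_deriv x) (at x)"
proof -
  have "((\<lambda>x. (1 / norm x ^ 3) *\<^sub>R x) has_derivative
      (\<lambda>h. (1 / norm x ^ 3) *\<^sub>R h + (- (3 * (norm x)\<^sup>2 * ((x \<bullet> h) / norm x)) / (norm x ^ 3)\<^sup>2) *\<^sub>R x)) (at x)"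
    using assms
    by (auto intro!: derivative_eq_intros has_derivative_norm' simp: field_simps power2_eq_square)
  moreover have "- (3 * (norm x)\<^sup>2 * ((x \<bullet> h) / norm x)) / (norm x ^ 3)\<^sup>2 = - (3 * (x \<bullet> h) / norm x ^ 5)" for h
    using assms by (simp add: field_simps power2_eq_square eval_nat_numeral)
  moreover have "kepler_field = (\<lambda>x. (1 / norm x ^ 3) *\<^sub>R x)"
    "kepler_field_deriv x = (\<lambda>h. (1 / norm x ^ 3) *\<^sub>R h - (3 * (x \<bullet> h) / norm x ^ 5) *\<^sub>R x)"
    by (auto simp: kepler_field_def kepler_field_deriv_def)
  ultimately show ?thesis by simp
qed

lemma continuous_on_kepler_field_deriv:
  assumes "continuous_on S f" "continuous_on S g" "\<And>x. x \<in> S \<Longrightarrow> f x \<noteq> 0"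
  shows "continuous_on S (\<lambda>x. kepler_field_deriv (f x) (g x))"
  unfolding kepler_field_deriv_def using assms by (intro continuous_intros) auto

lemma continuous_on_kepler_field:
  assumes "continuous_on S f" "\<And>x. x \<in> S \<Longrightarrow> f x \<noteq> 0"
  shows "continuous_on S (\<lambda>x. kepler_field (f x))"
  unfolding kepler_field_def using assms by (intro continuous_intros) auto

lemma kepler_hessian_eq:
  "kepler_hessian u \<eta> = (\<lambda>t. - weak_deriv2 \<eta> t - kepler_field_deriv (u t) (\<eta> t))"
  by (auto simp: kepler_hessian_def kepler_field_deriv_def)

lemma kepler_domainD:
  assumes "u \<in> kepler_domain"
  shows "u \<in> H2_periodic" "u t \<noteq> 0"
  using assms by (auto simp: kepler_domain_def)

lemma compact_period: "u \<in> H2_periodic \<Longrightarrow> compact (u ` {0..2*pi})"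
  by (intro compact_continuous_image H2_continuous compact_Icc)

text \<open>The range of u over one period is compact and misses the singularity, so the first order
  expansion of the force is uniform in t.\<close>

lemma kepler_field_expansion:
  assumes u: "u \<in> kepler_domain" and "0 < \<epsilon>"
  obtains \<delta> where "0 < \<delta>"
    "\<And>t h. \<lbrakk>t \<in> {0..2*pi}; norm h < \<delta>\<rbrakk> \<Longrightarrow>
      norm (kepler_field (u t + h) - kepler_field (u t) - kepler_field_deriv (u t) h) \<le> \<epsilon> * norm h"
proof (rule uniform_differentiability[of "-{0}" "u ` {0..2*pi}" kepler_field kepler_field_deriv \<epsilon>])
  show "u ` {0..2*pi} \<subseteq> -{0}" using kepler_domainD(2)[OF u] by auto
  show "continuous_on (-{0}) (\<lambda>x. kepler_field_deriv x h)" for h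
    by (intro continuous_on_kepler_field_deriv continuous_intros) auto
  fix \<delta> :: real
  assume "0 < \<delta>" and "\<And>x h. \<lbrakk>x \<in> u ` {0..2*pi}; norm h < \<delta>\<rbrakk> \<Longrightarrow> x + h \<in> -{0} \<and>
      norm (kepler_field (x + h) - kepler_field x - kepler_field_deriv x h) \<le> \<epsilon> * norm h"
  then show thesis by (intro that[of \<delta>]) auto
qed (use assms in \<open>auto intro!: has_derivative_kepler_field compact_period kepler_domainD\<close>)

lemma kepler_potential_expansion:
  assumes u: "u \<in> kepler_domain" and "0 < \<epsilon>"
  obtains \<delta> where "0 < \<delta>"
    "\<And>t h. \<lbrakk>t \<in> {0..2*pi}; norm h < \<delta>\<rbrakk> \<Longrightarrow>
      \<bar>1 / norm (u t + h) - 1 / norm (u t) + kepler_field (u t) \<bullet> h\<bar> \<le> \<epsilon> * norm h"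
proof (rule uniform_differentiability[of "-{0}" "u ` {0..2*pi}"
      "\<lambda>x. 1 / norm x" "\<lambda>x h. - (x \<bullet> h) / norm x ^ 3" \<epsilon>])
  show "u ` {0..2*pi} \<subseteq> -{0}" using kepler_domainD(2)[OF u] by auto
  show "continuous_on (-{0}) (\<lambda>x. - (x \<bullet> h) / norm x ^ 3)" for h :: "real ^ 3"
    by (intro continuous_intros) auto
  fix \<delta> :: real
  assume "0 < \<delta>" and "\<And>x h. \<lbrakk>x \<in> u ` {0..2*pi}; norm h < \<delta>\<rbrakk> \<Longrightarrow> x + h \<in> -{0} \<and>
      norm (1 / norm (x + h) - 1 / norm x - (- (x \<bullet> h) / norm x ^ 3)) \<le> \<epsilon> * norm h"
  then show thesis by (intro that[of \<delta>]) (auto simp: kepler_field_def)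
qed (use assms has_derivative_kepler_potential in \<open>auto intro!: compact_period kepler_domainD\<close>)

section \<open>The gradient of the action\<close>

definition kepler_gradient :: "curve \<Rightarrow> curve" where
  "kepler_gradient u = (\<lambda>t. - weak_deriv2 u t - kepler_field (u t))"

lemma H2_diff:
  assumes u: "u \<in> H2_periodic" and v: "v \<in> H2_periodic"
  shows "v - u \<in> H2_periodic"
    and "velocity (v - u) t = velocity v t - velocity u t"
    and "AE t in lborel. weak_deriv2 (v - u) t = weak_deriv2 v t - weak_deriv2 u t"
proof -
  have "v - u = (\<lambda>t. 1 *\<^sub>R v t + (-1) *\<^sub>R u t)" by auto
  then show "v - u \<in> H2_periodic" "velocity (v - u) t = velocity v t - velocity u t"
    "AE t in lborel. weak_deriv2 (v - u) t = weak_deriv2 v t - weak_deriv2 u t"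
    using H2_lincomb[OF v u, of 1 "-1"] by simp_all
qed

lemma kepler_domain_continuous:
  assumes "u \<in> kepler_domain"
  shows "continuous_on S (\<lambda>t. kepler_field (u t))"
    and "continuous_on S (\<lambda>t. 1 / norm (u t))"
    and "\<eta> \<in> H2_periodic \<Longrightarrow> continuous_on S (\<lambda>t. kepler_field_deriv (u t) (\<eta> t))"
  using kepler_domainD(2)[OF assms] H2_continuous[OF kepler_domainD(1)[OF assms]] H2_continuous[of \<eta>]
  by (auto intro!: continuous_on_kepler_field continuous_on_kepler_field_deriv continuous_intros)

lemma kepler_gradient_L2_on:
  assumes "u \<in> kepler_domain"
  shows "L2_on a b (kepler_gradient u)"
  using L2_on_lincomb[OF H2_L2_on(3)[OF kepler_domainD(1)[OF assms]]
      L2_on_continuous[OF kepler_domain_continuous(1)[OF assms]], of a b "-1" "-1"]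
  by (simp add: kepler_gradient_def)

text \<open>With h = z - v, integration by parts turns the pairing with the second derivative into
  minus the integral of v' . h', the boundary terms cancelling by periodicity. What remains of the
  increment is |h'|^2 / 2, which is quadratic, and the first order remainder \<open>?q\<close> of
  the potential.\<close>

lemma has_L2_gradient_kepler:
  assumes v: "v \<in> kepler_domain"
  shows "has_L2_gradient kepler_action kepler_domain v (kepler_gradient v)"
  unfolding has_L2_gradient_def
proof (intro conjI allI impI)
  show "v \<in> kepler_domain" by fact
  show "L2_on 0 (2*pi) (kepler_gradient v)" by (rule kepler_gradient_L2_on[OF v])
  fix \<epsilon> :: real assume "0 < \<epsilon>"
  note vH = kepler_domainD(1)[OF v]
  \<comment> \<open>The denominator 16 pi is 4 from \<open>Sobolev\<close>, times the length 2 pi of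
    the period, times 2 because the potential may use half of \<epsilon>.\<close>
  obtain \<delta>0 where "0 < \<delta>0" and \<delta>0: "\<And>t h. \<lbrakk>t \<in> {0..2*pi}; norm h < \<delta>0\<rbrakk> \<Longrightarrow>
      \<bar>1 / norm (v t + h) - 1 / norm (v t) + kepler_field (v t) \<bullet> h\<bar> \<le> \<epsilon> / (16 * pi) * norm h"
    using kepler_potential_expansion[OF v, of "\<epsilon> / (16 * pi)"] \<open>0 < \<epsilon>\<close> by auto
  show "\<exists>\<delta>>0. \<forall>z\<in>kepler_domain. H2_norm (z - v) < \<delta> \<longrightarrow>
      \<bar>kepler_action z - kepler_action v - L2_inner (kepler_gradient v) (z - v)\<bar> \<le> \<epsilon> * H2_norm (z - v)"
  \<comment> \<open>The bound \<delta>0 / 4 keeps |h| below \<delta>0 by \<open>Sobolev\<close>; the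
    bound \<epsilon> makes the kinetic remainder N * N / 2 at most \<epsilon> * N / 2.\<close>
  proof (intro exI[of _ "min \<epsilon> (\<delta>0 / 4)"] conjI ballI impI)
    show "0 < min \<epsilon> (\<delta>0 / 4)" using \<open>0 < \<epsilon>\<close> \<open>0 < \<delta>0\<close> by simp
    fix z assume z: "z \<in> kepler_domain" and small: "H2_norm (z - v) < min \<epsilon> (\<delta>0 / 4)"
    note zH = kepler_domainD(1)[OF z]
    define h where "h = z - v"
    define N where "N = H2_norm h"
    have hH: "h \<in> H2_periodic" and vel: "\<And>t. velocity h t = velocity z t - velocity v t"
      unfolding h_def by (intro H2_diff vH zH)+
    have zt: "z t = v t + h t" for t by (simp add: h_def)
    have hN: "norm (h t) \<le> 4 * N" for t unfolding N_def by (rule Sobolev[OF hH])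
    have N0: "0 \<le> N" by (simp add: N_def H2_norm_nonneg)
    let ?q = "\<lambda>t. 1 / norm (z t) - 1 / norm (v t) + kepler_field (v t) \<bullet> h t"
    let ?w = "weak_deriv2 v"
    note ci = borel_integrable_atLeastAtMost' continuous_intros
      H2_velocity_continuous[OF vH] H2_velocity_continuous[OF zH] H2_velocity_continuous[OF hH]
      H2_continuous[OF vH] H2_continuous[OF zH] H2_continuous[OF hH]
      kepler_domain_continuous(1)[OF v] kepler_domain_continuous(2)[OF v] kepler_domain_continuous(2)[OF z]
    have iz: "set_integrable lborel {0..2*pi} (\<lambda>t. (norm (velocity z t))\<^sup>2 / 2 + 1 / norm (z t))"
      and iv: "set_integrable lborel {0..2*pi} (\<lambda>t. (norm (velocity v t))\<^sup>2 / 2 + 1 / norm (v t))"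
      and ik: "set_integrable lborel {0..2*pi} (\<lambda>t. velocity v t \<bullet> velocity h t)"
      and ip: "set_integrable lborel {0..2*pi} (\<lambda>t. kepler_field (v t) \<bullet> h t)"
      by ((intro ci)?; simp)+
    have ibp: "set_integrable lborel {0..2*pi} (\<lambda>t. ?w t \<bullet> h t)"
      "(LBINT t:{0..2*pi}. ?w t \<bullet> h t) = - (LBINT t:{0..2*pi}. velocity v t \<bullet> velocity h t)"
    proof -
      have "(h has_vector_derivative velocity h t) (at t)" for t
        by (rule has_vector_derivative_velocity[OF hH])
      note * = weak_integration_by_parts[OF weak_deriv2(2)[OF vH] this H2_velocity_continuous[OF hH], of 0 "2*pi"]
      show "set_integrable lborel {0..2*pi} (\<lambda>t. ?w t \<bullet> h t)" using *(1) by simp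
      show "(LBINT t:{0..2*pi}. ?w t \<bullet> h t) = - (LBINT t:{0..2*pi}. velocity v t \<bullet> velocity h t)"
        using *(2) H2_periodicD[OF hH, of 0] H2_velocity_periodicD[OF vH, of 0] by simp
    qed
    have "L2_inner (kepler_gradient v) h
        = - (LBINT t:{0..2*pi}. ?w t \<bullet> h t) - (LBINT t:{0..2*pi}. kepler_field (v t) \<bullet> h t)"
    proof -
      have "L2_inner (kepler_gradient v) h
          = (LBINT t:{0..2*pi}. (-1) * (?w t \<bullet> h t) - kepler_field (v t) \<bullet> h t)"
        by (simp add: L2_inner_def kepler_gradient_def inner_diff_left)
      also have "\<dots> = (LBINT t:{0..2*pi}. (-1) * (?w t \<bullet> h t)) - (LBINT t:{0..2*pi}. kepler_field (v t) \<bullet> h t)"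
        by (intro set_integral_diff set_integrable_mult_right ip ibp)
      finally show ?thesis by (simp only: set_integral_mult_right)
    qed
    then have "kepler_action z - kepler_action v - L2_inner (kepler_gradient v) h
        = (LBINT t:{0..2*pi}. ((norm (velocity z t))\<^sup>2 / 2 + 1 / norm (z t))
            - ((norm (velocity v t))\<^sup>2 / 2 + 1 / norm (v t))
            - velocity v t \<bullet> velocity h t + kepler_field (v t) \<bullet> h t)"
      by (simp add: ibp kepler_action_def set_integral_add set_integral_diff iz iv ik ip)
    also have "\<dots> = (LBINT t:{0..2*pi}. (norm (velocity h t))\<^sup>2 / 2 + ?q t)"
    proof (intro set_lebesgue_integral_cong allI impI)
      fix t :: real
      have "(norm (velocity z t))\<^sup>2 = (norm (velocity v t))\<^sup>2 + 2 * (velocity v t \<bullet> velocity h t) + (norm (velocity h t))\<^sup>2"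
        by (simp add: vel power2_norm_eq_inner inner_diff_left inner_diff_right inner_commute)
      then show "((norm (velocity z t))\<^sup>2 / 2 + 1 / norm (z t))
            - ((norm (velocity v t))\<^sup>2 / 2 + 1 / norm (v t))
            - velocity v t \<bullet> velocity h t + kepler_field (v t) \<bullet> h t
          = (norm (velocity h t))\<^sup>2 / 2 + ?q t" by (simp add: field_simps)
    qed simp
    finally have eq: "kepler_action z - kepler_action v - L2_inner (kepler_gradient v) h = \<dots>" .
    have i1: "set_integrable lborel {0..2*pi} (\<lambda>t. (norm (velocity h t))\<^sup>2 / 2 + ?q t)"
      and i2: "set_integrable lborel {0..2*pi} (\<lambda>t. (norm (velocity h t))\<^sup>2 / 2)"
      and i3: "set_integrable lborel {0..2*pi} (\<lambda>t. \<epsilon> / (4 * pi) * N)"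
      by ((intro ci)?; simp)+
    have "\<bar>kepler_action z - kepler_action v - L2_inner (kepler_gradient v) h\<bar>
        \<le> (LBINT t:{0..2*pi}. \<bar>(norm (velocity h t))\<^sup>2 / 2 + ?q t\<bar>)"
      unfolding eq using set_integral_norm_bound[OF i1] by simp
    also have "\<dots> \<le> (LBINT t:{0..2*pi}. (norm (velocity h t))\<^sup>2 / 2 + \<epsilon> / (4 * pi) * N)"
    proof (rule set_integral_mono)
      show "set_integrable lborel {0..2*pi} (\<lambda>t. \<bar>(norm (velocity h t))\<^sup>2 / 2 + ?q t\<bar>)"
        using set_integrable_abs[OF i1] .
      show "set_integrable lborel {0..2*pi} (\<lambda>t. (norm (velocity h t))\<^sup>2 / 2 + \<epsilon> / (4 * pi) * N)"
        by (rule set_integral_add(1)[OF i2 i3])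
      fix t :: real assume t: "t \<in> {0..2*pi}"
      have "norm (h t) < \<delta>0" using hN[of t] small by (simp add: N_def h_def)
      then have "\<bar>?q t\<bar> \<le> \<epsilon> / (16 * pi) * norm (h t)" unfolding zt using \<delta>0[OF t] by blast
      also have "\<dots> \<le> \<epsilon> / (16 * pi) * (4 * N)"
        using hN[of t] \<open>0 < \<epsilon>\<close> by (intro mult_left_mono) auto
      also have "\<dots> = \<epsilon> / (4 * pi) * N" by simp
      finally show "\<bar>(norm (velocity h t))\<^sup>2 / 2 + ?q t\<bar> \<le> (norm (velocity h t))\<^sup>2 / 2 + \<epsilon> / (4 * pi) * N"
        by (smt (verit) zero_le_power2 divide_nonneg_pos)
    qed
    also have "\<dots> = (L2_norm (velocity h))\<^sup>2 / 2 + \<epsilon> / 2 * N"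
      using set_integral_add(2)[OF i2 i3] by (simp add: L2_norm_squared) (simp add: set_lebesgue_integral_def)
    also have "\<dots> \<le> N * N / 2 + \<epsilon> / 2 * N"
      using power_mono[OF L2_norm_le_H2_norm(2) L2_norm_nonneg, of h 2] by (simp add: N_def power2_eq_square)
    also have "\<dots> \<le> \<epsilon> * N / 2 + \<epsilon> / 2 * N"
      using small N0 by (intro add_right_mono divide_right_mono mult_right_mono) (auto simp: N_def h_def)
    finally show "\<bar>kepler_action z - kepler_action v - L2_inner (kepler_gradient v) (z - v)\<bar> \<le> \<epsilon> * H2_norm (z - v)"
      by (simp add: h_def N_def)
  qed
qed

section \<open>The Hessian as derivative of the gradient\<close>

lemma kepler_hessian_L2_on:
  assumes "u \<in> kepler_domain" "\<eta> \<in> H2_periodic"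
  shows "L2_on a b (kepler_hessian u \<eta>)"
  using L2_on_lincomb[OF H2_L2_on(3)[OF assms(2)]
      L2_on_continuous[OF kepler_domain_continuous(3)[OF assms]], of a b "-1" "-1"]
  by (simp add: kepler_hessian_eq)

lemma linear_kepler_field_deriv:
  "kepler_field_deriv x (a *\<^sub>R h + b *\<^sub>R k) = a *\<^sub>R kepler_field_deriv x h + b *\<^sub>R kepler_field_deriv x k"
  by (simp add: kepler_field_deriv_def algebra_simps add_divide_distrib)

lemma norm_kepler_field_deriv_le: "norm (kepler_field_deriv x h) \<le> 4 / norm x ^ 3 * norm h"
proof (cases "x = 0")
  case False
  have "norm (kepler_field_deriv x h) \<le> norm ((1 / norm x ^ 3) *\<^sub>R h) + norm ((3 * (x \<bullet> h) / norm x ^ 5) *\<^sub>R x)"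
    unfolding kepler_field_deriv_def by (rule norm_triangle_ineq4)
  also have "\<dots> = norm h / norm x ^ 3 + 3 * \<bar>x \<bullet> h\<bar> / norm x ^ 4"
    using False by (simp add: eval_nat_numeral abs_mult field_simps)
  also have "\<dots> \<le> norm h / norm x ^ 3 + 3 * (norm x * norm h) / norm x ^ 4"
    by (intro add_left_mono divide_right_mono mult_left_mono Cauchy_Schwarz_ineq2) auto
  also have "\<dots> = 4 / norm x ^ 3 * norm h"
    using False by (simp add: eval_nat_numeral field_simps)
  finally show ?thesis .
\<comment> \<open>At x = 0 both sides vanish, by the convention that division by 0 gives 0.\<close>
qed (simp add: kepler_field_deriv_def)

lemma kepler_field_deriv_bound:
  assumes "u \<in> kepler_domain"
  obtains B where "0 < B" "\<And>t h. t \<in> {0..2*pi} \<Longrightarrow> norm (kepler_field_deriv (u t) h) \<le> B * norm h"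
proof -
  have "compact ((\<lambda>t. 4 / norm (u t) ^ 3) ` {0..2*pi})"
    using kepler_domainD[OF assms] by (intro compact_continuous_image continuous_intros H2_continuous) auto
  from compact_imp_bounded[OF this] obtain B
    where B: "\<forall>y\<in>(\<lambda>t. 4 / norm (u t) ^ 3) ` {0..2*pi}. norm y \<le> B"
    by (auto simp only: bounded_iff)
  show ?thesis
  proof (rule that[of "max B 1"])
    fix t h assume t: "t \<in> {0..2*pi}"
    have "4 / norm (u t) ^ 3 \<le> max B 1" using B[rule_format, OF imageI[OF t]] by auto
    then show "norm (kepler_field_deriv (u t) h) \<le> max B 1 * norm h"
      by (intro order_trans[OF norm_kepler_field_deriv_le] mult_right_mono) auto
  qed simp
qed

lemma bounded_linear_kepler_hessian:
  assumes u: "u \<in> kepler_domain"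
  shows "bounded_linear_H2_L2 (kepler_hessian u)"
  unfolding bounded_linear_H2_L2_def
proof (intro conjI ballI allI)
  show "L2_on 0 (2*pi) (kepler_hessian u \<eta>)" if "\<eta> \<in> H2_periodic" for \<eta>
    by (rule kepler_hessian_L2_on[OF u that])
  show "AE t in lborel. t \<in> {0..2*pi} \<longrightarrow> kepler_hessian u (a *\<^sub>R \<eta> + b *\<^sub>R \<zeta>) t
      = a *\<^sub>R kepler_hessian u \<eta> t + b *\<^sub>R kepler_hessian u \<zeta> t"
    if \<eta>: "\<eta> \<in> H2_periodic" and \<zeta>: "\<zeta> \<in> H2_periodic" for \<eta> \<zeta> a b
  proof -
    have "a *\<^sub>R \<eta> + b *\<^sub>R \<zeta> = (\<lambda>t. a *\<^sub>R \<eta> t + b *\<^sub>R \<zeta> t)"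
      by (auto simp: scaleR_fun_def)
    then show ?thesis using H2_lincomb(3)[OF \<eta> \<zeta>, of a b]
      by (auto simp: kepler_hessian_eq linear_kepler_field_deriv algebra_simps elim!: eventually_mono)
  qed
  obtain B where "0 < B" and B: "\<And>t h. t \<in> {0..2*pi} \<Longrightarrow> norm (kepler_field_deriv (u t) h) \<le> B * norm h"
    using kepler_field_deriv_bound[OF u] by blast
  show "\<exists>C. \<forall>\<eta>\<in>H2_periodic. L2_norm (kepler_hessian u \<eta>) \<le> C * H2_norm \<eta>"
  proof (intro exI ballI)
    fix \<eta> assume \<eta>: "\<eta> \<in> H2_periodic"
    have "L2_norm (\<lambda>t. kepler_field_deriv (u t) (\<eta> t)) \<le> 3 * (B * (4 * H2_norm \<eta>))"
    proof (intro L2_norm_le_sup AE_I2 impI)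
      fix t :: real assume t: "t \<in> {0..2*pi}"
      have "norm (kepler_field_deriv (u t) (\<eta> t)) \<le> B * norm (\<eta> t)" by (rule B[OF t])
      also have "\<dots> \<le> B * (4 * H2_norm \<eta>)"
        using Sobolev(1)[OF \<eta>, of t] \<open>0 < B\<close> by (intro mult_left_mono) auto
      finally show "norm (kepler_field_deriv (u t) (\<eta> t)) \<le> B * (4 * H2_norm \<eta>)" .
    qed (use \<open>0 < B\<close> H2_norm_nonneg[of \<eta>] in simp)
    moreover have "L2_norm (kepler_hessian u \<eta>)
        \<le> 2 * (L2_norm (weak_deriv2 \<eta>) + L2_norm (\<lambda>t. kepler_field_deriv (u t) (\<eta> t)))"
    proof (rule L2_norm_quasi_triangle)
      show "L2_on 0 (2*pi) (\<lambda>t. kepler_field_deriv (u t) (\<eta> t))"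
        by (intro L2_on_continuous kepler_domain_continuous u \<eta>)
      show "AE t in lborel. t \<in> {0..2*pi} \<longrightarrow> norm (kepler_hessian u \<eta> t)
          \<le> norm (weak_deriv2 \<eta> t) + norm (kepler_field_deriv (u t) (\<eta> t))"
        using norm_triangle_ineq4[of "- weak_deriv2 \<eta> t" "kepler_field_deriv (u t) (\<eta> t)" for t]
        by (simp add: kepler_hessian_eq)
    qed (rule H2_L2_on[OF \<eta>])
    ultimately show "L2_norm (kepler_hessian u \<eta>) \<le> (2 + 24 * B) * H2_norm \<eta>"
      using L2_norm_le_H2_norm(3)[of \<eta>] by (simp add: algebra_simps)
  qed
qed

text \<open>The second derivatives enter linearly and cancel, so only the pointwise remainder of the
  force is left, and a uniform bound controls its L^2 norm. The divisor 12 is 3 from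
  \<open>L2_norm_le_sup\<close> times 4 from \<open>Sobolev\<close>.\<close>

lemma kepler_gradient_expansion:
  assumes u: "u \<in> kepler_domain" and "0 < \<epsilon>"
  shows "\<exists>\<delta>>0. \<forall>v\<in>kepler_domain. H2_norm (v - u) < \<delta> \<longrightarrow>
    L2_norm (kepler_gradient v - kepler_gradient u - kepler_hessian u (v - u)) \<le> \<epsilon> * H2_norm (v - u)"
proof -
  obtain \<delta> where "0 < \<delta>" and \<delta>: "\<And>t h. \<lbrakk>t \<in> {0..2*pi}; norm h < \<delta>\<rbrakk> \<Longrightarrow>
      norm (kepler_field (u t + h) - kepler_field (u t) - kepler_field_deriv (u t) h) \<le> \<epsilon> / 12 * norm h"
    using kepler_field_expansion[OF u, of "\<epsilon> / 12"] \<open>0 < \<epsilon>\<close> by auto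
  show ?thesis
  proof (intro exI[of _ "\<delta> / 4"] conjI ballI impI)
    fix v assume v: "v \<in> kepler_domain" and small: "H2_norm (v - u) < \<delta> / 4"
    note uH = kepler_domainD(1)[OF u] and vH = kepler_domainD(1)[OF v]
    define h where "h = v - u"
    have hH: "h \<in> H2_periodic" unfolding h_def by (intro H2_diff uH vH)
    have vt: "v t = u t + h t" for t by (simp add: h_def)
    have "L2_norm (kepler_gradient v - kepler_gradient u - kepler_hessian u h)
        \<le> 3 * (\<epsilon> / 12 * (4 * H2_norm h))"
    proof (rule L2_norm_le_sup)
      show "AE t in lborel. t \<in> {0..2*pi} \<longrightarrow>
          norm ((kepler_gradient v - kepler_gradient u - kepler_hessian u h) t) \<le> \<epsilon> / 12 * (4 * H2_norm h)"
        using H2_diff(3)[OF uH vH]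
      proof eventually_elim
        case (elim t)
        show ?case
        proof
          assume t: "t \<in> {0..2*pi}"
          have "norm (h t) < \<delta>" using Sobolev(1)[OF hH, of t] small by (simp add: h_def)
          then have "norm (kepler_field (v t) - kepler_field (u t) - kepler_field_deriv (u t) (h t)) \<le> \<epsilon> / 12 * norm (h t)"
            unfolding vt by (rule \<delta>[OF t])
          also have "\<dots> \<le> \<epsilon> / 12 * (4 * H2_norm h)"
            using Sobolev(1)[OF hH, of t] \<open>0 < \<epsilon>\<close> by (intro mult_left_mono) auto
          also have "norm (kepler_field (v t) - kepler_field (u t) - kepler_field_deriv (u t) (h t))
            = norm (- (kepler_field (v t) - kepler_field (u t) - kepler_field_deriv (u t) (h t)))"
            by (rule norm_minus_cancel[symmetric])
          also have "- (kepler_field (v t) - kepler_field (u t) - kepler_field_deriv (u t) (h t))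
            = (kepler_gradient v - kepler_gradient u - kepler_hessian u h) t"
            using elim by (simp add: kepler_gradient_def kepler_hessian_eq h_def[symmetric])
          finally show "norm ((kepler_gradient v - kepler_gradient u - kepler_hessian u h) t)
            \<le> \<epsilon> / 12 * (4 * H2_norm h)" .
        qed
      qed
    qed (use \<open>0 < \<epsilon>\<close> H2_norm_nonneg[of h] in simp)
    then show "L2_norm (kepler_gradient v - kepler_gradient u - kepler_hessian u (v - u)) \<le> \<epsilon> * H2_norm (v - u)"
      by (simp add: h_def)
  qed (use \<open>0 < \<delta>\<close> in simp)
qed

lemma has_L2_hessian_kepler:
  assumes "u \<in> kepler_domain"
  shows "has_L2_hessian kepler_action kepler_domain u (kepler_hessian u)"
  unfolding has_L2_hessian_def
  using assms bounded_linear_kepler_hessian has_L2_gradient_kepler kepler_gradient_expansion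
  by (intro conjI exI[of _ kepler_gradient]) blast+

section \<open>The Kepler ellipse\<close>

text \<open>The product of g with exp (- K t) is nonincreasing. Applied to a nonnegative g, the
  conclusion forces g = 0.\<close>

lemma gronwall_zero:
  fixes g g' :: "real \<Rightarrow> real"
  assumes der: "\<And>t. t \<in> {a..b} \<Longrightarrow> (g has_real_derivative g' t) (at t within {a..b})"
    and le: "\<And>t. t \<in> {a..b} \<Longrightarrow> g' t \<le> K * g t"
    and "g a = 0" and t: "t \<in> {a..b}"
  shows "g t \<le> 0"
proof -
  define h where "h t = exp (- K * t) * g t" for t
  have hd: "(h has_real_derivative exp (- K * s) * (g' s - K * g s)) (at s within {a..b})" if "s \<in> {a..b}" for s
    unfolding h_def by (auto intro!: derivative_eq_intros der that simp: algebra_simps)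
  have "h t \<le> h a"
  proof (rule DERIV_nonpos_imp_decreasing_open[of a t h])
    show "a \<le> t" using t by simp
    fix s assume s: "a < s" "s < t"
    then have "s \<in> interior {a..b}" using t by auto
    then have "(h has_real_derivative exp (- K * s) * (g' s - K * g s)) (at s)"
      using hd[of s] at_within_interior interior_subset by (metis subsetD)
    moreover have "exp (- K * s) * (g' s - K * g s) \<le> 0"
      using le[of s] s t by (intro mult_nonneg_nonpos) auto
    ultimately show "\<exists>y. DERIV h s :> y \<and> y \<le> 0" by blast
  next
    have "continuous_on {a..b} h"
      using hd by (intro DERIV_continuous_on)
    then show "continuous_on {a..t} h" by (rule continuous_on_subset) (use t in auto)
  qed
  then show ?thesis using \<open>g a = 0\<close> by (simp add: h_def mult_le_0_iff)
qed

text \<open>Negative times are reached by reflection, for which the bound on |g'| controls both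
  signs.\<close>

lemma gronwall_zero_UNIV:
  fixes g g' :: "real \<Rightarrow> real"
  assumes der: "\<And>t. (g has_real_derivative g' t) (at t)"
    and le: "\<And>t. \<bar>g' t\<bar> \<le> K * g t"
    and "g 0 = 0"
  shows "g t \<le> 0"
proof (cases "0 \<le> t")
  case True
  show ?thesis
  proof (rule gronwall_zero[of 0 t g g' K])
    show "g' s \<le> K * g s" for s using le[of s] by simp
  qed (use True assms in \<open>auto intro: has_field_derivative_at_within\<close>)
next
  case False
  have "(\<lambda>s. g (- s)) (- t) \<le> 0"
  proof (rule gronwall_zero[of 0 "-t" "\<lambda>s. g (- s)" "\<lambda>s. - g' (- s)" K])
    show "((\<lambda>s. g (- s)) has_real_derivative - g' (- s)) (at s within {0..-t})" for s
      by (rule has_field_derivative_at_within) (use DERIV_mirror der in blast)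
    show "- g' (- s) \<le> K * g (- s)" for s using le[of "-s"] by simp
  qed (use False assms in auto)
  then show ?thesis by simp
qed

section \<open>Kepler's equation and the eccentric anomaly\<close>

lemma one_minus_e_cos_pos:
  fixes e :: real
  assumes "\<bar>e\<bar> < 1"
  shows "0 < 1 - e * cos x" "0 < 1 + e * cos x"
proof -
  have "\<bar>e * cos x\<bar> \<le> \<bar>e\<bar> * 1" unfolding abs_mult by (intro mult_left_mono) auto
  with assms show "0 < 1 - e * cos x" "0 < 1 + e * cos x" by linarith+
qed

definition ecc_anomaly :: "real \<Rightarrow> real \<Rightarrow> real" where
  "ecc_anomaly e t = (THE x. x - e * sin x = t)"

lemma kepler_equation_ex1:
  fixes e t :: real
  assumes e: "\<bar>e\<bar> < 1"
  shows "\<exists>!x. x - e * sin x = t"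
proof -
  have b: "\<bar>e * sin x\<bar> \<le> 1" for x
  proof -
    have "\<bar>e * sin x\<bar> \<le> 1 * 1" unfolding abs_mult using e by (intro mult_mono) auto
    then show ?thesis by simp
  qed
  \<comment> \<open>A solution differs from t by e sin x, hence by at most 1, which fixes the
    interval for the intermediate value theorem.\<close>
  have "\<exists>x\<ge>t - 1. x \<le> t + 1 \<and> x - e * sin x = t"
    using b[of "t - 1"] b[of "t + 1"] by (intro IVT') (auto intro!: continuous_intros simp: abs_le_iff)
  moreover have mono: "x - e * sin x < y - e * sin y" if "x < y" for x y
  proof (rule DERIV_pos_imp_increasing[OF that])
    fix z
    show "\<exists>d. ((\<lambda>x. x - e * sin x) has_real_derivative d) (at z) \<and> 0 < d"
      using one_minus_e_cos_pos(1)[OF e, of z]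
      by (intro exI[of _ "1 - e * cos z"]) (auto intro!: derivative_eq_intros)
  qed
  ultimately show ?thesis by (metis less_irrefl linorder_less_linear)
qed

lemma ecc_anomaly:
  assumes "\<bar>e\<bar> < 1"
  shows "ecc_anomaly e t - e * sin (ecc_anomaly e t) = t"
  unfolding ecc_anomaly_def by (rule theI'[OF kepler_equation_ex1[OF assms]])

lemma ecc_anomaly_eqI:
  assumes "\<bar>e\<bar> < 1" "x - e * sin x = t"
  shows "ecc_anomaly e t = x"
  using kepler_equation_ex1[OF assms(1), of t] ecc_anomaly[OF assms(1), of t] assms(2) by blast

lemma ecc_anomaly_periodic:
  assumes "\<bar>e\<bar> < 1"
  shows "ecc_anomaly e (t + 2*pi) = ecc_anomaly e t + 2*pi"
  by (rule ecc_anomaly_eqI[OF assms]) (use ecc_anomaly[OF assms, of t] in simp)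

lemma open_eccentricities: "open {p :: real \<times> real. \<bar>fst p\<bar> < 1}"
  by (intro open_Collect_less continuous_intros)

text \<open>The inverse function theorem for \<open>(e, x) \<mapsto> (e, x - e sin x)\<close>.\<close>

lemma ecc_anomaly_has_derivative:
  fixes e t :: real
  assumes e: "\<bar>e\<bar> < 1"
  defines "x \<equiv> ecc_anomaly e t"
  shows "((\<lambda>p. ecc_anomaly (fst p) (snd p)) has_derivative
    (\<lambda>h. (snd h + fst h * sin x) / (1 - e * cos x))) (at (e, t))"
proof -
  define f :: "real \<times> real \<Rightarrow> real \<times> real" where "f p = (fst p, snd p - fst p * sin (snd p))" for p
  define g :: "real \<times> real \<Rightarrow> real \<times> real" where "g p = (fst p, ecc_anomaly (fst p) (snd p))" for p
  have pos: "1 - e * cos x \<noteq> 0" using one_minus_e_cos_pos(1)[OF e, of x] by simp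
  have "(g has_derivative (\<lambda>h. (fst h, (snd h + fst h * sin x) / (1 - e * cos x)))) (at (f (e, x)))"
  \<comment> \<open>This form of the theorem takes a left inverse of f without asking for its
    continuity; continuity of \<open>ecc_anomaly\<close> is derived afterwards, from its
    derivative.\<close>
  proof (rule has_derivative_inverse_strong[where f = f and x = "(e, x)", OF open_eccentricities])
    show "continuous_on {p. \<bar>fst p\<bar> < 1} f" unfolding f_def by (intro continuous_intros)
    show "g (f p) = p" if "p \<in> {p. \<bar>fst p\<bar> < 1}" for p
      using that by (cases p) (auto simp: f_def g_def intro!: ecc_anomaly_eqI)
    show "(f has_derivative (\<lambda>h. (fst h, snd h - fst h * sin x - e * (cos x * snd h)))) (at (e, x))"
      unfolding f_def by (auto intro!: derivative_eq_intros simp: algebra_simps)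
    show "(\<lambda>h. (fst h, snd h - fst h * sin x - e * (cos x * snd h)))
        \<circ> (\<lambda>h. (fst h, (snd h + fst h * sin x) / (1 - e * cos x))) = id"
    proof
      fix h :: "real \<times> real"
      obtain a b where h: "h = (a, b)" by (cases h)
      define k where "k = (b + a * sin x) / (1 - e * cos x)"
      have "k * (1 - e * cos x) = b + a * sin x" using pos by (simp add: k_def)
      then have "k - a * sin x - e * (cos x * k) = b" by (simp add: algebra_simps)
      then show "((\<lambda>h. (fst h, snd h - fst h * sin x - e * (cos x * snd h)))
        \<circ> (\<lambda>h. (fst h, (snd h + fst h * sin x) / (1 - e * cos x)))) h = id h"
        by (simp add: h k_def)
    qed
  qed (use e in simp)
  moreover have "f (e, x) = (e, t)" using ecc_anomaly[OF e, of t] by (simp add: f_def x_def)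
  ultimately have "(g has_derivative (\<lambda>h. (fst h, (snd h + fst h * sin x) / (1 - e * cos x)))) (at (e, t))"
    by simp
  from has_derivative_snd[OF this] show ?thesis by (simp add: g_def)
qed

lemma ecc_anomaly_deriv_t:
  assumes e: "\<bar>e\<bar> < 1"
  shows "(ecc_anomaly e has_real_derivative 1 / (1 - e * cos (ecc_anomaly e t))) (at t)"
proof -
  have "((\<lambda>t. (e, t)) has_derivative (\<lambda>h. (0, h))) (at t)"
    by (auto intro!: derivative_eq_intros)
  from has_derivative_compose[OF this ecc_anomaly_has_derivative[OF e]]
  show ?thesis unfolding fst_conv snd_conv by (rule has_derivative_imp_has_field_derivative) simp
qed

lemma continuous_on_ecc_anomaly:
  "continuous_on {p. \<bar>fst p\<bar> < 1} (\<lambda>p. ecc_anomaly (fst p) (snd p))"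
proof (rule continuous_at_imp_continuous_on, intro ballI)
  fix p :: "real \<times> real" assume "p \<in> {p. \<bar>fst p\<bar> < 1}"
  then show "isCont (\<lambda>p. ecc_anomaly (fst p) (snd p)) p"
    using has_derivative_continuous[OF ecc_anomaly_has_derivative[of "fst p" "snd p"]] by simp
qed

text \<open>Makes the definite description in \<open>kepler_angle\<close> denote the explicit angle
  found below. The right-hand side of the ODE is Lipschitz, so Gronwall applies to the square of the
  difference of two solutions.\<close>

lemma kepler_angle_unique:
  assumes e: "\<bar>e\<bar> < 1"
    and f: "\<And>t. (f has_real_derivative (1 + e * cos (f t))\<^sup>2 / sqrt (1 - e\<^sup>2) ^ 3) (at t)" "f 0 = 0"
    and g: "\<And>t. (g has_real_derivative (1 + e * cos (g t))\<^sup>2 / sqrt (1 - e\<^sup>2) ^ 3) (at t)" "g 0 = 0"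
  shows "f = g"
proof
  fix t
  define F where "F x = (1 + e * cos x)\<^sup>2 / sqrt (1 - e\<^sup>2) ^ 3" for x
  define F' where "F' x = - (2 * (1 + e * cos x) * (e * sin x)) / sqrt (1 - e\<^sup>2) ^ 3" for x
  \<comment> \<open>The numerator of \<open>F'\<close> is a product of 2, a factor of size at most 2
    and a factor of size at most 1.\<close>
  define L where "L = 4 / sqrt (1 - e\<^sup>2) ^ 3"
  have c: "0 < sqrt (1 - e\<^sup>2)" using e by (simp add: abs_square_less_1)
  have F: "(F has_real_derivative F' x) (at x)" for x
    unfolding F_def F'_def by (rule DERIV_cdivide) (auto intro!: derivative_eq_intros)
  have F'L: "\<bar>F' x\<bar> \<le> L" for x
  proof -
    have "\<bar>e * cos x\<bar> \<le> 1 * 1" unfolding abs_mult using e by (intro mult_mono) auto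
    then have "\<bar>1 + e * cos x\<bar> \<le> 2" by linarith
    moreover have "\<bar>e * sin x\<bar> \<le> 1 * 1" unfolding abs_mult using e by (intro mult_mono) auto
    ultimately have "\<bar>2 * (1 + e * cos x) * (e * sin x)\<bar> \<le> (2 * 2) * 1"
      unfolding abs_mult[of "2 * (1 + e * cos x)"] by (intro mult_mono) auto
    then show ?thesis using c by (simp add: F'_def L_def divide_right_mono)
  qed
  have lip: "\<bar>F x - F y\<bar> \<le> L * \<bar>x - y\<bar>" for x y
    using field_differentiable_bound[of UNIV F F' L x y] F F'L by (simp add: has_field_derivative_at_within)
  have "(f t - g t)\<^sup>2 \<le> 0"
  proof (rule gronwall_zero_UNIV[of "\<lambda>t. (f t - g t)\<^sup>2" "\<lambda>t. 2 * (f t - g t) * (F (f t) - F (g t))" "2 * L"])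
    show "((\<lambda>t. (f t - g t)\<^sup>2) has_real_derivative 2 * (f t - g t) * (F (f t) - F (g t))) (at t)" for t
      using f(1)[of t] g(1)[of t] by (auto intro!: derivative_eq_intros simp: F_def)
    show "\<bar>2 * (f t - g t) * (F (f t) - F (g t))\<bar> \<le> 2 * L * (f t - g t)\<^sup>2" for t
    proof -
      have "\<bar>2 * (f t - g t) * (F (f t) - F (g t))\<bar> = 2 * \<bar>f t - g t\<bar> * \<bar>F (f t) - F (g t)\<bar>"
        by (simp only: abs_mult abs_numeral)
      also have "\<dots> \<le> 2 * \<bar>f t - g t\<bar> * (L * \<bar>f t - g t\<bar>)"
        by (intro mult_left_mono lip) auto
      also have "\<dots> = 2 * L * \<bar>f t - g t\<bar>\<^sup>2" by (simp only: power2_eq_square mult_ac)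
      finally show ?thesis by simp
    qed
  qed (use f g in simp)
  then show "f t = g t" by simp
qed

section \<open>The true anomaly in terms of the eccentric anomaly\<close>

lemma ellipse_parameters:
  fixes e :: real
  assumes e: "\<bar>e\<bar> < 1"
  defines "c \<equiv> sqrt (1 - e\<^sup>2)"
  shows "0 < c" "c\<^sup>2 = 1 - e\<^sup>2" "c * c = 1 - e * e"
  using e by (simp_all add: c_def abs_square_less_1 power2_eq_square abs_square_le_1 flip: power2_eq_square)

text \<open>
  The true anomaly lifts to \<open>\<theta> = x + 2 arctan (b sin x / (1 - b cos x))\<close>, where \<open>x\<close> is the eccentric
  anomaly and \<open>b = e / (1 + sqrt (1 - e\<^sup>2))\<close>.
\<close>

lemma kepler_angle:
  fixes e t :: real
  assumes e: "\<bar>e\<bar> < 1"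
  defines "x \<equiv> ecc_anomaly e t"
  shows "cos (kepler_angle e t) = (cos x - e) / (1 - e * cos x)"
    and "sin (kepler_angle e t) = sqrt (1 - e\<^sup>2) * sin x / (1 - e * cos x)"
proof -
  define c where "c = sqrt (1 - e\<^sup>2)"
  define b where "b = e / (1 + c)"
  note c = ellipse_parameters[OF e, folded c_def]
  have be: "b * (1 + c) = e" using c(1) by (simp add: b_def)
  have b1: "\<bar>b\<bar> < 1" unfolding b_def using c(1) e by simp
  \<comment> \<open>If e is the sine of an angle, then c is its cosine and b the tangent of its
    half; this is b^2 = (1 - c) / (1 + c). Later b is eliminated through \<open>be\<close> and
    \<open>b2\<close>.\<close>
  have b2: "b\<^sup>2 * (1 + c) = 1 - c"
  proof -
    have "b\<^sup>2 * (1 + c) * (1 + c) = (b * (1 + c))\<^sup>2" by (simp add: power2_eq_square)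
    also have "\<dots> = 1 - c * c" unfolding be c(3) by (simp add: power2_eq_square)
    also have "\<dots> = (1 - c) * (1 + c)" by (simp add: algebra_simps)
    finally have "b\<^sup>2 * (1 + c) * (1 + c) = (1 - c) * (1 + c)" .
    then show ?thesis using c(1) by simp
  qed
  define \<theta> where "\<theta> t = ecc_anomaly e t + 2 * arctan (b * sin (ecc_anomaly e t) / (1 - b * cos (ecc_anomaly e t)))" for t
  have cs: "cos (\<theta> t) = (cos x - e) / (1 - e * cos x)" "sin (\<theta> t) = c * sin x / (1 - e * cos x)"
    and D: "(1 - b * cos x)\<^sup>2 + (b * sin x)\<^sup>2 = 2 * (1 - e * cos x) / (1 + c)"
    if "x = ecc_anomaly e t" for x t
  proof -
    \<comment> \<open>As a complex number m + i n = 1 - b exp (- i x). So arctan (n / m) is its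
      argument, because m > 0, and m^2 + n^2 is its squared modulus.\<close>
    define m where "m = 1 - b * cos x"
    define n where "n = b * sin x"
    have m: "0 < m" unfolding m_def by (rule one_minus_e_cos_pos[OF b1])
    have rho: "0 < 1 - e * cos x" by (rule one_minus_e_cos_pos[OF e])
    have sc: "(sin x)\<^sup>2 = 1 - (cos x)\<^sup>2" by (rule sin_squared_eq)
    have "(1 + c) * (m\<^sup>2 + n\<^sup>2) = (1 + c) - 2 * (b * (1 + c)) * cos x + b\<^sup>2 * (1 + c)"
      unfolding m_def n_def power_mult_distrib sc by (simp add: power2_eq_square algebra_simps)
    also have "\<dots> = 2 * (1 - e * cos x)" unfolding be b2 by simp
    finally have D': "m\<^sup>2 + n\<^sup>2 = 2 * (1 - e * cos x) / (1 + c)" using c(1) by (simp add: field_simps)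
    then show "(1 - b * cos x)\<^sup>2 + (b * sin x)\<^sup>2 = 2 * (1 - e * cos x) / (1 + c)"
      by (simp add: m_def n_def)
    have Dp: "0 < m\<^sup>2 + n\<^sup>2" using m by (simp add: sum_power2_gt_zero_iff)
    define A where "A = m\<^sup>2 + n\<^sup>2"
    have A: "A \<noteq> 0" using Dp unfolding A_def by linarith
    have "1 + (n / m)\<^sup>2 = A / m\<^sup>2" using m by (simp add: A_def field_simps power2_eq_square)
    moreover have "(sqrt (1 + (n / m)\<^sup>2))\<^sup>2 = 1 + (n / m)\<^sup>2" by simp
    ultimately have s2: "(sqrt (1 + (n / m)\<^sup>2))\<^sup>2 = A / m\<^sup>2" by (simp only:)
    have co: "cos (2 * arctan (n / m)) = (m\<^sup>2 - n\<^sup>2) / (m\<^sup>2 + n\<^sup>2)"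
      unfolding A_def[symmetric] cos_double cos_arctan sin_arctan power_divide s2[unfolded power_divide]
      using m A by (simp add: diff_divide_distrib)
    have si: "sin (2 * arctan (n / m)) = 2 * n * m / (m\<^sup>2 + n\<^sup>2)"
    proof -
      have "sin (2 * arctan (n / m)) = 2 * (n / m) / (sqrt (1 + (n / m)\<^sup>2))\<^sup>2"
        unfolding sin_double cos_arctan sin_arctan by (simp add: power2_eq_square)
      then show ?thesis unfolding s2 A_def[symmetric] using m A by (simp add: power2_eq_square)
    qed
    have aux: "2 * y / (1 + c) / (2 * z / (1 + c)) = y / z" for y z using c(1) by simp
    have \<theta>: "\<theta> t = x + 2 * arctan (n / m)" by (simp add: \<theta>_def m_def n_def that)
    \<comment> \<open>Real part of exp (i x) (m + i n)^2 / (m^2 + n^2); the sine below is the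
      imaginary part.\<close>
    have "cos (\<theta> t) = (cos x * (m\<^sup>2 - n\<^sup>2) - sin x * (2 * n * m)) / (m\<^sup>2 + n\<^sup>2)"
      unfolding \<theta> cos_add co si by (simp only: times_divide_eq_right diff_divide_distrib[symmetric])
    also have "cos x * (m\<^sup>2 - n\<^sup>2) - sin x * (2 * n * m) = cos x * (1 + b\<^sup>2) - 2 * b"
    proof -
      have "cos x * (m\<^sup>2 - n\<^sup>2) - sin x * (2 * n * m)
          = cos x * (m\<^sup>2 - b\<^sup>2 * (sin x)\<^sup>2) - 2 * b * (sin x)\<^sup>2 * m"
        by (simp add: n_def power2_eq_square algebra_simps)
      then show ?thesis unfolding sc by (simp add: m_def power2_eq_square algebra_simps)
    qed
    also have "\<dots> = 2 * (cos x - e) / (1 + c)"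
    proof -
      have "(cos x * (1 + b\<^sup>2) - 2 * b) * (1 + c) = cos x * ((1 + c) + b\<^sup>2 * (1 + c)) - 2 * (b * (1 + c))"
        by (simp add: algebra_simps)
      also have "\<dots> = 2 * (cos x - e)" unfolding be b2 by simp
      finally show ?thesis using c(1) by (simp add: field_simps)
    qed
    finally show "cos (\<theta> t) = (cos x - e) / (1 - e * cos x)"
      unfolding D' aux .
    have "sin (\<theta> t) = (sin x * (m\<^sup>2 - n\<^sup>2) + cos x * (2 * n * m)) / (m\<^sup>2 + n\<^sup>2)"
      unfolding \<theta> sin_add co si by (simp only: times_divide_eq_right add_divide_distrib[symmetric])
    also have "sin x * (m\<^sup>2 - n\<^sup>2) + cos x * (2 * n * m) = sin x * (1 - b\<^sup>2)"
    proof -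
      have "sin x * (m\<^sup>2 - n\<^sup>2) + cos x * (2 * n * m)
          = sin x * (m\<^sup>2 - b\<^sup>2 * (sin x)\<^sup>2 + 2 * b * cos x * m)"
        by (simp add: n_def power2_eq_square algebra_simps)
      then show ?thesis unfolding sc by (simp add: m_def power2_eq_square algebra_simps)
    qed
    also have "\<dots> = 2 * (c * sin x) / (1 + c)"
    proof -
      have "sin x * (1 - b\<^sup>2) * (1 + c) = sin x * ((1 + c) - b\<^sup>2 * (1 + c))"
        by (simp add: algebra_simps)
      also have "\<dots> = 2 * (c * sin x)" unfolding b2 by simp
      finally show ?thesis using c(1) by (simp add: field_simps)
    qed
    finally show "sin (\<theta> t) = c * sin x / (1 - e * cos x)"
      unfolding D' aux .
  qed
  have \<theta>0: "\<theta> 0 = 0"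
  proof -
    have "ecc_anomaly e 0 = 0" by (rule ecc_anomaly_eqI[OF e]) simp
    then show ?thesis by (simp add: \<theta>_def)
  qed
  have d\<theta>: "(\<theta> has_real_derivative (1 + e * cos (\<theta> t))\<^sup>2 / c ^ 3) (at t)" for t
  proof -
    define x where "x = ecc_anomaly e t"
    define m where "m = 1 - b * cos x"
    define n where "n = b * sin x"
    define \<rho> where "\<rho> = 1 - e * cos x"
    have m: "0 < m" unfolding m_def by (rule one_minus_e_cos_pos[OF b1])
    have rho: "0 < \<rho>" unfolding \<rho>_def by (rule one_minus_e_cos_pos[OF e])
    have sc: "(sin x)\<^sup>2 = 1 - (cos x)\<^sup>2" by (rule sin_squared_eq)
    have Dx: "m\<^sup>2 + n\<^sup>2 = 2 * \<rho> / (1 + c)" unfolding m_def n_def \<rho>_def by (rule D[OF x_def])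
    have dE: "(ecc_anomaly e has_real_derivative 1 / \<rho>) (at t)"
      unfolding \<rho>_def x_def by (rule ecc_anomaly_deriv_t[OF e])
    have "((\<lambda>t. 1 - b * cos (ecc_anomaly e t)) has_real_derivative n / \<rho>) (at t)"
      and "((\<lambda>t. b * sin (ecc_anomaly e t)) has_real_derivative b * cos x / \<rho>) (at t)"
      by (auto intro!: derivative_eq_intros dE simp: n_def x_def)
    from DERIV_divide[OF this(2,1)] m
    have "((\<lambda>t. b * sin (ecc_anomaly e t) / (1 - b * cos (ecc_anomaly e t))) has_real_derivative
        (b * cos x * m - n * n) / \<rho> / (m * m)) (at t)"
      by (simp add: m_def n_def x_def diff_divide_distrib)
    from DERIV_chain2[OF DERIV_arctan this]
    have "((\<lambda>t. arctan (b * sin (ecc_anomaly e t) / (1 - b * cos (ecc_anomaly e t)))) has_real_derivative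
        ((b * cos x * m - n * n) / \<rho> / (m * m)) / (1 + (n / m)\<^sup>2)) (at t)"
      by (simp add: m_def n_def x_def divide_inverse mult.commute)
    from DERIV_add[OF dE DERIV_cmult[OF this, of 2]]
    have "(\<theta> has_real_derivative 1 / \<rho> + 2 * (((b * cos x * m - n * n) / \<rho> / (m * m)) / (1 + (n / m)\<^sup>2))) (at t)"
      unfolding \<theta>_def .
    \<comment> \<open>This is the area law: \<rho> is the distance to the focus and c the angular
      momentum. The next step rewrites \<rho> as c^2 / (1 + e cos \<theta>), the polar equation of
      the ellipse.\<close>
    also have "1 / \<rho> + 2 * (((b * cos x * m - n * n) / \<rho> / (m * m)) / (1 + (n / m)\<^sup>2)) = c / \<rho>\<^sup>2"
    proof -
      have X: "((b * cos x * m - n * n) / \<rho> / (m * m)) / (1 + (n / m)\<^sup>2) = (b * cos x * m - n * n) / \<rho> / (m\<^sup>2 + n\<^sup>2)"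
      proof -
        have "m * m * (1 + (n / m)\<^sup>2) = m\<^sup>2 + n\<^sup>2"
          using m by (simp add: field_simps power2_eq_square)
        then show ?thesis by (metis divide_divide_eq_left)
      qed
      have X': "b * cos x * m - n * n = b * cos x - b\<^sup>2"
      proof -
        have "n * n = b\<^sup>2 * (sin x)\<^sup>2" by (simp add: n_def power2_eq_square)
        then show ?thesis unfolding sc by (simp add: m_def power2_eq_square algebra_simps)
      qed
      have Y: "2 * (y / \<rho> / (2 * \<rho> / (1 + c))) = (1 + c) * y / \<rho>\<^sup>2" for y
        using rho c(1) by (simp add: power2_eq_square)
      have "1 / \<rho> + 2 * (((b * cos x * m - n * n) / \<rho> / (m * m)) / (1 + (n / m)\<^sup>2))
        = 1 / \<rho> + (b * (1 + c) * cos x - b\<^sup>2 * (1 + c)) / \<rho>\<^sup>2"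
        unfolding X unfolding X' Dx Y by (simp add: algebra_simps)
      also have "\<dots> = (\<rho> + e * cos x - (1 - c)) / \<rho>\<^sup>2"
        unfolding be b2 using rho by (simp add: field_simps power2_eq_square)
      finally show ?thesis by (simp add: \<rho>_def)
    qed
    also have "c / \<rho>\<^sup>2 = (1 + e * cos (\<theta> t))\<^sup>2 / c ^ 3"
    proof -
      have eq: "1 + e * cos (\<theta> t) = c\<^sup>2 / \<rho>"
        unfolding cs(1)[OF x_def] \<rho>_def[symmetric] c(2) using rho by (simp add: \<rho>_def field_simps power2_eq_square)
      show ?thesis unfolding eq using c(1) rho by (simp add: power_divide field_simps eval_nat_numeral)
    qed
    finally show ?thesis .
  qed
  have "kepler_angle e = \<theta>"
    unfolding kepler_angle_def c_def[symmetric]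
    using \<theta>0 d\<theta> kepler_angle_unique[OF e, folded c_def] by (intro the_equality) auto
  then show "cos (kepler_angle e t) = (cos x - e) / (1 - e * cos x)"
    "sin (kepler_angle e t) = sqrt (1 - e\<^sup>2) * sin x / (1 - e * cos x)"
    using cs[OF refl, of t] by (simp_all add: x_def c_def)
qed


section \<open>Calculus with explicit vectors in three dimensions\<close>

lemma vector_3_eq:
  "(vector [a, b, c] :: real ^ 3) = a *\<^sub>R axis 1 1 + b *\<^sub>R axis 2 1 + c *\<^sub>R axis 3 1"
  by (simp add: vec_eq_iff forall_3 axis_def)

lemma has_derivative_vector_3:
  fixes a b c :: "'a::real_normed_vector \<Rightarrow> real"
  assumes "(a has_derivative a') F" "(b has_derivative b') F" "(c has_derivative c') F"
  shows "((\<lambda>x. vector [a x, b x, c x] :: real ^ 3) has_derivative (\<lambda>h. vector [a' h, b' h, c' h])) F"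
  unfolding vector_3_eq by (intro has_derivative_add has_derivative_scaleR_left assms)

lemma has_vector_derivative_vector_3:
  assumes "(a has_real_derivative a') F" "(b has_real_derivative b') F" "(c has_real_derivative c') F"
  shows "((\<lambda>x. vector [a x, b x, c x] :: real ^ 3) has_vector_derivative vector [a', b', c']) F"
proof -
  have *: "(\<lambda>h. vector [h * a', h * b', h * c'] :: real ^ 3) = (\<lambda>h. h *\<^sub>R vector [a', b', c'])"
    by (simp add: vec_eq_iff forall_3 fun_eq_iff)
  show ?thesis
    using has_derivative_vector_3[of a "\<lambda>h. h * a'" F b "\<lambda>h. h * b'" c "\<lambda>h. h * c'"] assms
    by (simp add: has_vector_derivative_def has_field_derivative_def mult_commute_abs *)
qed

lemma continuous_on_vector_3:
  assumes "continuous_on S a" "continuous_on S b" "continuous_on S c"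
  shows "continuous_on S (\<lambda>x. vector [a x, b x, c x] :: real ^ 3)"
  unfolding vector_3_eq by (intro continuous_intros assms)

lemma inner_vector_3: "(vector [a, b, c] :: real ^ 3) \<bullet> vector [x, y, z] = a * x + b * y + c * z"
  by (simp add: inner_vec_def sum_3)

lemma
  fixes a b c x y z k :: real
  shows vector_3_add: "vector [a, b, c] + vector [x, y, z] = (vector [a + x, b + y, c + z] :: real ^ 3)"
    and vector_3_diff: "vector [a, b, c] - vector [x, y, z] = (vector [a - x, b - y, c - z] :: real ^ 3)"
    and vector_3_scaleR: "k *\<^sub>R vector [a, b, c] = (vector [k * a, k * b, k * c] :: real ^ 3)"
    and vector_3_uminus: "- vector [a, b, c] = (vector [- a, - b, - c] :: real ^ 3)"
    and vector_3_zero: "(0 :: real ^ 3) = vector [0, 0, 0]"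
    and vector_3_inject: "(vector [a, b, c] :: real ^ 3) = vector [x, y, z] \<longleftrightarrow> a = x \<and> b = y \<and> c = z"
  by (simp_all add: vec_eq_iff forall_3)

section \<open>The ellipse and its derivatives in closed form\<close>

lemma kepler_ellipse_eq:
  assumes e: "\<bar>e\<bar> < 1"
  shows "kepler_ellipse e t
    = vector [cos (ecc_anomaly e t) - e, sqrt (1 - e\<^sup>2) * sin (ecc_anomaly e t), 0]"
proof -
  define x where "x = ecc_anomaly e t"
  define c where "c = sqrt (1 - e\<^sup>2)"
  note c = ellipse_parameters[OF e, folded c_def]
  have rho: "0 < 1 - e * cos x" by (rule one_minus_e_cos_pos[OF e])
  have a: "1 + e * ((cos x - e) / (1 - e * cos x)) = c\<^sup>2 / (1 - e * cos x)"
    unfolding c(2) using rho by (simp add: field_simps power2_eq_square)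
  show ?thesis
    unfolding kepler_ellipse_def Let_def kepler_angle[OF e] x_def[symmetric] c_def[symmetric] a
      vector_3_scaleR vector_3_inject
    using c(1) rho by simp
qed

lemma norm_kepler_ellipse:
  assumes e: "\<bar>e\<bar> < 1"
  shows "norm (kepler_ellipse e t) = 1 - e * cos (ecc_anomaly e t)"
proof -
  define x where "x = ecc_anomaly e t"
  have "(norm (kepler_ellipse e t))\<^sup>2 = (cos x - e)\<^sup>2 + (sqrt (1 - e\<^sup>2))\<^sup>2 * (sin x)\<^sup>2"
    unfolding power2_norm_eq_inner kepler_ellipse_eq[OF e] inner_vector_3 x_def
    by (simp add: power2_eq_square mult_ac)
  also have "\<dots> = (1 - e * cos x)\<^sup>2"
    unfolding ellipse_parameters(2)[OF e] sin_squared_eq by (simp add: power2_eq_square algebra_simps)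
  finally show ?thesis
    using one_minus_e_cos_pos(1)[OF e, of x] by (simp add: x_def)
qed

lemma kepler_ellipse_nonzero:
  assumes "\<bar>e\<bar> < 1"
  shows "kepler_ellipse e t \<noteq> 0"
  using norm_kepler_ellipse[OF assms, of t] one_minus_e_cos_pos(1)[OF assms, of "ecc_anomaly e t"] by auto

lemma kepler_ellipse_periodic:
  assumes "\<bar>e\<bar> < 1"
  shows "kepler_ellipse e (t + 2*pi) = kepler_ellipse e t"
  by (simp add: kepler_ellipse_eq[OF assms] ecc_anomaly_periodic[OF assms])

definition ellipse_velocity :: "real \<Rightarrow> real \<Rightarrow> real ^ 3" where
  "ellipse_velocity e t = (let x = ecc_anomaly e t in
     vector [- sin x / (1 - e * cos x), sqrt (1 - e\<^sup>2) * cos x / (1 - e * cos x), 0])"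

text \<open>At fixed time the eccentric anomaly x has e-derivative sin x / (1 - e cos x), and sqrt
  (1 - e^2) has derivative - e / sqrt (1 - e^2).\<close>

definition ellipse_deriv_e :: "real \<Rightarrow> real \<Rightarrow> real ^ 3" where
  "ellipse_deriv_e e t = (let x = ecc_anomaly e t; c = sqrt (1 - e\<^sup>2) in
     vector [- (sin x)\<^sup>2 / (1 - e * cos x) - 1, c * sin x * cos x / (1 - e * cos x) - e * sin x / c, 0])"

text \<open>Computed with dx/dt = 1 / \<rho>. It supplies the second half of the initial data of the
  solution \<open>ellipse_deriv_e\<close>.\<close>

definition ellipse_deriv_e_velocity :: "real \<Rightarrow> real \<Rightarrow> real ^ 3" where
  "ellipse_deriv_e_velocity e t = (let x = ecc_anomaly e t; c = sqrt (1 - e\<^sup>2); \<rho> = 1 - e * cos x in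
     vector [- 2 * sin x * cos x / \<rho>\<^sup>2 + e * (sin x) ^ 3 / \<rho> ^ 3,
       c * ((cos x)\<^sup>2 - (sin x)\<^sup>2) / \<rho>\<^sup>2 - c * e * (sin x)\<^sup>2 * cos x / \<rho> ^ 3 - e * cos x / (c * \<rho>), 0])"

text \<open>Joint differentiability gives both partial derivatives by restriction, and later the
  uniform expansion along curves that move eccentricity and phase together.\<close>

lemma has_derivative_kepler_ellipse:
  assumes e: "\<bar>e\<bar> < 1"
  shows "((\<lambda>p. kepler_ellipse (fst p) (snd p)) has_derivative
    (\<lambda>h. fst h *\<^sub>R ellipse_deriv_e e t + snd h *\<^sub>R ellipse_velocity e t)) (at (e, t))"
proof -
  define x where "x = ecc_anomaly e t"
  define c where "c = sqrt (1 - e\<^sup>2)"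
  define \<rho> where "\<rho> = 1 - e * cos x"
  note c = ellipse_parameters[OF e, folded c_def]
  have rho: "0 < \<rho>" unfolding \<rho>_def by (rule one_minus_e_cos_pos[OF e])
  note dE = ecc_anomaly_has_derivative[OF e, of t, folded x_def, folded \<rho>_def]
  define E where "E p = ecc_anomaly (fst p) (snd p)" for p
  have E: "E (e, t) = x" by (simp add: E_def x_def)
  have dE: "(E has_derivative (\<lambda>h. (snd h + fst h * sin x) / \<rho>)) (at (e, t))"
    unfolding E_def[abs_def] by (rule dE)
  have "((\<lambda>y. sqrt (1 - y\<^sup>2)) has_real_derivative - e / c) (at e)"
    using c(1) by (auto intro!: derivative_eq_intros simp: c_def field_simps)
  then have ds: "((\<lambda>p. sqrt (1 - (fst p)\<^sup>2)) has_derivative (\<lambda>h. - e / c * fst h)) (at (e, t))"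
  proof -
    have "(fst has_derivative fst) (at (e, t))"
      by (intro bounded_linear_imp_has_derivative bounded_linear_fst)
    moreover assume "((\<lambda>y. sqrt (1 - y\<^sup>2)) has_real_derivative - e / c) (at e)"
    ultimately show ?thesis
      using DERIV_compose_FDERIV[where f = "\<lambda>y. sqrt (1 - y\<^sup>2)" and g = fst and x = "(e, t)"]
      by (fastforce simp: mult.commute)
  qed
  have "((\<lambda>p. vector [cos (E p) - fst p, sqrt (1 - (fst p)\<^sup>2) * sin (E p), 0] :: real ^ 3) has_derivative
     (\<lambda>h. vector [- sin x * ((snd h + fst h * sin x) / \<rho>) - fst h,
        c * (cos x * ((snd h + fst h * sin x) / \<rho>)) + (- e / c * fst h) * sin x, 0])) (at (e, t))"
  proof (intro has_derivative_vector_3)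
    show "((\<lambda>p. cos (E p) - fst p) has_derivative
        (\<lambda>h. - sin x * ((snd h + fst h * sin x) / \<rho>) - fst h)) (at (e, t))"
      by (auto intro!: derivative_eq_intros dE simp: E)
    have "((\<lambda>p. sin (E p)) has_derivative (\<lambda>h. cos x * ((snd h + fst h * sin x) / \<rho>))) (at (e, t))"
      by (auto intro!: derivative_eq_intros dE simp: E)
    from has_derivative_mult[OF ds this]
    show "((\<lambda>p. sqrt (1 - (fst p)\<^sup>2) * sin (E p)) has_derivative
        (\<lambda>h. c * (cos x * ((snd h + fst h * sin x) / \<rho>)) + (- e / c * fst h) * sin x)) (at (e, t))"
      by (simp add: E c_def[symmetric])
  qed simp
  also have "(\<lambda>h. vector [- sin x * ((snd h + fst h * sin x) / \<rho>) - fst h,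
        c * (cos x * ((snd h + fst h * sin x) / \<rho>)) + (- e / c * fst h) * sin x, 0] :: real ^ 3)
     = (\<lambda>h. fst h *\<^sub>R ellipse_deriv_e e t + snd h *\<^sub>R ellipse_velocity e t)"
    unfolding ellipse_deriv_e_def ellipse_velocity_def Let_def x_def[symmetric] c_def[symmetric]
      \<rho>_def[symmetric] vector_3_scaleR vector_3_add vector_3_inject fun_eq_iff
    using c(1) rho by (simp add: field_simps power2_eq_square)
  finally show ?thesis
    \<comment> \<open>The closed form is proved for |e| < 1 only, which is an open condition and so
      suffices for the derivative.\<close>
    by (rule has_derivative_transform_within_open[OF _ open_eccentricities])
      (use e in \<open>auto simp: kepler_ellipse_eq E_def\<close>)
qed

lemma kepler_ellipse_deriv_t:
  assumes e: "\<bar>e\<bar> < 1"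
  shows "(kepler_ellipse e has_vector_derivative ellipse_velocity e t) (at t)"
proof -
  have "((\<lambda>t. (e, t)) has_derivative (\<lambda>h. (0, h))) (at t)"
    by (auto intro!: derivative_eq_intros)
  from has_derivative_compose[OF this has_derivative_kepler_ellipse[OF e]]
  show ?thesis by (simp add: has_vector_derivative_def)
qed

lemma kepler_ellipse_deriv_e_eq:
  assumes e: "\<bar>e\<bar> < 1"
  shows "kepler_ellipse_deriv_e e = ellipse_deriv_e e"
proof
  fix t :: real
  have "((\<lambda>e. (e, t)) has_derivative (\<lambda>h. (h, 0))) (at e)"
    by (auto intro!: derivative_eq_intros)
  from has_derivative_compose[OF this has_derivative_kepler_ellipse[OF e]]
  have "((\<lambda>e'. kepler_ellipse e' t) has_vector_derivative ellipse_deriv_e e t) (at e)"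
    by (simp add: has_vector_derivative_def)
  then show "kepler_ellipse_deriv_e e t = ellipse_deriv_e e t"
    by (simp add: kepler_ellipse_deriv_e_def vector_derivative_at)
qed

lemma ellipse_velocity_deriv:
  assumes e: "\<bar>e\<bar> < 1"
  shows "(ellipse_velocity e has_vector_derivative - kepler_field (kepler_ellipse e t)) (at t)"
proof -
  define x where "x = ecc_anomaly e t"
  define c where "c = sqrt (1 - e\<^sup>2)"
  define \<rho> where "\<rho> = 1 - e * cos x"
  have rho: "0 < \<rho>" unfolding \<rho>_def by (rule one_minus_e_cos_pos[OF e])
  note dE = ecc_anomaly_deriv_t[OF e, of t, folded x_def, folded \<rho>_def]
  have ec: "e * cos x = 1 - \<rho>" by (simp add: \<rho>_def)
  have es: "e * (sin x)\<^sup>2 = e - cos x * (1 - \<rho>)"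
  proof -
    have "e * (sin x)\<^sup>2 = e - (e * cos x) * cos x"
      unfolding sin_squared_eq by (simp add: power2_eq_square algebra_simps)
    then show ?thesis unfolding ec by (simp add: mult.commute)
  qed
  have d\<rho>: "((\<lambda>t. 1 - e * cos (ecc_anomaly e t)) has_real_derivative e * sin x / \<rho>) (at t)"
    and ds: "((\<lambda>t. - sin (ecc_anomaly e t)) has_real_derivative - cos x / \<rho>) (at t)"
    and dc: "((\<lambda>t. c * cos (ecc_anomaly e t)) has_real_derivative - c * sin x / \<rho>) (at t)"
    by (auto intro!: derivative_eq_intros dE simp: x_def)
  have 1: "((\<lambda>t. - sin (ecc_anomaly e t) / (1 - e * cos (ecc_anomaly e t))) has_real_derivative
     - (cos x - e) / \<rho> ^ 3) (at t)"
  proof (rule DERIV_cong[OF DERIV_divide[OF ds d\<rho>]])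
    show "1 - e * cos (ecc_anomaly e t) \<noteq> 0" using rho by (simp add: \<rho>_def x_def)
    have "(- cos x / \<rho> * \<rho> - - sin x * (e * sin x / \<rho>)) / (\<rho> * \<rho>) = (e * (sin x)\<^sup>2 - cos x * \<rho>) / \<rho> ^ 3"
      using rho by (simp add: field_simps power2_eq_square eval_nat_numeral)
    also have "\<dots> = - (cos x - e) / \<rho> ^ 3" unfolding es by (simp add: algebra_simps)
    finally show "(- cos x / \<rho> * (1 - e * cos (ecc_anomaly e t)) - - sin (ecc_anomaly e t) * (e * sin x / \<rho>)) /
        ((1 - e * cos (ecc_anomaly e t)) * (1 - e * cos (ecc_anomaly e t))) = - (cos x - e) / \<rho> ^ 3"
      by (simp add: \<rho>_def x_def)
  qed
  have 2: "((\<lambda>t. c * cos (ecc_anomaly e t) / (1 - e * cos (ecc_anomaly e t))) has_real_derivative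
     - (c * sin x) / \<rho> ^ 3) (at t)"
  proof (rule DERIV_cong[OF DERIV_divide[OF dc d\<rho>]])
    show "1 - e * cos (ecc_anomaly e t) \<noteq> 0" using rho by (simp add: \<rho>_def x_def)
    have "(- c * sin x / \<rho> * \<rho> - c * cos x * (e * sin x / \<rho>)) / (\<rho> * \<rho>) = - (c * sin x) * (\<rho> + e * cos x) / \<rho> ^ 3"
      using rho by (simp add: field_simps power2_eq_square eval_nat_numeral)
    also have "\<dots> = - (c * sin x) / \<rho> ^ 3" unfolding ec by simp
    finally show "(- c * sin x / \<rho> * (1 - e * cos (ecc_anomaly e t)) - c * cos (ecc_anomaly e t) * (e * sin x / \<rho>)) /
        ((1 - e * cos (ecc_anomaly e t)) * (1 - e * cos (ecc_anomaly e t))) = - (c * sin x) / \<rho> ^ 3"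
      by (simp add: \<rho>_def x_def)
  qed
  have "(ellipse_velocity e has_vector_derivative vector [- (cos x - e) / \<rho> ^ 3, - (c * sin x) / \<rho> ^ 3, 0]) (at t)"
    unfolding ellipse_velocity_def[abs_def] Let_def c_def[symmetric]
    by (intro has_vector_derivative_vector_3 1 2) simp
  moreover have "- kepler_field (kepler_ellipse e t) = vector [- (cos x - e) / \<rho> ^ 3, - (c * sin x) / \<rho> ^ 3, 0]"
    unfolding kepler_field_def norm_kepler_ellipse[OF e] x_def[symmetric]
    unfolding kepler_ellipse_eq[OF e] x_def[symmetric] c_def[symmetric]
      \<rho>_def[symmetric] vector_3_scaleR vector_3_uminus vector_3_inject by (simp add: minus_divide_left[symmetric] diff_divide_distrib)
  ultimately show ?thesis by simp
qed


text \<open>The linearized equation for the e-derivative is verified by calculation instead of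
  exchanging the derivatives in e and t. Eliminating S^2 = 1 - C^2 and \<rho> = 1 - e C reduces each
  numerator comparison to a polynomial identity.\<close>

lemma ellipse_deriv_e_deriv:
  assumes e: "\<bar>e\<bar> < 1"
  shows "(ellipse_deriv_e e has_vector_derivative ellipse_deriv_e_velocity e t) (at t)"
    and "(ellipse_deriv_e_velocity e has_vector_derivative
      - kepler_field_deriv (kepler_ellipse e t) (ellipse_deriv_e e t)) (at t)"
proof -
  define x where "x = ecc_anomaly e t"
  define c where "c = sqrt (1 - e\<^sup>2)"
  define \<rho> where "\<rho> = 1 - e * cos x"
  define S where "S = sin x"
  define C where "C = cos x"
  note c = ellipse_parameters[OF e, folded c_def]
  have rho: "0 < \<rho>" unfolding \<rho>_def by (rule one_minus_e_cos_pos[OF e])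
  have SS: "S * S = 1 - C * C" using sin_squared_eq[of x] by (simp add: S_def C_def power2_eq_square)
  have r: "\<rho> = 1 - e * C" by (simp add: \<rho>_def C_def)
  have dE: "(ecc_anomaly e has_real_derivative 1 / \<rho>) (at t)"
    unfolding \<rho>_def x_def by (rule ecc_anomaly_deriv_t[OF e])
  \<comment> \<open>The derivative rules work on the opaque functions \<open>si\<close>,
    \<open>co\<close>, \<open>rh\<close>; their values at t are inserted afterwards through
    \<open>v\<close>, so the side goals stay rational in S, C and \<rho>.\<close>
  define si where "si t = sin (ecc_anomaly e t)" for t
  define co where "co t = cos (ecc_anomaly e t)" for t
  define rh where "rh t = 1 - e * co t" for t
  have v: "si t = S" "co t = C" "rh t = \<rho>"
    by (simp_all add: si_def co_def rh_def S_def C_def \<rho>_def x_def)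
  have dsi: "(si has_real_derivative C / \<rho>) (at t)"
    and dco: "(co has_real_derivative - S / \<rho>) (at t)"
    unfolding si_def[abs_def] co_def[abs_def]
    by (auto intro!: derivative_eq_intros dE simp: S_def C_def x_def)
  then have drh: "(rh has_real_derivative e * S / \<rho>) (at t)"
    unfolding rh_def[abs_def] by (auto intro!: derivative_eq_intros)
  note d = derivative_eq_intros dsi dco drh
  have "((\<lambda>t. - (si t)\<^sup>2 / rh t - 1) has_real_derivative - 2 * S * C / \<rho>\<^sup>2 + e * S ^ 3 / \<rho> ^ 3) (at t)"
    by (rule d refl | use rho in \<open>simp add: v; fail\<close>)+
      (use rho in \<open>simp add: v field_simps eval_nat_numeral\<close>)
  moreover have "((\<lambda>t. c * si t * co t / rh t - e * si t / c) has_real_derivative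
      c * (C\<^sup>2 - S\<^sup>2) / \<rho>\<^sup>2 - c * e * S\<^sup>2 * C / \<rho> ^ 3 - e * C / (c * \<rho>)) (at t)"
    by (rule d refl | use rho c(1) in \<open>simp add: v; fail\<close>)+
      (use rho c(1) in \<open>simp add: v field_simps eval_nat_numeral\<close>)
  ultimately show "(ellipse_deriv_e e has_vector_derivative ellipse_deriv_e_velocity e t) (at t)"
    unfolding ellipse_deriv_e_def[abs_def] ellipse_deriv_e_velocity_def Let_def c_def[symmetric]
      x_def[symmetric] S_def[symmetric] C_def[symmetric] r[symmetric]
    unfolding si_def co_def rh_def
    by (intro has_vector_derivative_vector_3) simp_all
  have "((\<lambda>t. - 2 * si t * co t / (rh t)\<^sup>2 + e * (si t) ^ 3 / (rh t) ^ 3) has_real_derivative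
      (- 2 * (C * C - S * S) * \<rho>\<^sup>2 + 7 * e * C * (S * S) * \<rho> - 3 * e\<^sup>2 * (S * S)\<^sup>2) / \<rho> ^ 5) (at t)"
    by (rule d refl | use rho in \<open>simp add: v; fail\<close>)+
      (use rho in \<open>simp add: v field_simps eval_nat_numeral\<close>)
  also have "- 2 * (C * C - S * S) * \<rho>\<^sup>2 + 7 * e * C * (S * S) * \<rho> - 3 * e\<^sup>2 * (S * S)\<^sup>2
      = (S * S + \<rho>) * \<rho> - 3 * (C - e)\<^sup>2"
    unfolding SS r by (simp add: algebra_simps power2_eq_square)
  also have "((S * S + \<rho>) * \<rho> - 3 * (C - e)\<^sup>2) / \<rho> ^ 5 = (S\<^sup>2 / \<rho> + 1) / \<rho> ^ 3 + 3 * (e - C) / \<rho> ^ 5 * (C - e)"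
    using rho by (simp add: field_simps eval_nat_numeral)
  finally have 1: "((\<lambda>t. - 2 * si t * co t / (rh t)\<^sup>2 + e * (si t) ^ 3 / (rh t) ^ 3) has_real_derivative
      (S\<^sup>2 / \<rho> + 1) / \<rho> ^ 3 + 3 * (e - C) / \<rho> ^ 5 * (C - e)) (at t)" .
  have "((\<lambda>t. c * ((co t)\<^sup>2 - (si t)\<^sup>2) / (rh t)\<^sup>2 - c * e * (si t)\<^sup>2 * co t / (rh t) ^ 3 - e * co t / (c * rh t))
      has_real_derivative c * S * (- 4 * C * \<rho>\<^sup>2 - e * (4 * (C * C) - 3 * (S * S)) * \<rho> + 3 * e\<^sup>2 * (S * S) * C) / \<rho> ^ 5
        + e * S * (\<rho> + e * C) / (c * \<rho> ^ 3)) (at t)"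
    by (rule d refl | use rho c(1) in \<open>simp add: v; fail\<close>)+
      (use rho c(1) in \<open>simp add: v field_simps eval_nat_numeral\<close>)
  also have "- 4 * C * \<rho>\<^sup>2 - e * (4 * (C * C) - 3 * (S * S)) * \<rho> + 3 * e\<^sup>2 * (S * S) * C = - C * \<rho> + 3 * (e - C)"
    unfolding SS r by (simp add: algebra_simps power2_eq_square)
  also have "\<rho> + e * C = 1" by (simp add: r)
  also have "c * S * (- C * \<rho> + 3 * (e - C)) / \<rho> ^ 5 + e * S * 1 / (c * \<rho> ^ 3)
      = - (c * S * C / \<rho> - e * S / c) / \<rho> ^ 3 + 3 * (e - C) / \<rho> ^ 5 * (c * S)"
    using rho c(1) by (simp add: field_simps eval_nat_numeral)
  finally have 2: "((\<lambda>t. c * ((co t)\<^sup>2 - (si t)\<^sup>2) / (rh t)\<^sup>2 - c * e * (si t)\<^sup>2 * co t / (rh t) ^ 3 - e * co t / (c * rh t))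
      has_real_derivative - (c * S * C / \<rho> - e * S / c) / \<rho> ^ 3 + 3 * (e - C) / \<rho> ^ 5 * (c * S)) (at t)" .
  have u: "kepler_ellipse e t = vector [C - e, c * S, 0]"
    and ue: "ellipse_deriv_e e t = vector [- S\<^sup>2 / \<rho> - 1, c * S * C / \<rho> - e * S / c, 0]"
    by (simp_all add: kepler_ellipse_eq[OF e] ellipse_deriv_e_def Let_def x_def S_def C_def c_def \<rho>_def)
  \<comment> \<open>The value e - C is the e-derivative of |u|^2 / 2, that is, \<rho> times the
    e-derivative of \<rho>.\<close>
  have "kepler_ellipse e t \<bullet> ellipse_deriv_e e t
      = (- (C - e) * (S * S + \<rho>) + c * c * (S * S) * C - e * (S * S) * \<rho>) / \<rho>"
    unfolding u ue inner_vector_3 using rho c(1) by (simp add: field_simps power2_eq_square)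
  also have "- (C - e) * (S * S + \<rho>) + c * c * (S * S) * C - e * (S * S) * \<rho> = (e - C) * \<rho>"
    unfolding c(3) SS r by (simp add: algebra_simps)
  finally have ip: "kepler_ellipse e t \<bullet> ellipse_deriv_e e t = e - C" using rho by simp
  have "norm (kepler_ellipse e t) = \<rho>"
    unfolding norm_kepler_ellipse[OF e] \<rho>_def x_def ..
  then have "- kepler_field_deriv (kepler_ellipse e t) (ellipse_deriv_e e t)
      = vector [(S\<^sup>2 / \<rho> + 1) / \<rho> ^ 3 + 3 * (e - C) / \<rho> ^ 5 * (C - e),
          - (c * S * C / \<rho> - e * S / c) / \<rho> ^ 3 + 3 * (e - C) / \<rho> ^ 5 * (c * S), 0]"
    unfolding kepler_field_deriv_def ip unfolding u ue
    by (simp add: vector_3_scaleR vector_3_diff vector_3_uminus vector_3_inject add_divide_distrib diff_divide_distrib)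
  moreover have "(ellipse_deriv_e_velocity e has_vector_derivative
      vector [(S\<^sup>2 / \<rho> + 1) / \<rho> ^ 3 + 3 * (e - C) / \<rho> ^ 5 * (C - e),
          - (c * S * C / \<rho> - e * S / c) / \<rho> ^ 3 + 3 * (e - C) / \<rho> ^ 5 * (c * S), 0]) (at t)"
    using 1 2 unfolding ellipse_deriv_e_velocity_def[abs_def] Let_def c_def[symmetric]
    unfolding si_def co_def rh_def
    by (intro has_vector_derivative_vector_3) simp_all
  ultimately show "(ellipse_deriv_e_velocity e has_vector_derivative
      - kepler_field_deriv (kepler_ellipse e t) (ellipse_deriv_e e t)) (at t)" by simp
qed

section \<open>Rotated ellipses\<close>

lemma matrix_mul_scaleR_right:
  fixes A :: "real ^ 3 ^ 3"
  shows "A ** (k *\<^sub>R B) = k *\<^sub>R (A ** B)" "(k *\<^sub>R A) ** B = k *\<^sub>R (A ** B)"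
  by (simp_all add: matrix_matrix_mult_def vec_eq_iff sum_distrib_left mult_ac)

lemma matrix_mul_diff_right:
  fixes A :: "real ^ 3 ^ 3"
  shows "A ** (B - C) = A ** B - A ** C"
  by (simp add: matrix_matrix_mult_def vec_eq_iff right_diff_distrib sum_subtractf)

text \<open>Rodrigues' formula: J^3 = - J leaves only J and J^2 among the positive powers, and their
  coefficients are the sine and cosine series.\<close>

lemma matrix_exp_skew:
  fixes J :: "real ^ 3 ^ 3"
  assumes J: "J ** (J ** J) = - J"
  shows "matrix_exp (s *\<^sub>R J) = mat 1 + sin s *\<^sub>R J + (1 - cos s) *\<^sub>R (J ** J)"
proof -
  define Q where "Q n = (((**) (s *\<^sub>R J) ^^ n) (mat 1)) /\<^sub>R fact n" for n
  \<comment> \<open>For n = 0 the pattern would yield - J^2 in place of the identity; the extra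
    summand corrects exactly this term.\<close>
  have Q: "Q n = (sin_coeff n *\<^sub>R s ^ n) *\<^sub>R J - (cos_coeff n *\<^sub>R s ^ n) *\<^sub>R (J ** J)
      + (if n = 0 then mat 1 + J ** J else 0)" for n
  proof (induction n)
    case 0
    show ?case by (simp add: Q_def)
  next
    case (Suc n)
    have "Q (Suc n) = (s / real (Suc n)) *\<^sub>R (J ** Q n)"
      by (simp add: Q_def matrix_mul_scaleR_right divide_inverse mult_ac del: of_nat_Suc)
    also have "J ** Q n = (sin_coeff n *\<^sub>R s ^ n) *\<^sub>R (J ** J) + (cos_coeff n *\<^sub>R s ^ n) *\<^sub>R J"
      unfolding Suc.IH
      by (simp add: matrix_add_ldistrib matrix_mul_diff_right matrix_mul_scaleR_right J)
    finally show ?case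
      by (simp add: sin_coeff_Suc cos_coeff_Suc scaleR_add_right mult_ac del: of_nat_Suc)
  qed
  have "Q sums (sin s *\<^sub>R J - cos s *\<^sub>R (J ** J) + (mat 1 + J ** J))"
    unfolding Q[abs_def]
    by (intro sums_add sums_diff bounded_linear.sums[OF bounded_linear_scaleR_left] sin_converges
        cos_converges sums_single[of 0 "\<lambda>_. mat 1 + J ** J"])
  then show ?thesis
    unfolding matrix_exp_def Q_def[symmetric] by (simp add: sums_iff algebra_simps)
qed

lemma vector_3_mult:
  fixes x :: "real ^ 3"
  shows "J1 *v x = vector [0, - x $ 3, x $ 2]" "J2 *v x = vector [- x $ 3, 0, x $ 1]"
    "J3 *v x = vector [- x $ 2, x $ 1, 0]"
  by (simp_all add: J1_def J2_def J3_def matrix_vector_mult_def vec_eq_iff forall_3 sum_3)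

lemma J_cubed: "J1 ** (J1 ** J1) = - J1" "J2 ** (J2 ** J2) = - J2" "J3 ** (J3 ** J3) = - J3"
  by (simp_all add: J1_def J2_def J3_def matrix_matrix_mult_def vec_eq_iff forall_3 sum_3)

lemma matrix_exp_skew_mult:
  fixes J :: "real ^ 3 ^ 3"
  assumes "J ** (J ** J) = - J"
  shows "matrix_exp (s *\<^sub>R J) *v x = x + sin s *\<^sub>R (J *v x) + (1 - cos s) *\<^sub>R (J *v (J *v x))"
  unfolding matrix_exp_skew[OF assms]
  by (simp add: matrix_vector_mult_add_rdistrib scaleR_matrix_vector_assoc[symmetric] matrix_vector_mul_assoc)

lemma norm_matrix_exp_mult:
  fixes x :: "real ^ 3"
  assumes "J \<in> {J1, J2, J3}"
  shows "norm (matrix_exp (s *\<^sub>R J) *v x) = norm x"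
proof -
  have s: "(sin s)\<^sup>2 = 1 - (cos s)\<^sup>2" by (rule sin_squared_eq)
  have "(norm (matrix_exp (s *\<^sub>R J) *v x))\<^sup>2 = (norm x)\<^sup>2"
    using assms
    by (auto simp: matrix_exp_skew_mult J_cubed vector_3_mult power2_norm_eq_inner inner_vec_def sum_3
        power2_eq_square[symmetric] power2_sum power2_diff power_mult_distrib s algebra_simps)
  then show ?thesis by simp
qed

lemma rotation_mult:
  "rotation \<psi> *v x = matrix_exp ((\<psi> $ 1) *\<^sub>R J1) *v (matrix_exp ((\<psi> $ 2) *\<^sub>R J2) *v (matrix_exp ((\<psi> $ 3) *\<^sub>R J3) *v x))"
  by (simp add: rotation_def matrix_vector_mul_assoc matrix_mul_assoc)

lemma norm_rotation_mult: "norm (rotation \<psi> *v x) = norm x"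
  by (simp add: rotation_mult norm_matrix_exp_mult)

lemma rotation_0: "rotation 0 *v x = x"
  using matrix_exp_skew_mult[OF J_cubed(1), of 0] matrix_exp_skew_mult[OF J_cubed(2), of 0]
    matrix_exp_skew_mult[OF J_cubed(3), of 0]
  by (simp add: rotation_mult)

lemma kepler_field_rotation: "kepler_field (rotation \<psi> *v x) = rotation \<psi> *v kepler_field x"
  by (simp add: kepler_field_def norm_rotation_mult matrix_vector_mult_scaleR)

section \<open>Points of the manifold as critical points\<close>

lemma kepler_solution:
  assumes per: "\<And>t. u (t + 2*pi) = u t"
    and d1: "\<And>t. (u has_vector_derivative v t) (at t)"
    and d2: "\<And>t. (v has_vector_derivative - kepler_field (u t)) (at t)"
    and nz: "\<And>t. u t \<noteq> 0"
  shows "u \<in> kepler_domain" "velocity u = v" "AE t in lborel. weak_deriv2 u t = - kepler_field (u t)"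
proof -
  have "continuous_on UNIV u"
    using d1 has_vector_derivative_continuous by (blast intro: continuous_at_imp_continuous_on)
  then have "continuous_on UNIV (\<lambda>t. - kepler_field (u t))"
    by (intro continuous_intros continuous_on_kepler_field nz)
  from C2_periodic_H2[OF per d1 d2 this] nz
  show "u \<in> kepler_domain" "velocity u = v" "AE t in lborel. weak_deriv2 u t = - kepler_field (u t)"
    by (auto simp: kepler_domain_def)
qed

lemma kepler_ellipse_rotated:
  fixes e \<phi> :: real and \<psi> :: "real ^ 3"
  assumes e: "\<bar>e\<bar> < 1"
  defines "u \<equiv> \<lambda>t. rotation \<psi> *v kepler_ellipse e (t + \<phi>)"
  shows "u \<in> kepler_domain" "velocity u = (\<lambda>t. rotation \<psi> *v ellipse_velocity e (t + \<phi>))"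
    "AE t in lborel. weak_deriv2 u t = - kepler_field (u t)"
proof -
  have shift: "((\<lambda>t. rotation \<psi> *v f (t + \<phi>)) has_vector_derivative rotation \<psi> *v f') (at t)"
    if "(f has_vector_derivative f') (at (t + \<phi>))" for f f' t
  proof -
    have "((\<lambda>t. f (t + \<phi>)) has_vector_derivative 1 *\<^sub>R f') (at t)"
      by (rule vector_diff_chain_at[of "\<lambda>t. t + \<phi>" 1 t f, unfolded o_def])
        (auto intro!: derivative_eq_intros that)
    then show ?thesis
      using bounded_linear.has_vector_derivative[OF matrix_vector_mul_bounded_linear] by fastforce
  qed
  have "u (t + 2*pi) = u t" for t
    using kepler_ellipse_periodic[OF e, of "t + \<phi>"] by (simp add: u_def algebra_simps)
  moreover have "(u has_vector_derivative rotation \<psi> *v ellipse_velocity e (t + \<phi>)) (at t)" for t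
    unfolding u_def by (rule shift[OF kepler_ellipse_deriv_t[OF e]])
  moreover have "((\<lambda>t. rotation \<psi> *v ellipse_velocity e (t + \<phi>)) has_vector_derivative - kepler_field (u t)) (at t)" for t
    using shift[OF ellipse_velocity_deriv[OF e], of t]
    by (simp add: u_def kepler_field_rotation linear_neg)
  moreover have "u t \<noteq> 0" for t
    using kepler_ellipse_nonzero[OF e, of "t + \<phi>"] norm_rotation_mult[of \<psi> "kepler_ellipse e (t + \<phi>)"]
    by (auto simp: u_def)
  ultimately show "u \<in> kepler_domain" "velocity u = (\<lambda>t. rotation \<psi> *v ellipse_velocity e (t + \<phi>))"
    "AE t in lborel. weak_deriv2 u t = - kepler_field (u t)"
    by (rule kepler_solution)+
qed

lemma kepler_manifoldD:
  assumes "v \<in> kepler_manifold"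
  shows "v \<in> kepler_domain" "AE t in lborel. weak_deriv2 v t = - kepler_field (v t)"
proof -
  obtain e \<psi> \<phi> where v: "v = (\<lambda>t. rotation \<psi> *v kepler_ellipse e (t + \<phi>))" and "0 \<le> e" "e < 1"
    using assms by (auto simp: kepler_manifold_def)
  then have "\<bar>e\<bar> < 1" by simp
  from kepler_ellipse_rotated[OF this, of \<psi> \<phi>]
  show "v \<in> kepler_domain" "AE t in lborel. weak_deriv2 v t = - kepler_field (v t)"
    unfolding v by auto
qed

lemma kepler_manifoldI:
  "\<lbrakk>0 \<le> e; e < 1\<rbrakk> \<Longrightarrow> (\<lambda>t. rotation \<psi> *v kepler_ellipse e (t + \<phi>)) \<in> kepler_manifold"
  by (auto simp: kepler_manifold_def)

lemma kepler_ellipse_in_manifold: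
  assumes "0 \<le> e" "e < 1"
  shows "kepler_ellipse e \<in> kepler_manifold"
  using kepler_manifoldI[OF assms, of 0 0] by (simp add: rotation_0)

lemma L2_inner_AE_zero:
  assumes "AE t in lborel. g t = 0"
  shows "L2_inner g h = 0"
proof -
  have "AE t in lborel. indicator {0..2*pi} t *\<^sub>R (g t \<bullet> h t) = 0"
    using assms by eventually_elim simp
  then show ?thesis
    unfolding L2_inner_def set_lebesgue_integral_def by (rule integral_eq_zero_AE)
qed

text \<open>\<open>kepler_gradient\<close> vanishes on the manifold only up to a null set. As a
  gradient acts solely through \<open>L2_inner\<close>, the zero curve can take its place.\<close>

lemma has_L2_gradient_manifold:
  assumes "v \<in> kepler_manifold"
  shows "has_L2_gradient kepler_action kepler_domain v 0"
proof -
  note v = kepler_manifoldD[OF assms]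
  have "AE t in lborel. kepler_gradient v t = 0"
    using v(2) by eventually_elim (simp add: kepler_gradient_def)
  then have "L2_inner (kepler_gradient v) h = 0" for h
    by (rule L2_inner_AE_zero)
  moreover have "L2_inner 0 h = 0" for h by (simp add: L2_inner_def)
  moreover have "L2_on 0 (2*pi) 0"
    using L2_on_continuous[of 0 "2*pi" "\<lambda>_. 0"] by (simp add: zero_fun_def)
  ultimately show ?thesis
    using has_L2_gradient_kepler[OF v(1)] by (simp add: has_L2_gradient_def)
qed

text \<open>The velocity is bounded by integrating by parts: the integral of |p'|^2 is at most 2 pi
  A B \<le> (3 (A + B))^2. The three parts of the norm are then at most 3 A, 3 B and 3 (A +
  B).\<close>

lemma H2_norm_le_sup:
  assumes p: "p \<in> H2_periodic" and "0 \<le> A" "0 \<le> B"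
    and A: "\<And>t. t \<in> {0..2*pi} \<Longrightarrow> norm (p t) \<le> A"
    and B: "AE t in lborel. t \<in> {0..2*pi} \<longrightarrow> norm (weak_deriv2 p t) \<le> B"
  shows "H2_norm p \<le> 6 * (A + B)"
proof -
  let ?w = "weak_deriv2 p"
  have 1: "L2_norm p \<le> 3 * A" by (rule L2_norm_le_sup) (use assms in auto)
  have 2: "L2_norm ?w \<le> 3 * B" by (rule L2_norm_le_sup) (use assms in auto)
  note ibp = weak_integration_by_parts[OF weak_deriv2(2)[OF p] has_vector_derivative_velocity[OF p]
      H2_velocity_continuous[OF p], of 0 "2*pi"]
  have "(L2_norm (velocity p))\<^sup>2 = - (LBINT t:{0..2*pi}. ?w t \<bullet> p t)"
    using ibp(2) H2_periodicD[OF p, of 0] H2_velocity_periodicD[OF p, of 0]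
    by (simp add: L2_norm_squared power2_norm_eq_inner)
  also have "\<dots> \<le> \<bar>LBINT t:{0..2*pi}. ?w t \<bullet> p t\<bar>" by simp
  also have "\<dots> \<le> (LBINT t:{0..2*pi}. \<bar>?w t \<bullet> p t\<bar>)"
    using set_integral_norm_bound[OF ibp(1)] by simp
  also have "\<dots> \<le> (LBINT t:{0..2*pi}. B * A)"
  proof (rule set_integral_mono_AE)
    show "set_integrable lborel {0..2*pi} (\<lambda>t. \<bar>?w t \<bullet> p t\<bar>)"
      by (rule set_integrable_abs) (use ibp(1) in simp)
    show "set_integrable lborel {0..2*pi} (\<lambda>t. B * A)"
      by (intro borel_integrable_atLeastAtMost' continuous_intros)
    show "AE t\<in>{0..2*pi} in lborel. \<bar>?w t \<bullet> p t\<bar> \<le> B * A"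
      using B
    proof eventually_elim
      case (elim t)
      show ?case
      proof
        assume t: "t \<in> {0..2*pi}"
        have "\<bar>?w t \<bullet> p t\<bar> \<le> norm (?w t) * norm (p t)" by (rule Cauchy_Schwarz_ineq2)
        also have "\<dots> \<le> B * A" using elim t A[OF t] \<open>0 \<le> B\<close> by (intro mult_mono) auto
        finally show "\<bar>?w t \<bullet> p t\<bar> \<le> B * A" .
      qed
    qed
  qed
  also have "\<dots> = 2 * pi * (A * B)" by (simp add: set_lebesgue_integral_def)
  also have "\<dots> \<le> 8 * (A * B)" using pi_less_4 assms(2,3) by (intro mult_right_mono) auto
  also have "\<dots> \<le> (3 * (A + B))\<^sup>2"
    using assms(2,3) by (simp add: power2_eq_square algebra_simps)
  finally have 3: "L2_norm (velocity p) \<le> 3 * (A + B)"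
    by (rule power2_le_imp_le) (use assms in simp)
  show ?thesis using H2_norm_le_sum[of p] 1 2 3 by simp
qed

text \<open>A product rule at s = 0, uniform in t, by which one rotation at a time is composed with
  a family of curves. By Rodrigues' formula it reduces to the limits of sin (s k) / s and (1 - cos
  (s k)) / s; bounded limits make products converge uniformly.\<close>

lemma uniform_limit_rotate:
  fixes J :: "real ^ 3 ^ 3" and y :: "real \<Rightarrow> real \<Rightarrow> real ^ 3"
  assumes J: "J ** (J ** J) = - J"
    and lim: "uniform_limit X (\<lambda>s t. (y s t - y 0 t) /\<^sub>R s) \<eta> (at 0)"
    and bdd: "bounded (y 0 ` X)" "bounded (\<eta> ` X)"
  shows "uniform_limit X (\<lambda>s t. (matrix_exp ((s * k) *\<^sub>R J) *v y s t - y 0 t) /\<^sub>R s)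
    (\<lambda>t. \<eta> t + k *\<^sub>R (J *v y 0 t)) (at 0)"
proof -
  have blJ: "bounded_linear ((*v) J)" by (rule matrix_vector_mul_bounded_linear)
  have const: "uniform_limit X (\<lambda>s (t :: real). f s) (\<lambda>_. l) (at 0)" if "(f \<longlongrightarrow> l) (at (0::real))"
    for f and l :: real
    using that by (auto simp: uniform_limit_iff tendsto_iff)
  have b0: "bounded ((\<lambda>_. c) ` X)" for c :: real
    by (rule bounded_subset[of "{c}"]) auto
  \<comment> \<open>Converging difference quotients force y s to tend to y 0. The rewriting also
    holds at s = 0, where the quotient is multiplied by 0.\<close>
  have y: "uniform_limit X y (y 0) (at 0)"
  proof -
    have "uniform_limit X (\<lambda>s t. s *\<^sub>R ((y s t - y 0 t) /\<^sub>R s) + y 0 t) (\<lambda>t. 0 *\<^sub>R \<eta> t + y 0 t) (at 0)"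
      using bdd
      by (intro uniform_limit_add uniform_limit_const bounded_bilinear.bounded_uniform_limit[OF bounded_bilinear_scaleR]
         const lim tendsto_ident_at b0)
    moreover have "s *\<^sub>R ((y s t - y 0 t) /\<^sub>R s) + y 0 t = y s t" for s t
      by (cases "s = 0") auto
    ultimately show ?thesis by (simp only: scaleR_zero_left add_0_left)
  qed
  have bJ: "bounded ((\<lambda>t. J *v f t) ` X)" if "bounded (f ` X)" for f
    using bounded_linear_image[OF that blJ] by (simp add: image_image)
  have l1: "((\<lambda>s. sin (s * k) / s) \<longlongrightarrow> k) (at 0)"
  proof -
    have "((\<lambda>s. sin (s * k)) has_real_derivative k) (at 0)" by (auto intro!: derivative_eq_intros)
    then show ?thesis by (simp add: has_field_derivative_iff)
  qed
  have l2: "((\<lambda>s. (1 - cos (s * k)) / s) \<longlongrightarrow> 0) (at 0)"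
  proof -
    have "((\<lambda>s. 1 - cos (s * k)) has_real_derivative 0) (at 0)" by (auto intro!: derivative_eq_intros)
    then show ?thesis by (simp add: has_field_derivative_iff)
  qed
  have "uniform_limit X (\<lambda>s t. (y s t - y 0 t) /\<^sub>R s + ((sin (s * k) / s) *\<^sub>R (J *v y s t)
        + ((1 - cos (s * k)) / s) *\<^sub>R (J *v (J *v y s t))))
      (\<lambda>t. \<eta> t + (k *\<^sub>R (J *v y 0 t) + 0 *\<^sub>R (J *v (J *v y 0 t)))) (at 0)"
    using bdd
    by (intro uniform_limit_add lim bounded_bilinear.bounded_uniform_limit[OF bounded_bilinear_scaleR]
        const l1 l2 bounded_linear.uniform_limit[OF blJ] y bJ b0)
  then have "uniform_limit X (\<lambda>s t. (y s t - y 0 t) /\<^sub>R s + ((sin (s * k) / s) *\<^sub>R (J *v y s t)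
        + ((1 - cos (s * k)) / s) *\<^sub>R (J *v (J *v y s t))))
      (\<lambda>t. \<eta> t + k *\<^sub>R (J *v y 0 t)) (at 0)" by simp
  then show ?thesis
    by (rule uniform_limit_cong'[THEN iffD1, rotated -1])
      (auto simp: matrix_exp_skew_mult[OF J] divide_inverse algebra_simps)
qed

section \<open>The kernel of the Hessian\<close>

lemma
  shows kepler_field_deriv_diff: "kepler_field_deriv x (h - k) = kepler_field_deriv x h - kepler_field_deriv x k"
    and kepler_field_deriv_scaleR: "kepler_field_deriv x (a *\<^sub>R h) = a *\<^sub>R kepler_field_deriv x h"
  using linear_kepler_field_deriv[of x 1 h "-1" k]
    linear_kepler_field_deriv[of x a h 0 k] by simp_all

lemma operator_kernelI:
  assumes u: "u \<in> kepler_domain"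
    and per: "\<And>t. y (t + 2*pi) = y t"
    and d1: "\<And>t. (y has_vector_derivative y' t) (at t)"
    and d2: "\<And>t. (y' has_vector_derivative - kepler_field_deriv (u t) (y t)) (at t)"
  shows "y \<in> operator_kernel (kepler_hessian u)"
proof -
  have "continuous_on UNIV y"
    using d1 has_vector_derivative_continuous by (blast intro: continuous_at_imp_continuous_on)
  then have "continuous_on UNIV (\<lambda>t. - kepler_field_deriv (u t) (y t))"
    by (intro continuous_intros continuous_on_kepler_field_deriv H2_continuous[OF kepler_domainD(1)[OF u]] kepler_domainD(2)[OF u])
  from C2_periodic_H2[OF per d1 d2 this] show ?thesis
    by (auto simp: operator_kernel_def kepler_hessian_eq elim!: eventually_mono)
qed

lemma subspace_operator_kernel:
  assumes u: "u \<in> kepler_domain"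
  shows "subspace (operator_kernel (kepler_hessian u))"
proof -
  have lin: "(\<lambda>t. p *\<^sub>R y t + q *\<^sub>R z t) \<in> operator_kernel (kepler_hessian u)"
    if y: "y \<in> operator_kernel (kepler_hessian u)" and z: "z \<in> operator_kernel (kepler_hessian u)" for p q y z
  proof -
    have yz: "y \<in> H2_periodic" "z \<in> H2_periodic"
      and ae: "AE t in lborel. t \<in> {0..2*pi} \<longrightarrow> kepler_hessian u y t = 0"
        "AE t in lborel. t \<in> {0..2*pi} \<longrightarrow> kepler_hessian u z t = 0"
      using y z by (auto simp: operator_kernel_def)
    have "AE t in lborel. t \<in> {0..2*pi} \<longrightarrow> kepler_hessian u (\<lambda>t. p *\<^sub>R y t + q *\<^sub>R z t) t = 0"
      using ae H2_lincomb(3)[OF yz, of p q]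
    proof eventually_elim
      case (elim t)
      show ?case
      proof
        assume "t \<in> {0..2*pi}"
        then have "kepler_hessian u y t = 0" "kepler_hessian u z t = 0" using elim by auto
        moreover have "kepler_hessian u (\<lambda>t. p *\<^sub>R y t + q *\<^sub>R z t) t
            = p *\<^sub>R kepler_hessian u y t + q *\<^sub>R kepler_hessian u z t"
          using elim by (simp add: kepler_hessian_eq linear_kepler_field_deriv algebra_simps)
        ultimately show "kepler_hessian u (\<lambda>t. p *\<^sub>R y t + q *\<^sub>R z t) t = 0" by simp
      qed
    qed
    then show ?thesis using H2_lincomb(1)[OF yz] by (simp add: operator_kernel_def)
  qed
  show ?thesis
  proof (rule subspaceI)
    show "0 \<in> operator_kernel (kepler_hessian u)"
      by (rule operator_kernelI[OF u, of _ "\<lambda>_. 0"]) (auto simp: zero_fun_def kepler_field_deriv_def)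
    show "y + z \<in> operator_kernel (kepler_hessian u)"
      if "y \<in> operator_kernel (kepler_hessian u)" "z \<in> operator_kernel (kepler_hessian u)" for y z
      using lin[OF that, of 1 1] by (simp add: plus_fun_def)
    show "c *\<^sub>R y \<in> operator_kernel (kepler_hessian u)"
      if "y \<in> operator_kernel (kepler_hessian u)" for c y
      using lin[OF that that, of c 0] by (simp add: scaleR_fun_def)
  qed
qed

section \<open>Five explicit kernel elements\<close>

lemma kepler_field_chain:
  assumes "(u has_vector_derivative v) (at t)" "u t \<noteq> 0"
  shows "((\<lambda>t. kepler_field (u t)) has_vector_derivative kepler_field_deriv (u t) v) (at t)"
  using has_derivative_compose[OF assms(1)[unfolded has_vector_derivative_def] has_derivative_kepler_field[OF assms(2)]]
  by (simp add: has_vector_derivative_def kepler_field_deriv_scaleR)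

text \<open>Infinitesimal rotations are tangent to spheres, so the radial term of
  \<open>kepler_field_deriv\<close> drops out below; this is rotation invariance of the force to
  first order.\<close>

lemma skew_orthogonal: "J \<in> {J1, J2, J3} \<Longrightarrow> x \<bullet> (J *v x) = 0"
  by (auto simp: vector_3_mult inner_vec_def sum_3)

lemma kepler_field_deriv_skew:
  assumes "J \<in> {J1, J2, J3}"
  shows "kepler_field_deriv x (J *v x) = J *v kepler_field x"
  by (simp add: kepler_field_deriv_def kepler_field_def skew_orthogonal[OF assms] matrix_vector_mult_scaleR)

lemma has_vector_derivative_matrix_mult:
  fixes A :: "real ^ 3 ^ 3"
  assumes "(f has_vector_derivative f') F"
  shows "((\<lambda>t. A *v f t) has_vector_derivative A *v f') F"
  using bounded_linear.has_vector_derivative[OF matrix_vector_mul_bounded_linear assms] .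

lemma kepler_ellipse_domain:
  assumes e: "\<bar>e\<bar> < 1"
  shows "kepler_ellipse e \<in> kepler_domain" "velocity (kepler_ellipse e) = ellipse_velocity e"
    "AE t in lborel. weak_deriv2 (kepler_ellipse e) t = - kepler_field (kepler_ellipse e t)"
  using kepler_solution[OF kepler_ellipse_periodic[OF e] kepler_ellipse_deriv_t[OF e]
      ellipse_velocity_deriv[OF e] kepler_ellipse_nonzero[OF e]] .

lemma ellipse_velocity_deriv2:
  assumes e: "\<bar>e\<bar> < 1"
  shows "((\<lambda>t. - kepler_field (kepler_ellipse e t)) has_vector_derivative
    - kepler_field_deriv (kepler_ellipse e t) (ellipse_velocity e t)) (at t)"
  by (intro has_vector_derivative_minus kepler_field_chain kepler_ellipse_deriv_t[OF e] kepler_ellipse_nonzero[OF e])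

lemma skew_ellipse_deriv:
  assumes e: "\<bar>e\<bar> < 1" and J: "J \<in> {J1, J2, J3}"
  shows "((\<lambda>t. J *v kepler_ellipse e t) has_vector_derivative J *v ellipse_velocity e t) (at t)"
    and "((\<lambda>t. J *v ellipse_velocity e t) has_vector_derivative
      - kepler_field_deriv (kepler_ellipse e t) (J *v kepler_ellipse e t)) (at t)"
proof -
  show "((\<lambda>t. J *v kepler_ellipse e t) has_vector_derivative J *v ellipse_velocity e t) (at t)"
    by (intro has_vector_derivative_matrix_mult kepler_ellipse_deriv_t[OF e])
  show "((\<lambda>t. J *v ellipse_velocity e t) has_vector_derivative
      - kepler_field_deriv (kepler_ellipse e t) (J *v kepler_ellipse e t)) (at t)"
    using has_vector_derivative_matrix_mult[OF ellipse_velocity_deriv[OF e], of J]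
    by (simp add: kepler_field_deriv_skew[OF J] linear_neg)
qed

lemma ellipse_periodic:
  assumes e: "\<bar>e\<bar> < 1"
  shows "ellipse_velocity e (t + 2*pi) = ellipse_velocity e t"
    "ellipse_deriv_e e (t + 2*pi) = ellipse_deriv_e e t"
    "ellipse_deriv_e_velocity e (t + 2*pi) = ellipse_deriv_e_velocity e t"
  by (simp_all add: ellipse_velocity_def ellipse_deriv_e_def ellipse_deriv_e_velocity_def ecc_anomaly_periodic[OF e] Let_def)

abbreviation kernel_basis :: "real \<Rightarrow> curve set" where
  "kernel_basis e \<equiv> {ellipse_velocity e, ellipse_deriv_e e, (\<lambda>t. J1 *v kepler_ellipse e t),
     (\<lambda>t. J2 *v kepler_ellipse e t), (\<lambda>t. J3 *v kepler_ellipse e t)}"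

lemma kernel_basis_subset:
  assumes e: "\<bar>e\<bar> < 1"
  shows "kernel_basis e \<subseteq> operator_kernel (kepler_hessian (kepler_ellipse e))"
proof -
  note K = operator_kernelI[OF kepler_ellipse_domain(1)[OF e]]
  have "(\<lambda>t. J *v kepler_ellipse e t) \<in> operator_kernel (kepler_hessian (kepler_ellipse e))"
    if "J \<in> {J1, J2, J3}" for J
    by (rule K[OF _ skew_ellipse_deriv[OF e that]]) (simp add: kepler_ellipse_periodic[OF e])
  moreover have "ellipse_velocity e \<in> operator_kernel (kepler_hessian (kepler_ellipse e))"
    by (rule K[OF ellipse_periodic(1)[OF e] ellipse_velocity_deriv[OF e] ellipse_velocity_deriv2[OF e]])
  moreover have "ellipse_deriv_e e \<in> operator_kernel (kepler_hessian (kepler_ellipse e))"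
    by (rule K[OF ellipse_periodic(2)[OF e] ellipse_deriv_e_deriv[OF e]])
  ultimately show ?thesis by auto
qed

text \<open>The two instants at which the ellipse is explicit: the pericentre, and the end of the
  minor axis, where x = pi / 2 gives t = pi / 2 - e.\<close>

lemma ecc_anomaly_values:
  assumes e: "\<bar>e\<bar> < 1"
  shows "ecc_anomaly e 0 = 0" "ecc_anomaly e (pi / 2 - e) = pi / 2"
  by (rule ecc_anomaly_eqI[OF e]; simp)+

lemma ellipse_values_0:
  assumes e: "\<bar>e\<bar> < 1"
  defines "c \<equiv> sqrt (1 - e\<^sup>2)"
  shows "kepler_ellipse e 0 = vector [1 - e, 0, 0]" "ellipse_velocity e 0 = vector [0, c / (1 - e), 0]"
    "- kepler_field (kepler_ellipse e 0) = vector [- 1 / (1 - e)\<^sup>2, 0, 0]"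
    "ellipse_deriv_e e 0 = vector [- 1, 0, 0]"
    "ellipse_deriv_e_velocity e 0 = vector [0, 1 / (c * (1 - e)), 0]"
proof -
  note c = ellipse_parameters[OF e, folded c_def]
  have rho: "0 < 1 - e" using e by simp
  show u: "kepler_ellipse e 0 = vector [1 - e, 0, 0]" and "ellipse_velocity e 0 = vector [0, c / (1 - e), 0]"
    "ellipse_deriv_e e 0 = vector [- 1, 0, 0]"
    by (simp_all add: kepler_ellipse_eq[OF e] ellipse_velocity_def ellipse_deriv_e_def ecc_anomaly_values[OF e] c_def)
  have "norm (kepler_ellipse e 0) = 1 - e"
    by (simp add: norm_kepler_ellipse[OF e] ecc_anomaly_values[OF e])
  then have "kepler_field (kepler_ellipse e 0) = vector [1 / (1 - e) ^ 3 * (1 - e), 0, 0]"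
    by (simp add: kepler_field_def) (simp add: u vector_3_scaleR)
  also have "1 / (1 - e) ^ 3 * (1 - e) = 1 / (1 - e)\<^sup>2"
    using rho by (simp add: eval_nat_numeral)
  finally show "- kepler_field (kepler_ellipse e 0) = vector [- 1 / (1 - e)\<^sup>2, 0, 0]"
    by (simp add: vector_3_uminus)
  have f: "c / r\<^sup>2 - e / (c * r) = (c * c - e * r) / (c * r\<^sup>2)" "r / (c * r\<^sup>2) = 1 / (c * r)"
    if "0 < r" for r
    using c(1) that by (simp_all add: field_simps power2_eq_square)
  have "c / (1 - e)\<^sup>2 - e / (c * (1 - e)) = (c * c - e * (1 - e)) / (c * (1 - e)\<^sup>2)"
    by (rule f(1)[OF rho])
  also have "c * c - e * (1 - e) = 1 - e" unfolding c(3) by (simp add: algebra_simps)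
  also have "(1 - e) / (c * (1 - e)\<^sup>2) = 1 / (c * (1 - e))" by (rule f(2)[OF rho])
  finally show "ellipse_deriv_e_velocity e 0 = vector [0, 1 / (c * (1 - e)), 0]"
    by (simp add: ellipse_deriv_e_velocity_def ecc_anomaly_values[OF e] c_def[symmetric] Let_def)
qed

text \<open>The pericentre isolates b in the first component and c2 in the third; the end of the
  minor axis separates the remaining coefficients.\<close>

lemma kernel_basis_lincomb_zero:
  assumes e: "0 < e" "e < 1"
    and zero: "\<And>t. a *\<^sub>R ellipse_velocity e t + b *\<^sub>R ellipse_deriv_e e t + c1 *\<^sub>R (J1 *v kepler_ellipse e t)
      + c2 *\<^sub>R (J2 *v kepler_ellipse e t) + c3 *\<^sub>R (J3 *v kepler_ellipse e t) = 0"
  shows "a = 0 \<and> b = 0 \<and> c1 = 0 \<and> c2 = 0 \<and> c3 = 0"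
proof -
  have e': "\<bar>e\<bar> < 1" using e by simp
  note c = ellipse_parameters[OF e']
  have "b = 0" "c2 = 0"
    using zero[of 0] e
    by (simp_all add: ellipse_values_0[OF e'] vector_3_mult vec_eq_iff forall_3)
  \<comment> \<open>Here the second component of the relation is - e * c3, so e \<noteq> 0 is
    essential; the third gives c1 and the first gives a.\<close>
  moreover have "c3 = 0 \<and> c1 = 0 \<and> - a = c3 * sqrt (1 - e\<^sup>2)"
    using zero[of "pi / 2 - e"] e c(1) \<open>b = 0\<close> \<open>c2 = 0\<close>
    by (auto simp: kepler_ellipse_eq[OF e'] ellipse_velocity_def ellipse_deriv_e_def
      ecc_anomaly_values[OF e'] vector_3_mult vec_eq_iff forall_3)
  ultimately show ?thesis by auto
qed

section \<open>Span and independence of the five fields\<close>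

lemma span_insert_fun:
  fixes f :: "'a \<Rightarrow> 'b::real_vector"
  shows "g \<in> span (insert f S) \<longleftrightarrow> (\<exists>k. (\<lambda>t. g t - k *\<^sub>R f t) \<in> span S)"
  by (simp add: span_insert fun_diff_def scaleR_fun_def)

lemma span_empty_fun: "g \<in> span {} \<longleftrightarrow> (\<forall>t. g t = 0)"
  by (simp add: fun_eq_iff)

lemma span_kernel_basis:
  "\<eta> \<in> span (kernel_basis e) \<longleftrightarrow> (\<exists>a b c1 c2 c3. \<forall>t. \<eta> t = a *\<^sub>R ellipse_velocity e t + b *\<^sub>R ellipse_deriv_e e t
    + c1 *\<^sub>R (J1 *v kepler_ellipse e t) + c2 *\<^sub>R (J2 *v kepler_ellipse e t) + c3 *\<^sub>R (J3 *v kepler_ellipse e t))"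
  unfolding span_insert_fun span_empty_fun by (simp add: algebra_simps)

lemma independent_kernel_basis:
  assumes e: "0 < e" "e < 1"
  shows "independent (kernel_basis e)" "card (kernel_basis e) = 5"
proof -
  note nz = kernel_basis_lincomb_zero[OF e]
  let ?f1 = "ellipse_velocity e" and ?f2 = "ellipse_deriv_e e" and ?f3 = "\<lambda>t. J1 *v kepler_ellipse e t"
    and ?f4 = "\<lambda>t. J2 *v kepler_ellipse e t" and ?f5 = "\<lambda>t. J3 *v kepler_ellipse e t"
  have s: "?f1 \<notin> span {?f2, ?f3, ?f4, ?f5}" "?f2 \<notin> span {?f3, ?f4, ?f5}" "?f3 \<notin> span {?f4, ?f5}"
    "?f4 \<notin> span {?f5}" "?f5 \<notin> span {}"
  proof -
    have "\<exists>t. ?f1 t - k2 *\<^sub>R ?f2 t - k3 *\<^sub>R ?f3 t - k4 *\<^sub>R ?f4 t - k5 *\<^sub>R ?f5 t \<noteq> 0" for k2 k3 k4 k5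
      using nz[of 1 "- k2" "- k3" "- k4" "- k5"] by fastforce
    moreover have "\<exists>t. ?f2 t - k3 *\<^sub>R ?f3 t - k4 *\<^sub>R ?f4 t - k5 *\<^sub>R ?f5 t \<noteq> 0" for k3 k4 k5
      using nz[of 0 1 "- k3" "- k4" "- k5"] by fastforce
    moreover have "\<exists>t. ?f3 t - k4 *\<^sub>R ?f4 t - k5 *\<^sub>R ?f5 t \<noteq> 0" for k4 k5
      using nz[of 0 0 1 "- k4" "- k5"] by fastforce
    moreover have "\<exists>t. ?f4 t - k5 *\<^sub>R ?f5 t \<noteq> 0" for k5
      using nz[of 0 0 0 1 "- k5"] by fastforce
    moreover have "\<exists>t. ?f5 t \<noteq> 0"
      using nz[of 0 0 0 0 1] by fastforce
    ultimately show "?f1 \<notin> span {?f2, ?f3, ?f4, ?f5}" "?f2 \<notin> span {?f3, ?f4, ?f5}"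
      "?f3 \<notin> span {?f4, ?f5}" "?f4 \<notin> span {?f5}" "?f5 \<notin> span {}"
      unfolding span_insert_fun span_empty_fun by blast+
  qed
  \<comment> \<open>A set lies in its span, so the same facts make the five fields distinct, as the
    cardinality requires.\<close>
  have n: "?f1 \<notin> {?f2, ?f3, ?f4, ?f5}" "?f2 \<notin> {?f3, ?f4, ?f5}" "?f3 \<notin> {?f4, ?f5}" "?f4 \<notin> {?f5}"
    using s[THEN contra_subsetD[OF span_superset]] by blast+
  show "independent (kernel_basis e)"
    using n s by (simp only: independent_insert independent_empty empty_iff if_False simp_thms)
  show "card (kernel_basis e) = 5"
    using n by simp
qed

text \<open>The domain is one closed period because \<open>operator_kernel\<close> imposes the
  equation only there. Carrying y' as a separate argument turns the equation into a first-order
  system.\<close>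

definition linearized_solution :: "curve \<Rightarrow> curve \<Rightarrow> curve \<Rightarrow> bool" where
  "linearized_solution u y y' \<longleftrightarrow> (\<forall>t\<in>{0..2*pi}.
     (y has_vector_derivative y' t) (at t within {0..2*pi}) \<and>
     (y' has_vector_derivative - kepler_field_deriv (u t) (y t)) (at t within {0..2*pi}))"

lemma linearized_solutionI:
  assumes "\<And>t. (y has_vector_derivative y' t) (at t)"
    "\<And>t. (y' has_vector_derivative - kepler_field_deriv (u t) (y t)) (at t)"
  shows "linearized_solution u y y'"
  using assms by (auto simp: linearized_solution_def intro: has_vector_derivative_at_within)

lemma linearized_solution_diff:
  assumes "linearized_solution u y y'" "linearized_solution u z z'"
  shows "linearized_solution u (\<lambda>t. y t - k *\<^sub>R z t) (\<lambda>t. y' t - k *\<^sub>R z' t)"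
  unfolding linearized_solution_def
proof (intro ballI conjI)
  fix t :: real assume t: "t \<in> {0..2*pi}"
  note yz = assms[unfolded linearized_solution_def, rule_format, OF t]
  have s: "((\<lambda>t. k *\<^sub>R f t) has_vector_derivative k *\<^sub>R f') F"
    if "(f has_vector_derivative f') F" for f f' and F :: "real filter"
    using bounded_linear.has_vector_derivative[OF bounded_linear_scaleR_right that] .
  show "((\<lambda>t. y t - k *\<^sub>R z t) has_vector_derivative y' t - k *\<^sub>R z' t) (at t within {0..2*pi})"
    using yz by (intro has_vector_derivative_diff s) auto
  have "((\<lambda>t. y' t - k *\<^sub>R z' t) has_vector_derivative
      - kepler_field_deriv (u t) (y t) - k *\<^sub>R - kepler_field_deriv (u t) (z t)) (at t within {0..2*pi})"
    using yz by (intro has_vector_derivative_diff s) auto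
  then show "((\<lambda>t. y' t - k *\<^sub>R z' t) has_vector_derivative
      - kepler_field_deriv (u t) (y t - k *\<^sub>R z t)) (at t within {0..2*pi})"
    by (simp add: kepler_field_deriv_diff kepler_field_deriv_scaleR)
qed

text \<open>Gronwall for |y|^2 + |y'|^2, whose derivative is at most 2 (1 + B) |y| |y'|.\<close>

lemma linearized_solution_unique:
  assumes u: "u \<in> kepler_domain" and sol: "linearized_solution u y y'"
    and init: "y 0 = 0" "y' 0 = 0" and t: "t \<in> {0..2*pi}"
  shows "y t = 0" "y' t = 0"
proof -
  obtain B where "0 < B" and B: "\<And>t h. t \<in> {0..2*pi} \<Longrightarrow> norm (kepler_field_deriv (u t) h) \<le> B * norm h"
    using kepler_field_deriv_bound[OF u] by blast
  define g where "g t = y t \<bullet> y t + y' t \<bullet> y' t" for t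
  define g' where "g' t = 2 * (y t \<bullet> y' t) - 2 * (y' t \<bullet> kepler_field_deriv (u t) (y t))" for t
  have "g t \<le> 0"
  proof (rule gronwall_zero[of 0 "2*pi" g g' "1 + B"])
    fix s :: real assume s: "s \<in> {0..2*pi}"
    note ys = sol[unfolded linearized_solution_def, rule_format, OF s]
    have ip: "((\<lambda>t. f t \<bullet> f t) has_real_derivative 2 * (f s \<bullet> f')) (at s within S)"
      if "(f has_vector_derivative f') (at s within S)" for f f' S
      using has_derivative_inner[OF that[unfolded has_vector_derivative_def] that[unfolded has_vector_derivative_def]]
      by (auto simp: has_field_derivative_def inner_commute algebra_simps elim!: has_derivative_eq_rhs)
    have "(g has_real_derivative 2 * (y s \<bullet> y' s) + 2 * (y' s \<bullet> - kepler_field_deriv (u s) (y s))) (at s within {0..2*pi})"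
      unfolding g_def[abs_def] using ys by (intro DERIV_add ip) auto
    then show "(g has_real_derivative g' s) (at s within {0..2*pi})" by (simp add: g'_def)
    have "y s \<bullet> y' s \<le> norm (y s) * norm (y' s)" by (rule norm_cauchy_schwarz)
    moreover have "- (y' s \<bullet> kepler_field_deriv (u s) (y s)) \<le> norm (y' s) * (B * norm (y s))"
      using norm_cauchy_schwarz[of "y' s" "- kepler_field_deriv (u s) (y s)"]
        mult_left_mono[OF B[OF s, of "y s"] norm_ge_zero[of "y' s"]] by simp
    ultimately have "g' s \<le> (1 + B) * (2 * norm (y s) * norm (y' s))"
      by (simp add: g'_def algebra_simps)
    also have "\<dots> \<le> (1 + B) * ((norm (y s))\<^sup>2 + (norm (y' s))\<^sup>2)"
      using \<open>0 < B\<close> sum_squares_bound[of "norm (y s)" "norm (y' s)"] by (intro mult_left_mono) auto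
    finally show "g' s \<le> (1 + B) * g s" by (simp add: g_def power2_norm_eq_inner)
  qed (use init t in \<open>auto simp: g_def\<close>)
  then have "y t \<bullet> y t = 0 \<and> y' t \<bullet> y' t = 0"
    using inner_ge_zero[of "y t"] inner_ge_zero[of "y' t"] unfolding g_def by linarith
  then show "y t = 0" "y' t = 0" by simp_all
qed

text \<open>The equation identifies the weak second derivative, up to a null set, with the
  continuous function \<open>g\<close>. So the velocity is an indefinite integral of
  \<open>g\<close> and differentiable everywhere on the period.\<close>

lemma operator_kernel_linearized_solution:
  assumes u: "u \<in> kepler_domain" and \<eta>: "\<eta> \<in> operator_kernel (kepler_hessian u)"
  shows "linearized_solution u \<eta> (velocity \<eta>)"
  unfolding linearized_solution_def
proof (intro ballI conjI)
  fix t :: real assume t: "t \<in> {0..2*pi}"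
  have H: "\<eta> \<in> H2_periodic" and ae: "AE t in lborel. t \<in> {0..2*pi} \<longrightarrow> kepler_hessian u \<eta> t = 0"
    using \<eta> by (auto simp: operator_kernel_def)
  show "(\<eta> has_vector_derivative velocity \<eta> t) (at t within {0..2*pi})"
    by (rule has_vector_derivative_velocity[OF H])
  define g where "g t = - kepler_field_deriv (u t) (\<eta> t)" for t
  have gc: "continuous_on S g" for S
    unfolding g_def[abs_def] by (intro continuous_intros kepler_domain_continuous u H)
  have V: "velocity \<eta> s = velocity \<eta> 0 + integral {0..s} g" if s: "s \<in> {0..2*pi}" for s
  proof -
    have gi: "set_integrable lborel {0..s} g" by (intro borel_integrable_atLeastAtMost' gc)
    have wi: "set_integrable lborel {0..s} (weak_deriv2 \<eta>)"
      and ws: "velocity \<eta> s - velocity \<eta> 0 = (LBINT t:{0..s}. weak_deriv2 \<eta> t)"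
      using weak_deriv2(2)[OF H] s by (auto simp: has_weak_derivative_def)
    have "(LBINT t:{0..s}. weak_deriv2 \<eta> t) = (LBINT t:{0..s}. g t)"
      unfolding set_lebesgue_integral_def
    proof (rule integral_cong_AE)
      show "AE t in lborel. indicator {0..s} t *\<^sub>R weak_deriv2 \<eta> t = indicator {0..s} t *\<^sub>R g t"
        using ae
      proof eventually_elim
        case (elim t)
        have "weak_deriv2 \<eta> t = g t" if "t \<in> {0..s}"
        proof -
          have "- weak_deriv2 \<eta> t = kepler_field_deriv (u t) (\<eta> t)"
            using elim that s by (auto simp: kepler_hessian_eq)
          then show ?thesis by (simp add: g_def flip: minus_equation_iff) (metis minus_minus)
        qed
        then show ?case by (cases "t \<in> {0..s}") simp_all
      qed
    qed (use gi wi in \<open>auto simp: set_integrable_def\<close>)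
    then show ?thesis
      using ws set_borel_integral_eq_integral(2)[OF gi] by (simp add: algebra_simps)
  qed
  have "((\<lambda>s. velocity \<eta> 0 + integral {0..s} g) has_vector_derivative 0 + g t) (at t within {0..2*pi})"
    by (intro has_vector_derivative_add has_vector_derivative_const integral_has_vector_derivative gc t)
  then have "((\<lambda>s. velocity \<eta> 0 + integral {0..s} g) has_vector_derivative g t) (at t within {0..2*pi})"
    by simp
  then have "(velocity \<eta> has_vector_derivative g t) (at t within {0..2*pi})"
    by (rule has_vector_derivative_transform[OF t, rotated]) (rule V)
  then show "(velocity \<eta> has_vector_derivative - kepler_field_deriv (u t) (\<eta> t)) (at t within {0..2*pi})"
    by (simp add: g_def)
qed


lemma linear_system_2:
  fixes p q r s x y :: real
  assumes "p * s - q * r \<noteq> 0"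
  obtains a b where "a * p + b * q = x" "a * r + b * s = y"
proof (rule that)
  let ?d = "p * s - q * r"
  show "((x * s - y * q) / ?d) * p + ((y * p - x * r) / ?d) * q = x"
    "((x * s - y * q) / ?d) * r + ((y * p - x * r) / ?d) * s = y"
    using assms by (simp_all add: divide_simps) (simp_all add: algebra_simps)
qed

text \<open>At the pericentre the six initial values decouple. The e-derivative and \<open>z\<close>
  match the first component of \<eta> and the second of its velocity; u' and J3 u match the second
  component of \<eta> and the first of its velocity; J1 u and J2 u each match one of the two
  vertical values.\<close>

lemma operator_kernel_eq_span:
  assumes e: "0 < e" "e < 1"
  defines "u \<equiv> kepler_ellipse e"
  shows "operator_kernel (kepler_hessian u) = span (kernel_basis e)"
proof
  have e': "\<bar>e\<bar> < 1" using e by simp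
  note c = ellipse_parameters[OF e']
  define c where "c = sqrt (1 - e\<^sup>2)"
  note c = c[folded c_def]
  define \<rho> where "\<rho> = 1 - e"
  have rho: "0 < \<rho>" using e by (simp add: \<rho>_def)
  have cc: "c * c = \<rho> * (1 + e)" unfolding c(3) by (simp add: \<rho>_def algebra_simps)
  note uD = kepler_ellipse_domain(1)[OF e', folded u_def]
  show "span (kernel_basis e) \<subseteq> operator_kernel (kepler_hessian u)"
    unfolding u_def by (intro span_minimal kernel_basis_subset e' subspace_operator_kernel kepler_ellipse_domain)
  show "operator_kernel (kepler_hessian u) \<subseteq> span (kernel_basis e)"
  proof
    fix \<eta> assume \<eta>: "\<eta> \<in> operator_kernel (kepler_hessian u)"
    then have H: "\<eta> \<in> H2_periodic" by (simp add: operator_kernel_def)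
    let ?v = "ellipse_velocity e" and ?a = "\<lambda>t. - kepler_field (u t)"
      and ?w = "ellipse_deriv_e e" and ?w' = "ellipse_deriv_e_velocity e"
    \<comment> \<open>\<open>z\<close> generates the scaling \<open>u \<mapsto> \<lambda>\<^sup>2 u(t / \<lambda>\<^sup>3)\<close>, which does not preserve the period.\<close>
    define z where "z t = 2 *\<^sub>R u t - (3 * t) *\<^sub>R ?v t" for t
    define z' where "z' t = - ?v t - (3 * t) *\<^sub>R ?a t" for t
    have sv: "linearized_solution u ?v ?a"
      unfolding u_def by (rule linearized_solutionI[OF ellipse_velocity_deriv[OF e'] ellipse_velocity_deriv2[OF e']])
    have sw: "linearized_solution u ?w ?w'"
      unfolding u_def by (rule linearized_solutionI[OF ellipse_deriv_e_deriv[OF e']])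
    have sJ: "linearized_solution u (\<lambda>t. J *v u t) (\<lambda>t. J *v ?v t)" if "J \<in> {J1, J2, J3}" for J
      unfolding u_def by (rule linearized_solutionI[OF skew_ellipse_deriv[OF e' that]])
    have sz: "linearized_solution u z z'"
    proof (rule linearized_solutionI)
      fix t
      have du: "(u has_vector_derivative ?v t) (at t)"
        and dv: "(?v has_vector_derivative ?a t) (at t)"
        and da: "(?a has_vector_derivative - kepler_field_deriv (u t) (?v t)) (at t)"
        unfolding u_def using kepler_ellipse_deriv_t[OF e'] ellipse_velocity_deriv[OF e'] ellipse_velocity_deriv2[OF e'] by auto
      have s: "((\<lambda>t. (3 * t) *\<^sub>R f t) has_vector_derivative (3 * t) *\<^sub>R f' + 3 *\<^sub>R f t) (at t)"
        if "(f has_vector_derivative f') (at t)" for f :: curve and f'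
        by (rule has_vector_derivative_scaleR[OF _ that]) (auto intro!: derivative_eq_intros)
      have "(z has_vector_derivative 2 *\<^sub>R ?v t - ((3 * t) *\<^sub>R ?a t + 3 *\<^sub>R ?v t)) (at t)"
        unfolding z_def[abs_def]
        by (intro has_vector_derivative_diff s dv bounded_linear.has_vector_derivative[OF bounded_linear_scaleR_right] du)
      moreover have "2 *\<^sub>R ?v t - ((3 * t) *\<^sub>R ?a t + 3 *\<^sub>R ?v t) = z' t"
        by (simp add: z'_def vec_eq_iff)
      ultimately show "(z has_vector_derivative z' t) (at t)" by simp
      have dz': "(z' has_vector_derivative - ?a t - ((3 * t) *\<^sub>R - kepler_field_deriv (u t) (?v t) + 3 *\<^sub>R ?a t)) (at t)"
        unfolding z'_def[abs_def] by (intro has_vector_derivative_diff has_vector_derivative_minus s da dv)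
      \<comment> \<open>Euler's identity: the force is homogeneous of degree -2.\<close>
      have Du: "kepler_field_deriv (u t) (u t) = (- 2) *\<^sub>R kepler_field (u t)"
      proof -
        have "u t \<bullet> u t = norm (u t) ^ 2" by (simp add: power2_norm_eq_inner)
        moreover have "norm (u t) \<noteq> 0" using kepler_domainD(2)[OF uD] by simp
        ultimately have "3 * (u t \<bullet> u t) / norm (u t) ^ 5 = 3 / norm (u t) ^ 3"
          by (simp add: eval_nat_numeral)
        then show ?thesis
          by (simp add: kepler_field_deriv_def kepler_field_def flip: scaleR_diff_left)
      qed
      have "- ?a t - ((3 * t) *\<^sub>R - kepler_field_deriv (u t) (?v t) + 3 *\<^sub>R ?a t)
          = - kepler_field_deriv (u t) (z t)"
        unfolding z_def kepler_field_deriv_diff kepler_field_deriv_scaleR Du by (simp add: vec_eq_iff)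
      with dz' show "(z' has_vector_derivative - kepler_field_deriv (u t) (z t)) (at t)" by simp
    qed
    note v0 = ellipse_values_0[OF e', folded c_def \<rho>_def u_def]
    have z0: "z 0 = vector [2 * \<rho>, 0, 0]" "z' 0 = vector [0, - (c / \<rho>), 0]"
      by (simp_all add: z_def z'_def v0 vector_3_scaleR vector_3_uminus vector_3_zero[symmetric])
    define V where "V = velocity \<eta>"
    \<comment> \<open>The determinant equals - \<rho> / c and never vanishes.\<close>
    obtain a3 k where ak: "a3 * (-1) + k * (2 * \<rho>) = \<eta> 0 $ 1" "a3 * (1 / (c * \<rho>)) + k * (- (c / \<rho>)) = V 0 $ 2"
    proof (rule linear_system_2)
      have "(-1) * (- (c / \<rho>)) - 2 * \<rho> * (1 / (c * \<rho>)) = (c * c - 2 * \<rho>) / (c * \<rho>)"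
        using c(1) rho by (simp add: field_simps)
      also have "c * c - 2 * \<rho> = - \<rho> * \<rho>" unfolding cc by (simp add: \<rho>_def algebra_simps)
      finally show "(-1) * (- (c / \<rho>)) - 2 * \<rho> * (1 / (c * \<rho>)) \<noteq> 0" using c(1) rho by simp
    qed blast
    \<comment> \<open>The determinant equals - e / \<rho>, which degenerates exactly on the
      circle.\<close>
    obtain a1 b3 where ab: "a1 * (c / \<rho>) + b3 * \<rho> = \<eta> 0 $ 2" "a1 * (- 1 / \<rho>\<^sup>2) + b3 * (- (c / \<rho>)) = V 0 $ 1"
    proof (rule linear_system_2)
      have "c / \<rho> * (- (c / \<rho>)) - \<rho> * (- 1 / \<rho>\<^sup>2) = (\<rho> - c * c) / (\<rho> * \<rho>)"
        using rho by (simp add: field_simps power2_eq_square)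
      also have "\<rho> - c * c = - (\<rho> * e)" unfolding cc by (simp add: algebra_simps)
      finally show "c / \<rho> * (- (c / \<rho>)) - \<rho> * (- 1 / \<rho>\<^sup>2) \<noteq> 0" using rho e by simp
    qed blast
    define b1 where "b1 = V 0 $ 3 / (c / \<rho>)"
    define b2 where "b2 = \<eta> 0 $ 3 / \<rho>"
    have b: "b1 * (c / \<rho>) = V 0 $ 3" "b2 * \<rho> = \<eta> 0 $ 3" using c(1) rho by (simp_all add: b1_def b2_def)
    define d where "d t = \<eta> t - a1 *\<^sub>R ?v t - a3 *\<^sub>R ?w t - b1 *\<^sub>R (J1 *v u t) - b2 *\<^sub>R (J2 *v u t)
      - b3 *\<^sub>R (J3 *v u t)" for t
    have sol: "linearized_solution u
       (\<lambda>t. \<eta> t - a1 *\<^sub>R ?v t - a3 *\<^sub>R ?w t - b1 *\<^sub>R (J1 *v u t) - b2 *\<^sub>R (J2 *v u t) - b3 *\<^sub>R (J3 *v u t) - k *\<^sub>R z t)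
       (\<lambda>t. V t - a1 *\<^sub>R ?a t - a3 *\<^sub>R ?w' t - b1 *\<^sub>R (J1 *v ?v t) - b2 *\<^sub>R (J2 *v ?v t) - b3 *\<^sub>R (J3 *v ?v t) - k *\<^sub>R z' t)"
      unfolding V_def
      by (intro linearized_solution_diff operator_kernel_linearized_solution uD \<eta> sv sw sz sJ) auto
    have eq: "d t = k *\<^sub>R z t" if "t \<in> {0..2*pi}" for t
    proof -
      have "d t - k *\<^sub>R z t = 0"
        unfolding d_def
      proof (rule linearized_solution_unique(1)[OF uD sol _ _ that])
        show "\<eta> 0 - a1 *\<^sub>R ?v 0 - a3 *\<^sub>R ?w 0 - b1 *\<^sub>R (J1 *v u 0) - b2 *\<^sub>R (J2 *v u 0) - b3 *\<^sub>R (J3 *v u 0) - k *\<^sub>R z 0 = 0"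
          using ak(1) ab(1) b by (simp add: v0 z0 vector_3_mult vec_eq_iff forall_3)
        show "V 0 - a1 *\<^sub>R ?a 0 - a3 *\<^sub>R ?w' 0 - b1 *\<^sub>R (J1 *v ?v 0) - b2 *\<^sub>R (J2 *v ?v 0) - b3 *\<^sub>R (J3 *v ?v 0) - k *\<^sub>R z' 0 = 0"
          using ak(2) ab(2) b unfolding v0(3) unfolding v0 z0 by (simp add: vector_3_mult vec_eq_iff forall_3)
      qed
      then show ?thesis by simp
    qed
    have dper: "d (t + 2*pi) = d t" for t
      by (simp add: d_def H2_periodicD[OF H] ellipse_periodic[OF e'] u_def kepler_ellipse_periodic[OF e'])
    \<comment> \<open>Over one period \<open>z\<close> changes by - 6 pi times the pericentre
      velocity, which is nonzero, whereas \<open>d\<close> is periodic.\<close>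
    have "k = 0"
    proof -
      have "k *\<^sub>R z (2 * pi) = k *\<^sub>R z 0"
        using eq[of 0] eq[of "2*pi"] dper[of 0] by simp
      moreover have "z (2 * pi) = z 0 - (6 * pi) *\<^sub>R ?v 0"
        using kepler_ellipse_periodic[OF e', of 0] ellipse_periodic(1)[OF e', of 0] by (simp add: z_def u_def)
      ultimately have "(k * (6 * pi)) *\<^sub>R ?v 0 = 0" by (simp add: scaleR_diff_right)
      then show ?thesis using c(1) rho by (simp add: v0 vec_eq_iff forall_3)
    qed
    have "d t = 0" for t
    proof -
      obtain s where "s \<in> {0..2*pi}" "d t = d s" using periodic_shift[of d t] dper by blast
      then show ?thesis using eq[of s] \<open>k = 0\<close> by simp
    qed
    then have "\<eta> t = a1 *\<^sub>R ?v t + a3 *\<^sub>R ?w t + b1 *\<^sub>R (J1 *v u t) + b2 *\<^sub>R (J2 *v u t) + b3 *\<^sub>R (J3 *v u t)"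
      for t unfolding d_def by (simp only: diff_eq_eq add_0_left ac_simps)
    then show "\<eta> \<in> span (kernel_basis e)" unfolding span_kernel_basis u_def by blast
  qed
qed


section \<open>The tangent space\<close>

text \<open>On the manifold second derivatives equal minus the force, so the second derivative of a
  difference quotient is a difference quotient of the force. Uniform closeness alone then makes the
  quotient an approximate solution of the linearized equation, with an error relative to its own
  size; both inclusions for the tangent space rest on this.\<close>

lemma kepler_difference_quotient:
  assumes u: "u \<in> kepler_manifold" and "0 < \<epsilon>"
  shows "\<exists>\<delta>>0. \<forall>v\<in>kepler_manifold. \<forall>s. s \<noteq> 0 \<longrightarrow> (\<forall>t\<in>{0..2*pi}. norm (v t - u t) < \<delta>) \<longrightarrow>
      (v - u) /\<^sub>R s \<in> H2_periodic \<and>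
      (AE t in lborel. t \<in> {0..2*pi} \<longrightarrow>
         norm (weak_deriv2 ((v - u) /\<^sub>R s) t + kepler_field_deriv (u t) (((v - u) /\<^sub>R s) t))
           \<le> \<epsilon> * norm (((v - u) /\<^sub>R s) t))"
proof -
  note uM = kepler_manifoldD[OF u]
  note uH = kepler_domainD(1)[OF uM(1)]
  obtain \<delta> where "0 < \<delta>" and \<delta>: "\<And>t h. \<lbrakk>t \<in> {0..2*pi}; norm h < \<delta>\<rbrakk> \<Longrightarrow>
      norm (kepler_field (u t + h) - kepler_field (u t) - kepler_field_deriv (u t) h) \<le> \<epsilon> * norm h"
    using kepler_field_expansion[OF uM(1) \<open>0 < \<epsilon>\<close>] by blast
  show ?thesis
  proof (rule exI[of _ \<delta>], rule conjI[OF \<open>0 < \<delta>\<close>], rule ballI, rule allI, rule impI, rule impI)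
    fix v and s :: real assume v: "v \<in> kepler_manifold" and "s \<noteq> 0"
      and small: "\<forall>t\<in>{0..2*pi}. norm (v t - u t) < \<delta>"
    note vM = kepler_manifoldD[OF v]
    note vH = kepler_domainD(1)[OF vM(1)]
    let ?q = "(v - u) /\<^sub>R s"
    have q: "?q = (\<lambda>t. inverse s *\<^sub>R v t + (- inverse s) *\<^sub>R u t)"
      by (auto simp: scaleR_fun_def algebra_simps)
    have "AE t in lborel. t \<in> {0..2*pi} \<longrightarrow>
         norm (weak_deriv2 ?q t + kepler_field_deriv (u t) (?q t)) \<le> \<epsilon> * norm (?q t)"
      using uM(2) vM(2) H2_lincomb(3)[OF vH uH, of "inverse s" "- inverse s"]
    proof eventually_elim
      case (elim t)
      show ?case
      proof
        assume t: "t \<in> {0..2*pi}"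
        let ?h = "v t - u t"
        have qt: "?q t = inverse s *\<^sub>R ?h" by (simp add: scaleR_fun_def)
        have "weak_deriv2 ?q t = inverse s *\<^sub>R (kepler_field (u t) - kepler_field (v t))"
          unfolding q using elim by (simp add: algebra_simps)
        then have "weak_deriv2 ?q t + kepler_field_deriv (u t) (?q t)
            = (- inverse s) *\<^sub>R (kepler_field (u t + ?h) - kepler_field (u t) - kepler_field_deriv (u t) ?h)"
          unfolding qt kepler_field_deriv_scaleR by (simp add: algebra_simps)
        then have "norm (weak_deriv2 ?q t + kepler_field_deriv (u t) (?q t))
            = \<bar>inverse s\<bar> * norm (kepler_field (u t + ?h) - kepler_field (u t) - kepler_field_deriv (u t) ?h)"
          by simp
        also have "\<dots> \<le> \<bar>inverse s\<bar> * (\<epsilon> * norm ?h)"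
          by (intro mult_left_mono \<delta>[OF t] small[rule_format, OF t]) simp
        also have "\<dots> = \<epsilon> * norm (?q t)" unfolding qt by simp
        finally show "norm (weak_deriv2 ?q t + kepler_field_deriv (u t) (?q t)) \<le> \<epsilon> * norm (?q t)" .
      qed
    qed
    moreover have "?q \<in> H2_periodic" unfolding q by (rule H2_lincomb(1)[OF vH uH])
    ultimately show "?q \<in> H2_periodic \<and> (AE t in lborel. t \<in> {0..2*pi} \<longrightarrow>
         norm (weak_deriv2 ?q t + kepler_field_deriv (u t) (?q t)) \<le> \<epsilon> * norm (?q t))" by blast
  qed
qed

lemma H2_bounded:
  assumes "\<eta> \<in> H2_periodic"
  obtains M where "0 < M" "\<And>t. norm (\<eta> t) \<le> M"
proof (rule that)
  show "0 < 4 * H2_norm \<eta> + 1" using H2_norm_nonneg[of \<eta>] by simp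
  show "norm (\<eta> t) \<le> 4 * H2_norm \<eta> + 1" for t using Sobolev(1)[OF assms, of t] by simp
qed

text \<open>The curve \<open>\<gamma>\<close> comes without differentiable parameters; only its H^2
  velocity at 0 is given. Its difference quotients almost solve the linearized equation and tend to
  \<eta> in H^2, so the norm of the Hessian at \<eta> is below every positive e.\<close>

lemma tangent_space_subset_kernel:
  assumes u: "u \<in> kepler_manifold"
  shows "tangent_space kepler_manifold u \<subseteq> operator_kernel (kepler_hessian u)"
proof
  fix \<eta> assume "\<eta> \<in> tangent_space kepler_manifold u"
  then obtain \<gamma> where H: "\<eta> \<in> H2_periodic" and "\<gamma> 0 = u" and M: "\<forall>\<^sub>F s in nhds 0. \<gamma> s \<in> kepler_manifold"
    and lim: "((\<lambda>s. H2_norm ((\<gamma> s - u) /\<^sub>R s - \<eta>)) \<longlongrightarrow> 0) (at 0)"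
    by (auto simp: tangent_space_def)
  note uD = kepler_manifoldD(1)[OF u]
  obtain B where "0 < B" and B: "\<And>t h. t \<in> {0..2*pi} \<Longrightarrow> norm (kepler_field_deriv (u t) h) \<le> B * norm h"
    using kepler_field_deriv_bound[OF uD] by blast
  obtain K where "0 < K" and K: "\<And>t. norm (\<eta> t) \<le> K" using H2_bounded[OF H] by blast
  have "L2_norm (kepler_hessian u \<eta>) \<le> 0 + e" if "0 < e" for e
  proof -
    \<comment> \<open>K + 4 bounds the quotient: K for \<eta>, and 4 by \<open>Sobolev\<close> for a
      deviation of norm at most 1. The factor 12 makes this error contribute e / 2.\<close>
    define \<epsilon> where "\<epsilon> = e / (12 * (K + 4))"
    have "0 < \<epsilon>" using that \<open>0 < K\<close> by (simp add: \<epsilon>_def)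
    obtain \<delta> where "0 < \<delta>" and \<delta>: "\<forall>v\<in>kepler_manifold. \<forall>s. s \<noteq> 0 \<longrightarrow> (\<forall>t\<in>{0..2*pi}. norm (v t - u t) < \<delta>) \<longrightarrow>
      (v - u) /\<^sub>R s \<in> H2_periodic \<and>
      (AE t in lborel. t \<in> {0..2*pi} \<longrightarrow>
         norm (weak_deriv2 ((v - u) /\<^sub>R s) t + kepler_field_deriv (u t) (((v - u) /\<^sub>R s) t))
           \<le> \<epsilon> * norm (((v - u) /\<^sub>R s) t))"
      using kepler_difference_quotient[OF u \<open>0 < \<epsilon>\<close>] by blast
    \<comment> \<open>The other half of e pays for the deviation: 2 \<nu> (1 + 12 B) \<le> e /
      2.\<close>
    define \<nu> where "\<nu> = min 1 (e / (4 * (1 + 12 * B)))"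
    have "0 < \<nu>" using that \<open>0 < B\<close> by (simp add: \<nu>_def)
    have 1: "\<forall>\<^sub>F s in at 0. \<gamma> s \<in> kepler_manifold"
      using M by (simp add: eventually_nhds_conv_at)
    have 2: "\<forall>\<^sub>F s in at 0. H2_norm ((\<gamma> s - u) /\<^sub>R s - \<eta>) < \<nu>"
      using order_tendstoD(2)[OF lim \<open>0 < \<nu>\<close>] .
    have 3: "\<forall>\<^sub>F s::real in at 0. s \<noteq> 0" by (simp add: eventually_at_filter)
    have "((\<lambda>s. \<bar>s\<bar> * (K + 4)) \<longlongrightarrow> \<bar>0\<bar> * (K + 4)) (at (0::real))" by (intro tendsto_intros)
    then have 4: "\<forall>\<^sub>F s in at (0::real). \<bar>s\<bar> * (K + 4) < \<delta>"
      using order_tendstoD(2) \<open>0 < \<delta>\<close> by fastforce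
    obtain s where gM: "\<gamma> s \<in> kepler_manifold" and N\<nu>: "H2_norm ((\<gamma> s - u) /\<^sub>R s - \<eta>) < \<nu>"
      and s: "s \<noteq> 0" "\<bar>s\<bar> * (K + 4) < \<delta>"
      using eventually_happens'[OF _ eventually_conj[OF 1 eventually_conj[OF 2 eventually_conj[OF 3 4]]]] by auto
    let ?q = "(\<gamma> s - u) /\<^sub>R s"
    let ?p = "?q - \<eta>"
    have qH: "?q \<in> H2_periodic"
    proof -
      have "?q = (\<lambda>t. inverse s *\<^sub>R \<gamma> s t + (- inverse s) *\<^sub>R u t)"
        by (auto simp: scaleR_fun_def algebra_simps)
      then show ?thesis
        using H2_lincomb(1)[OF kepler_domainD(1)[OF kepler_manifoldD(1)[OF gM]] kepler_domainD(1)[OF uD]] by metis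
    qed
    have pH: "?p \<in> H2_periodic" by (rule H2_diff(1)[OF H qH])
    have pN: "norm (?p t) \<le> 4 * H2_norm ?p" for t by (rule Sobolev(1)[OF pH])
    have qK: "norm (?q t) \<le> K + 4" for t
      using norm_triangle_ineq[of "?p t" "\<eta> t"] pN[of t] K[of t] N\<nu> by (simp add: \<nu>_def)
    have "norm (\<gamma> s t - u t) < \<delta>" for t
    proof -
      have "norm (\<gamma> s t - u t) = \<bar>s\<bar> * norm (?q t)" using s(1) by (simp add: scaleR_fun_def)
      also have "\<dots> \<le> \<bar>s\<bar> * (K + 4)" by (intro mult_left_mono qK) simp
      finally show ?thesis using s(2) by simp
    qed
    then have ae: "AE t in lborel. t \<in> {0..2*pi} \<longrightarrow>
         norm (weak_deriv2 ?q t + kepler_field_deriv (u t) (?q t)) \<le> \<epsilon> * norm (?q t)"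
      using \<delta> gM s(1) by blast
    define b where "b = \<epsilon> * (K + 4) + B * (4 * H2_norm ?p)"
    have b0: "0 \<le> b" using \<open>0 < \<epsilon>\<close> \<open>0 < K\<close> \<open>0 < B\<close> H2_norm_nonneg[of ?p] by (simp add: b_def)
    \<comment> \<open>The scalar error bound \<open>b\<close> enters as a constant curve of norm b,
      the form in which \<open>L2_norm_quasi_triangle\<close> accepts it.\<close>
    have l1: "L2_norm (kepler_hessian u \<eta>) \<le> 2 * (L2_norm (weak_deriv2 ?p) + L2_norm (\<lambda>_. b *\<^sub>R axis 1 1))"
    proof (rule L2_norm_quasi_triangle)
      show "L2_on 0 (2*pi) (\<lambda>_. b *\<^sub>R axis 1 1)" by (intro L2_on_continuous continuous_intros)
      show "AE t in lborel. t \<in> {0..2*pi} \<longrightarrow>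
          norm (kepler_hessian u \<eta> t) \<le> norm (weak_deriv2 ?p t) + norm (b *\<^sub>R axis 1 1 :: real ^ 3)"
        using ae H2_diff(3)[OF H qH]
      proof eventually_elim
        case (elim t)
        show ?case
        proof
          assume t: "t \<in> {0..2*pi}"
          define Z where "Z = weak_deriv2 ?q t + kepler_field_deriv (u t) (?q t)"
          have "kepler_hessian u \<eta> t = weak_deriv2 ?p t + (kepler_field_deriv (u t) (?p t) - Z)"
            using elim by (simp add: Z_def kepler_hessian_eq kepler_field_deriv_diff)
          then have "norm (kepler_hessian u \<eta> t) \<le> norm (weak_deriv2 ?p t) + (norm (kepler_field_deriv (u t) (?p t)) + norm Z)"
            using norm_triangle_ineq[of "weak_deriv2 ?p t" "kepler_field_deriv (u t) (?p t) - Z"]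
              norm_triangle_ineq4[of "kepler_field_deriv (u t) (?p t)" Z] by simp
          moreover have "norm Z \<le> \<epsilon> * norm (?q t)" using elim t by (simp add: Z_def)
          moreover have "\<epsilon> * norm (?q t) \<le> \<epsilon> * (K + 4)"
            using \<open>0 < \<epsilon>\<close> by (intro mult_left_mono qK) simp
          moreover have "norm (kepler_field_deriv (u t) (?p t)) \<le> B * norm (?p t)" by (rule B[OF t])
          moreover have "B * norm (?p t) \<le> B * (4 * H2_norm ?p)"
            using \<open>0 < B\<close> by (intro mult_left_mono pN) simp
          ultimately have "norm (kepler_hessian u \<eta> t) \<le> norm (weak_deriv2 ?p t) + b"
            unfolding b_def by linarith
          then show "norm (kepler_hessian u \<eta> t) \<le> norm (weak_deriv2 ?p t) + norm (b *\<^sub>R axis 1 1 :: real ^ 3)"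
            using b0 by (simp add: norm_axis_1)
        qed
      qed
    qed (rule H2_L2_on(3)[OF pH])
    have l2: "L2_norm (\<lambda>_. b *\<^sub>R axis 1 1) \<le> 3 * b"
      using b0 by (intro L2_norm_le_sup) (auto simp: norm_axis_1)
    have "L2_norm (kepler_hessian u \<eta>) \<le> 2 * (H2_norm ?p + 3 * b)"
      by (rule order_trans[OF l1]) (intro mult_left_mono add_mono l2 L2_norm_le_H2_norm(3), simp)
    also have "2 * (H2_norm ?p + 3 * b) = 2 * (H2_norm ?p * (1 + 12 * B)) + 6 * (\<epsilon> * (K + 4))"
      by (simp add: b_def algebra_simps)
    finally have "L2_norm (kepler_hessian u \<eta>) \<le> 2 * (H2_norm ?p * (1 + 12 * B)) + 6 * (\<epsilon> * (K + 4))" .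
    moreover have "6 * (\<epsilon> * (K + 4)) = e / 2" using \<open>0 < K\<close> by (simp add: \<epsilon>_def field_simps)
    moreover have "H2_norm ?p * (1 + 12 * B) \<le> e / (4 * (1 + 12 * B)) * (1 + 12 * B)"
      using N\<nu> \<open>0 < B\<close> by (intro mult_right_mono) (auto simp: \<nu>_def)
    moreover have "e / (4 * (1 + 12 * B)) * (1 + 12 * B) = e / 4" using \<open>0 < B\<close> by (simp add: field_simps)
    ultimately show ?thesis by linarith
  qed
  then have "L2_norm (kepler_hessian u \<eta>) = 0"
    using field_le_epsilon[of "L2_norm (kepler_hessian u \<eta>)" 0] L2_norm_nonneg[of "kepler_hessian u \<eta>"] by (intro antisym) auto
  from L2_norm_eq_0_imp[OF kepler_hessian_L2_on[OF uD H] this]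
  show "\<eta> \<in> operator_kernel (kepler_hessian u)" using H by (simp add: operator_kernel_def)
qed

text \<open>Both the quotient and \<eta> have second derivatives governed by the curve itself, the
  first approximately and the second exactly. Uniform closeness therefore bounds the difference of
  the second derivatives, and \<open>H2_norm_le_sup\<close> supplies the velocity.\<close>

lemma tangent_spaceI:
  assumes u: "u \<in> kepler_manifold" and \<eta>: "\<eta> \<in> operator_kernel (kepler_hessian u)"
    and \<gamma>: "\<gamma> 0 = u" "\<forall>\<^sub>F s in nhds 0. \<gamma> s \<in> kepler_manifold"
    and lim: "uniform_limit {0..2*pi} (\<lambda>s t. (\<gamma> s t - u t) /\<^sub>R s) \<eta> (at 0)"
  shows "\<eta> \<in> tangent_space kepler_manifold u"
proof -
  note uD = kepler_manifoldD(1)[OF u]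
  have H: "\<eta> \<in> H2_periodic" and ker: "AE t in lborel. t \<in> {0..2*pi} \<longrightarrow> kepler_hessian u \<eta> t = 0"
    using \<eta> by (auto simp: operator_kernel_def)
  obtain B where "0 < B" and B: "\<And>t h. t \<in> {0..2*pi} \<Longrightarrow> norm (kepler_field_deriv (u t) h) \<le> B * norm h"
    using kepler_field_deriv_bound[OF uD] by blast
  obtain K where "0 < K" and K: "\<And>t. norm (\<eta> t) \<le> K" using H2_bounded[OF H] by blast
  have "((\<lambda>s. H2_norm ((\<gamma> s - u) /\<^sub>R s - \<eta>)) \<longlongrightarrow> 0) (at 0)"
  proof (rule tendstoI)
    fix e :: real assume "0 < e"
    define \<epsilon> where "\<epsilon> = e / (24 * (K + 1))"
    have "0 < \<epsilon>" using \<open>0 < e\<close> \<open>0 < K\<close> by (simp add: \<epsilon>_def)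
    obtain \<delta> where "0 < \<delta>" and \<delta>: "\<forall>v\<in>kepler_manifold. \<forall>s. s \<noteq> 0 \<longrightarrow> (\<forall>t\<in>{0..2*pi}. norm (v t - u t) < \<delta>) \<longrightarrow>
      (v - u) /\<^sub>R s \<in> H2_periodic \<and>
      (AE t in lborel. t \<in> {0..2*pi} \<longrightarrow>
         norm (weak_deriv2 ((v - u) /\<^sub>R s) t + kepler_field_deriv (u t) (((v - u) /\<^sub>R s) t))
           \<le> \<epsilon> * norm (((v - u) /\<^sub>R s) t))"
      using kepler_difference_quotient[OF u \<open>0 < \<epsilon>\<close>] by blast
    \<comment> \<open>This choice and that of \<open>\<epsilon>\<close> each contribute e / 4 to the
      final bound, which is e / 2 and hence strictly below e.\<close>
    define \<nu> where "\<nu> = min 1 (e / (24 * (1 + B)))"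
    have "0 < \<nu>" using \<open>0 < e\<close> \<open>0 < B\<close> by (simp add: \<nu>_def)
    have 1: "\<forall>\<^sub>F s in at 0. \<gamma> s \<in> kepler_manifold"
      using \<gamma>(2) by (simp add: eventually_nhds_conv_at)
    have 2: "\<forall>\<^sub>F s in at 0. \<forall>t\<in>{0..2*pi}. dist ((\<gamma> s t - u t) /\<^sub>R s) (\<eta> t) < \<nu>"
      using lim \<open>0 < \<nu>\<close> unfolding uniform_limit_iff by blast
    have 3: "\<forall>\<^sub>F s::real in at 0. s \<noteq> 0" by (simp add: eventually_at_filter)
    have "((\<lambda>s. \<bar>s\<bar> * (K + 1)) \<longlongrightarrow> \<bar>0\<bar> * (K + 1)) (at (0::real))" by (intro tendsto_intros)
    then have 4: "\<forall>\<^sub>F s in at (0::real). \<bar>s\<bar> * (K + 1) < \<delta>"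
      using order_tendstoD(2) \<open>0 < \<delta>\<close> by fastforce
    show "\<forall>\<^sub>F s in at 0. dist (H2_norm ((\<gamma> s - u) /\<^sub>R s - \<eta>)) 0 < e"
      using 1 2 3 4
    proof eventually_elim
      case (elim s)
      let ?q = "(\<gamma> s - u) /\<^sub>R s"
      let ?p = "?q - \<eta>"
      have p\<nu>: "norm (?p t) \<le> \<nu>" if "t \<in> {0..2*pi}" for t
        using elim(2) that by (force simp: dist_norm scaleR_fun_def)
      have qK: "norm (?q t) \<le> K + 1" if "t \<in> {0..2*pi}" for t
        using norm_triangle_ineq[of "?p t" "\<eta> t"] p\<nu>[OF that] K[of t] by (simp add: \<nu>_def)
      have "norm (\<gamma> s t - u t) < \<delta>" if "t \<in> {0..2*pi}" for t
      proof -
        have "norm (\<gamma> s t - u t) = \<bar>s\<bar> * norm (?q t)" using elim(3) by (simp add: scaleR_fun_def)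
        also have "\<dots> \<le> \<bar>s\<bar> * (K + 1)" by (intro mult_left_mono qK that) simp
        finally show ?thesis using elim(4) by simp
      qed
      then have qH: "?q \<in> H2_periodic" and ae: "AE t in lborel. t \<in> {0..2*pi} \<longrightarrow>
         norm (weak_deriv2 ?q t + kepler_field_deriv (u t) (?q t)) \<le> \<epsilon> * norm (?q t)"
        using \<delta> elim(1,3) by blast+
      have "H2_norm ?p \<le> 6 * (\<nu> + (\<epsilon> * (K + 1) + B * \<nu>))"
      proof (rule H2_norm_le_sup)
        show "?p \<in> H2_periodic" by (rule H2_diff(1)[OF H qH])
        show "AE t in lborel. t \<in> {0..2*pi} \<longrightarrow> norm (weak_deriv2 ?p t) \<le> \<epsilon> * (K + 1) + B * \<nu>"
          using ae ker H2_diff(3)[OF H qH]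
        proof eventually_elim
          case (elim t)
          show ?case
          proof
            assume t: "t \<in> {0..2*pi}"
            define Z where "Z = weak_deriv2 ?q t + kepler_field_deriv (u t) (?q t)"
            have "weak_deriv2 \<eta> t = - kepler_field_deriv (u t) (\<eta> t)"
              using elim t by (simp add: kepler_hessian_eq) (metis minus_minus)
            then have "weak_deriv2 ?p t = Z - kepler_field_deriv (u t) (?p t)"
              using elim by (simp add: Z_def kepler_field_deriv_diff)
            then have "norm (weak_deriv2 ?p t) \<le> norm Z + norm (kepler_field_deriv (u t) (?p t))"
              using norm_triangle_ineq4[of Z "kepler_field_deriv (u t) (?p t)"] by simp
            moreover have "norm Z \<le> \<epsilon> * norm (?q t)" using elim t by (simp add: Z_def)
            moreover have "\<epsilon> * norm (?q t) \<le> \<epsilon> * (K + 1)"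
              using \<open>0 < \<epsilon>\<close> by (intro mult_left_mono qK t) simp
            moreover have "norm (kepler_field_deriv (u t) (?p t)) \<le> B * norm (?p t)" by (rule B[OF t])
            moreover have "B * norm (?p t) \<le> B * \<nu>"
              using \<open>0 < B\<close> by (intro mult_left_mono p\<nu> t) simp
            ultimately show "norm (weak_deriv2 ?p t) \<le> \<epsilon> * (K + 1) + B * \<nu>" by linarith
          qed
        qed
      qed (use p\<nu> \<open>0 < \<epsilon>\<close> \<open>0 < K\<close> \<open>0 < B\<close> \<open>0 < \<nu>\<close> in auto)
      also have "\<dots> = 6 * (\<nu> * (1 + B)) + 6 * (\<epsilon> * (K + 1))" by (simp add: algebra_simps)
      finally have "H2_norm ?p \<le> 6 * (\<nu> * (1 + B)) + 6 * (\<epsilon> * (K + 1))" .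
      moreover have "\<epsilon> * (K + 1) = e / 24" using \<open>0 < K\<close> by (simp add: \<epsilon>_def field_simps)
      moreover have "\<nu> * (1 + B) \<le> e / (24 * (1 + B)) * (1 + B)"
        using \<open>0 < B\<close> by (intro mult_right_mono) (auto simp: \<nu>_def)
      moreover have "e / (24 * (1 + B)) * (1 + B) = e / 24" using \<open>0 < B\<close> by (simp add: field_simps)
      ultimately have "H2_norm ?p < e" using \<open>0 < e\<close> by linarith
      then show ?case using H2_norm_nonneg[of ?p] by simp
    qed
  qed
  then show ?thesis using H \<gamma> by (auto simp: tangent_space_def)
qed

text \<open>The part moving eccentricity and phase is controlled by uniform differentiability on the
  compact set of pairs (e, t) with t in the period; the rotations are then added by
  \<open>uniform_limit_rotate\<close>.\<close>

lemma kernel_subset_tangent_space: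
  assumes e: "0 < e" "e < 1"
  defines "u \<equiv> kepler_ellipse e"
  shows "operator_kernel (kepler_hessian u) \<subseteq> tangent_space kepler_manifold u"
proof
  have e': "\<bar>e\<bar> < 1" using e by simp
  fix \<eta> assume \<eta>: "\<eta> \<in> operator_kernel (kepler_hessian u)"
  then obtain a b c1 c2 c3 where eq: "\<And>t. \<eta> t = a *\<^sub>R ellipse_velocity e t + b *\<^sub>R ellipse_deriv_e e t
    + c1 *\<^sub>R (J1 *v u t) + c2 *\<^sub>R (J2 *v u t) + c3 *\<^sub>R (J3 *v u t)"
    using operator_kernel_eq_span[OF e] span_kernel_basis[of \<eta> e] unfolding u_def by blast
  \<comment> \<open>Rotations are applied from the innermost factor outwards, in the order fixed by
    \<open>rotation\<close>.\<close>
  define y where "y s t = kepler_ellipse (e + s * b) (t + s * a)" for s t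
  define y3 where "y3 s t = matrix_exp ((s * c3) *\<^sub>R J3) *v y s t" for s t
  define y2 where "y2 s t = matrix_exp ((s * c2) *\<^sub>R J2) *v y3 s t" for s t
  define \<gamma> where "\<gamma> s t = matrix_exp ((s * c1) *\<^sub>R J1) *v y2 s t" for s t
  have m0: "matrix_exp 0 *v x = x" for x :: "real ^ 3"
    using matrix_exp_skew_mult[OF J_cubed(1), of 0 x] by simp
  have zero: "y 0 = u" "y3 0 = u" "y2 0 = u" "\<gamma> 0 = u"
    by (simp_all add: fun_eq_iff y_def y3_def y2_def \<gamma>_def u_def m0)
  have bdd: "bounded (f ` {0..2*pi})" if "\<And>t. (f has_vector_derivative f' t) (at t)" for f f' :: curve
    using that has_vector_derivative_continuous
    by (blast intro: compact_imp_bounded compact_continuous_image continuous_at_imp_continuous_on compact_Icc)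
  have bu: "bounded (u ` {0..2*pi})" unfolding u_def by (rule bdd[OF kepler_ellipse_deriv_t[OF e']])
  have bJ: "bounded ((\<lambda>t. J *v u t) ` {0..2*pi})" for J :: "real ^ 3 ^ 3"
    unfolding u_def
    by (rule bdd[where f' = "\<lambda>t. J *v ellipse_velocity e t"])
      (rule has_vector_derivative_matrix_mult[OF kepler_ellipse_deriv_t[OF e']])
  have bv: "bounded (ellipse_velocity e ` {0..2*pi})" by (rule bdd[OF ellipse_velocity_deriv[OF e']])
  have bw: "bounded (ellipse_deriv_e e ` {0..2*pi})" by (rule bdd[OF ellipse_deriv_e_deriv(1)[OF e']])
  have bsc: "bounded ((\<lambda>t. k *\<^sub>R f t) ` {0..2*pi})" if "bounded (f ` {0..2*pi})" for k and f :: curve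
    using bounded_scaling[OF that, of k] by (simp add: image_image)
  have bp: "bounded ((\<lambda>t. f t + g t) ` {0..2*pi})" if "bounded (f ` {0..2*pi})" "bounded (g ` {0..2*pi})"
    for f g :: curve
    using that by (rule bounded_plus_comp)
  have "uniform_limit {0..2*pi} (\<lambda>s t. (y s t - u t) /\<^sub>R s) (\<lambda>t. b *\<^sub>R ellipse_deriv_e e t + a *\<^sub>R ellipse_velocity e t) (at 0)"
    unfolding uniform_limit_iff
  proof (intro allI impI)
    fix \<epsilon> :: real assume "0 < \<epsilon>"
    \<comment> \<open>Adding 1 keeps N positive when a = b = 0. The tolerance \<epsilon> / (2 * N)
      then ends in \<epsilon> / 2, which leaves the inequality strict.\<close>
    define N where "N = norm (b, a) + 1"
    have "0 < N" by (simp add: N_def add_nonneg_pos)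
    obtain \<delta> where "0 < \<delta>" and \<delta>: "\<And>p h. \<lbrakk>p \<in> {e} \<times> {0..2*pi}; norm h < \<delta>\<rbrakk> \<Longrightarrow>
        p + h \<in> {p. \<bar>fst p\<bar> < 1} \<and> norm (kepler_ellipse (fst (p + h)) (snd (p + h)) - kepler_ellipse (fst p) (snd p)
          - (fst h *\<^sub>R ellipse_deriv_e (fst p) (snd p) + snd h *\<^sub>R ellipse_velocity (fst p) (snd p))) \<le> \<epsilon> / (2 * N) * norm h"
    proof (rule uniform_differentiability[of "{p. \<bar>fst p\<bar> < 1}" "{e} \<times> {0..2*pi}" "\<lambda>p. kepler_ellipse (fst p) (snd p)"
        "\<lambda>p h. fst h *\<^sub>R ellipse_deriv_e (fst p) (snd p) + snd h *\<^sub>R ellipse_velocity (fst p) (snd p)" "\<epsilon> / (2 * N)"])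
      show "compact ({e} \<times> {0..2*pi})" by (intro compact_Times compact_Icc) simp
      show "((\<lambda>p. kepler_ellipse (fst p) (snd p)) has_derivative
          (\<lambda>h. fst h *\<^sub>R ellipse_deriv_e (fst p) (snd p) + snd h *\<^sub>R ellipse_velocity (fst p) (snd p))) (at p)"
        if "p \<in> {p. \<bar>fst p\<bar> < 1}" for p
        using has_derivative_kepler_ellipse[of "fst p" "snd p"] that by simp
      have nz: "1 - fst p * cos (ecc_anomaly (fst p) (snd p)) \<noteq> 0" "sqrt (1 - (fst p)\<^sup>2) \<noteq> 0"
        if "p \<in> {p. \<bar>fst p\<bar> < 1}" for p
        using one_minus_e_cos_pos(1)[of "fst p" "ecc_anomaly (fst p) (snd p)"] ellipse_parameters(1)[of "fst p"] that by auto
      show "continuous_on {p. \<bar>fst p\<bar> < 1}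
          (\<lambda>p. fst h *\<^sub>R ellipse_deriv_e (fst p) (snd p) + snd h *\<^sub>R ellipse_velocity (fst p) (snd p))" for h :: "real \<times> real"
        unfolding ellipse_deriv_e_def ellipse_velocity_def Let_def
        by (intro continuous_intros continuous_on_vector_3 continuous_on_ecc_anomaly ballI nz)
    qed (use e' \<open>0 < \<epsilon>\<close> \<open>0 < N\<close> in \<open>auto simp: open_eccentricities\<close>)
    have "((\<lambda>s. \<bar>s\<bar> * N) \<longlongrightarrow> \<bar>0\<bar> * N) (at (0::real))" by (intro tendsto_intros)
    then have 1: "\<forall>\<^sub>F s in at (0::real). \<bar>s\<bar> * N < \<delta>"
      using order_tendstoD(2) \<open>0 < \<delta>\<close> by fastforce
    have 2: "\<forall>\<^sub>F s::real in at 0. s \<noteq> 0" by (simp add: eventually_at_filter)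
    show "\<forall>\<^sub>F s in at 0. \<forall>t\<in>{0..2*pi}. dist ((y s t - u t) /\<^sub>R s) (b *\<^sub>R ellipse_deriv_e e t + a *\<^sub>R ellipse_velocity e t) < \<epsilon>"
      using 1 2
    proof eventually_elim
      case (elim s)
      show ?case
      proof
        fix t :: real assume t: "t \<in> {0..2*pi}"
        let ?w = "b *\<^sub>R ellipse_deriv_e e t + a *\<^sub>R ellipse_velocity e t"
        have nh: "norm (s * b, s * a) = \<bar>s\<bar> * norm (b, a)"
          using norm_scaleR[of s "(b, a)"] by simp
        also have le: "\<dots> \<le> \<bar>s\<bar> * N" by (intro mult_left_mono) (auto simp: N_def)
        finally have "norm (s * b, s * a) < \<delta>" using elim by simp
        from \<delta>[OF _ this, of "(e, t)"] t
        have "norm (y s t - u t - s *\<^sub>R ?w) \<le> \<epsilon> / (2 * N) * norm (s * b, s * a)"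
          by (simp add: y_def u_def scaleR_add_right)
        also have "\<dots> \<le> \<epsilon> / (2 * N) * (\<bar>s\<bar> * N)"
          unfolding nh using \<open>0 < \<epsilon>\<close> \<open>0 < N\<close> by (intro mult_left_mono le) auto
        also have "\<dots> = \<bar>s\<bar> * (\<epsilon> / 2)" using \<open>0 < N\<close> by simp
        finally have "norm (y s t - u t - s *\<^sub>R ?w) \<le> \<bar>s\<bar> * (\<epsilon> / 2)" .
        moreover have "y s t - u t - s *\<^sub>R ?w = s *\<^sub>R ((y s t - u t) /\<^sub>R s - ?w)"
          using elim by (simp add: scaleR_diff_right)
        ultimately have "\<bar>s\<bar> * norm ((y s t - u t) /\<^sub>R s - ?w) \<le> \<bar>s\<bar> * (\<epsilon> / 2)"
          by (metis norm_scaleR)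
        then have "norm ((y s t - u t) /\<^sub>R s - ?w) \<le> \<epsilon> / 2" using elim by simp
        then show "dist ((y s t - u t) /\<^sub>R s) ?w < \<epsilon>" using \<open>0 < \<epsilon>\<close> by (simp add: dist_norm)
      qed
    qed
  qed
  \<comment> \<open>Folding and unfolding \<open>zero\<close> lets the conclusion of each rotation
    serve as the hypothesis of the next; the boundedness premises accumulate and are discharged in
    \<open>lim\<close>.\<close>
  note l0 = this[folded zero(1)]
  note l3 = uniform_limit_rotate[OF J_cubed(3) l0, of c3, folded y3_def, unfolded zero, folded zero(2)]
  note l2 = uniform_limit_rotate[OF J_cubed(2) l3, of c2, folded y2_def, unfolded zero, folded zero(3)]
  note l1 = uniform_limit_rotate[OF J_cubed(1) l2, of c1, folded \<gamma>_def, unfolded zero]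
  have lim: "uniform_limit {0..2*pi} (\<lambda>s t. (\<gamma> s t - u t) /\<^sub>R s) \<eta> (at 0)"
  proof -
    have "uniform_limit {0..2*pi} (\<lambda>s t. (\<gamma> s t - u t) /\<^sub>R s)
      (\<lambda>t. b *\<^sub>R ellipse_deriv_e e t + a *\<^sub>R ellipse_velocity e t + c3 *\<^sub>R (J3 *v u t) + c2 *\<^sub>R (J2 *v u t) + c1 *\<^sub>R (J1 *v u t)) (at 0)"
      by (intro l1 bu bp bsc bv bw bJ)
    moreover have "(\<lambda>t. b *\<^sub>R ellipse_deriv_e e t + a *\<^sub>R ellipse_velocity e t + c3 *\<^sub>R (J3 *v u t) + c2 *\<^sub>R (J2 *v u t) + c1 *\<^sub>R (J1 *v u t)) = \<eta>"
      by (auto simp: eq algebra_simps)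
    ultimately show ?thesis by simp
  qed
  \<comment> \<open>The curve must stay in the manifold for s of both signs; e > 0 leaves room to
    lower the eccentricity.\<close>
  have "open {s. 0 < e + s * b \<and> e + s * b < 1}"
    by (intro open_Collect_conj open_Collect_less continuous_intros)
  from eventually_nhds_in_open[OF this, of 0]
  have "\<forall>\<^sub>F s in nhds 0. 0 < e + s * b \<and> e + s * b < 1"
    using e by simp
  then have M: "\<forall>\<^sub>F s in nhds 0. \<gamma> s \<in> kepler_manifold"
  proof eventually_elim
    case (elim s)
    have "\<gamma> s = (\<lambda>t. rotation (s *\<^sub>R vector [c1, c2, c3]) *v kepler_ellipse (e + s * b) (t + s * a))"
      by (simp add: fun_eq_iff \<gamma>_def y2_def y3_def y_def rotation_mult)
    then show ?case using kepler_manifoldI[of "e + s * b" "s *\<^sub>R vector [c1, c2, c3]" "s * a"] elim by simp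
  qed
  show "\<eta> \<in> tangent_space kepler_manifold u"
  proof (rule tangent_spaceI[OF _ \<eta> zero(4) M lim])
    show "u \<in> kepler_manifold" unfolding u_def using e by (intro kepler_ellipse_in_manifold) auto
  qed
qed

theorem proposition3:
  fixes e :: real
  assumes "0 < e" and "e < 1"
  defines "u \<equiv> kepler_ellipse e"
  defines "L \<equiv> kepler_hessian u"
  shows "nondegenerate_critical_manifold kepler_action kepler_domain kepler_manifold u \<and>
    has_L2_hessian kepler_action kepler_domain u L \<and>
    operator_kernel L =
      span {velocity u, kepler_ellipse_deriv_e e,
            (\<lambda>t. J1 *v u t), (\<lambda>t. J2 *v u t), (\<lambda>t. J3 *v u t)} \<and>
    dim (operator_kernel L) = 5 \<and>
    operator_kernel L = tangent_space kepler_manifold u"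
proof -
  have e: "\<bar>e\<bar> < 1" using assms(1,2) by simp
  have uM: "u \<in> kepler_manifold"
    unfolding u_def using assms(1,2) by (intro kepler_ellipse_in_manifold) auto
  have basis: "kernel_basis e = {velocity u, kepler_ellipse_deriv_e e,
            (\<lambda>t. J1 *v u t), (\<lambda>t. J2 *v u t), (\<lambda>t. J3 *v u t)}"
    unfolding u_def kepler_ellipse_domain(2)[OF e] kepler_ellipse_deriv_e_eq[OF e] ..
  have hess: "has_L2_hessian kepler_action kepler_domain u L"
    unfolding L_def by (rule has_L2_hessian_kepler[OF kepler_manifoldD(1)[OF uM]])
  have ker: "operator_kernel L = span (kernel_basis e)"
    unfolding L_def u_def by (rule operator_kernel_eq_span[OF assms(1,2)])
  have dim: "dim (operator_kernel L) = 5"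
    unfolding ker using dim_span_eq_card_independent[OF independent_kernel_basis(1)[OF assms(1,2)]]
      independent_kernel_basis(2)[OF assms(1,2)] by simp
  have tan: "operator_kernel L = tangent_space kepler_manifold u"
    unfolding L_def
  proof
    show "operator_kernel (kepler_hessian u) \<subseteq> tangent_space kepler_manifold u"
      unfolding u_def by (rule kernel_subset_tangent_space[OF assms(1,2)])
  qed (rule tangent_space_subset_kernel[OF uM])
  have "nondegenerate_critical_manifold kepler_action kepler_domain kepler_manifold u"
    unfolding nondegenerate_critical_manifold_def using uM has_L2_gradient_manifold hess tan by blast
  with hess ker dim tan show ?thesis unfolding basis by blast
qed

end
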